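(* Let $d\ge 1$ and let $(k,\ell)$ be a pair of diagonal holomorphic kernels on a domain $\Omega\subseteq\mathbb{C}^d$ with $\mathbf{0}\in\Omega$. Then $(k,\ell)$ is a complete Pick pair if and only if there exists a strong Shimorin certificate for $(k,\ell)$.
   Context: A kernel on a non-empty set $X$ is a function $k:X\times X\to\mathbb{C}$ such that $[k(z_i,z_j)]_{i,j=1}^n$ is positive semi-definite for all $n$ and all $z_1,\dots,z_n\in X$; $\mathcal{H}_k$ is the associated reproducing kernel Hilbert space. For kernels $k,\ell$ on $X$ and $N\ge1$, $\mathrm{Mult}(\mathcal{H}_k\otimes\mathbb{C}^N,\mathcal{H}_\ell\otimes\mathbb{C}^N)$ is the set of functions $\Phi:X\to\mathbb{M}_N$ (with $\mathbb{M}_N$ the complex $N\times N$ matrices) such that $\Phi f\in\mathcal{H}_\ell\otimes\mathbb{C}^N$ for all $f\in\mathcal{H}_k\otimes\mathbb{C}^N$; the norm of $\Phi$ is the operator norm of $M_\Phi:f\mapsto\Phi f$. A pair $(k,\ell)$ of kernels on $X$ is a complete Pick pair if for all positive integers $n,N$, all points $z_1,\dots,z_n\in X$ and all $W_1,\dots,W_n\in\mathbb{M}_N$ such that the block matrix $[\ell(z_i,z_j)I_{N\times N}-k(z_i,z_j)W_iW_j^*]_{i,j=1}^n$ is positive semi-definite, there is $\Phi\in\mathrm{Mult}(\mathcal{H}_k\otimes\mathbb{C}^N,\mathcal{H}_\ell\otimes\mathbb{C}^N)$ of norm at most one with $\Phi(z_i)=W_i$ for $i=1,\dots,n$. A kernel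 $s$ is a complete Pick kernel if $(s,s)$ is a complete Pick pair. A strong Shimorin certificate for $(k,\ell)$ is a complete Pick kernel $s$ on $X$ for which there exist kernels $h,g$ on $X$ with $k=(1-h)s$ and $\ell=sg$. A domain is an open, connected, non-empty set. For a domain $\Omega\subseteq\mathbb{C}^d$ containing $\mathbf{0}$, a diagonal holomorphic kernel on $\Omega$ is a kernel $f:\Omega\times\Omega\to\mathbb{C}$, holomorphic in $z$ and conjugate holomorphic in $w$, for which there are positive numbers $\{f_a\}_{a\in\mathbb{N}^d}$ (with $0\in\mathbb{N}$) such that the power series expansion of $f$ at $\mathbf{0}$ has the form $f(z,w)=\sum_{a\in\mathbb{N}^d}f_az^a\overline{w}^a$. *)

theory Defs
  imports "HOL-Analysis.Analysis" "Jordan_Normal_Form.Schur_Decomposition"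
begin

no_notation Matrix.vec_index (infixl "$" 100)

section \<open>Kernels\<close>

text \<open>The order on \<open>complex\<close> is that of \<open>HOL-Library.Complex_Order\<close>: \<open>0 \<le> x\<close> says that \<open>x\<close> is
  real and non-negative.\<close>

definition pos_semidef :: "complex mat \<Rightarrow> bool" where
  "pos_semidef A \<longleftrightarrow> square_mat A \<and> (\<forall>v \<in> carrier_vec (dim_row A). 0 \<le> (A *\<^sub>v v) \<bullet>c v)"

definition psd_kernel :: "'a set \<Rightarrow> ('a \<Rightarrow> 'a \<Rightarrow> complex) \<Rightarrow> bool" where
  "psd_kernel X k \<longleftrightarrow> X \<noteq> {} \<and>
     (\<forall>n (z :: nat \<Rightarrow> 'a). (\<forall>i<n. z i \<in> X) \<longrightarrow> pos_semidef (Matrix.mat n n (\<lambda>(i, j). k (z i) (z j))))"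


section \<open>Reproducing kernel Hilbert spaces\<close>

text \<open>A function on the set \<open>X\<close> is represented by the total function that is \<open>0\<close> outside \<open>X\<close>.
  Inner products are linear in the first argument.  They are \<open>0\<close> by convention when an argument
  is not in the space, so that a function space is determined by its elements and the inner
  products between them.\<close>

record 'a function_space =
  elems :: "('a \<Rightarrow> complex) set"
  inprod :: "('a \<Rightarrow> complex) \<Rightarrow> ('a \<Rightarrow> complex) \<Rightarrow> complex"

definition fs_norm :: "'a function_space \<Rightarrow> ('a \<Rightarrow> complex) \<Rightarrow> real" where
  "fs_norm H f = sqrt (Re (inprod H f f))"

definition hilbert_function_space :: "'a set \<Rightarrow> 'a function_space \<Rightarrow> bool" where
  "hilbert_function_space X H \<longleftrightarrow>
     (\<forall>f \<in> elems H. \<forall>z. z \<notin> X \<longrightarrow> f z = 0) \<and>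
     (\<lambda>z. 0) \<in> elems H \<and>
     (\<forall>f \<in> elems H. \<forall>g \<in> elems H. (\<lambda>z. f z + g z) \<in> elems H) \<and>
     (\<forall>c. \<forall>f \<in> elems H. (\<lambda>z. c * f z) \<in> elems H) \<and>
     (\<forall>f \<in> elems H. \<forall>g \<in> elems H. \<forall>h \<in> elems H.
        inprod H (\<lambda>z. f z + g z) h = inprod H f h + inprod H g h) \<and>
     (\<forall>c. \<forall>f \<in> elems H. \<forall>g \<in> elems H. inprod H (\<lambda>z. c * f z) g = c * inprod H f g) \<and>
     (\<forall>f \<in> elems H. \<forall>g \<in> elems H. inprod H g f = cnj (inprod H f g)) \<and>
     (\<forall>f \<in> elems H. 0 \<le> inprod H f f) \<and>
     (\<forall>f \<in> elems H. inprod H f f = 0 \<longrightarrow> f = (\<lambda>z. 0)) \<and>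
     (\<forall>f g. f \<notin> elems H \<or> g \<notin> elems H \<longrightarrow> inprod H f g = 0) \<and>
     (\<forall>u :: nat \<Rightarrow> 'a \<Rightarrow> complex.
        (\<forall>n. u n \<in> elems H) \<longrightarrow>
        (\<forall>e>0. \<exists>M. \<forall>m\<ge>M. \<forall>n\<ge>M. fs_norm H (\<lambda>z. u m z - u n z) < e) \<longrightarrow>
        (\<exists>f \<in> elems H. (\<lambda>n. fs_norm H (\<lambda>z. u n z - f z)) \<longlonglongrightarrow> 0))"

definition kernel_section :: "'a set \<Rightarrow> ('a \<Rightarrow> 'a \<Rightarrow> complex) \<Rightarrow> 'a \<Rightarrow> 'a \<Rightarrow> complex" where
  "kernel_section X k w = (\<lambda>z. if z \<in> X then k z w else 0)"

definition is_rkhs :: "'a set \<Rightarrow> ('a \<Rightarrow> 'a \<Rightarrow> complex) \<Rightarrow> 'a function_space \<Rightarrow> bool" where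
  "is_rkhs X k H \<longleftrightarrow> hilbert_function_space X H \<and>
     (\<forall>w \<in> X. kernel_section X k w \<in> elems H \<and>
        (\<forall>f \<in> elems H. inprod H f (kernel_section X k w) = f w))"

text \<open>By the Moore--Aronszajn theorem every kernel has exactly one such space.\<close>

definition rkhs :: "'a set \<Rightarrow> ('a \<Rightarrow> 'a \<Rightarrow> complex) \<Rightarrow> 'a function_space" where
  "rkhs X k = (THE H. is_rkhs X k H)"


section \<open>Matrix-valued multipliers\<close>

text \<open>The Hilbert space tensor product of \<open>H\<close> with \<open>\<complex>\<^sup>N\<close> is, as usual, identified with the space of
  \<open>\<complex>\<^sup>N\<close>-valued functions whose components are in \<open>H\<close>; its norm squared is the sum of those of the
  components.  The elements vanish outside \<open>X\<close>, because their components do.\<close>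

definition tensor_elems :: "'a function_space \<Rightarrow> nat \<Rightarrow> ('a \<Rightarrow> complex vec) set" where
  "tensor_elems H N =
     {f. (\<forall>z. f z \<in> carrier_vec N) \<and> (\<forall>i<N. (\<lambda>z. vec_index (f z) i) \<in> elems H)}"

definition tensor_norm :: "'a function_space \<Rightarrow> nat \<Rightarrow> ('a \<Rightarrow> complex vec) \<Rightarrow> real" where
  "tensor_norm H N f = sqrt (\<Sum>i<N. (fs_norm H (\<lambda>z. vec_index (f z) i))\<^sup>2)"

definition mult_op :: "'a set \<Rightarrow> nat \<Rightarrow> ('a \<Rightarrow> complex mat) \<Rightarrow> ('a \<Rightarrow> complex vec) \<Rightarrow> 'a \<Rightarrow> complex vec" where
  "mult_op X N \<Phi> f = (\<lambda>z. if z \<in> X then \<Phi> z *\<^sub>v f z else 0\<^sub>v N)"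

definition Mult ::
  "'a set \<Rightarrow> ('a \<Rightarrow> 'a \<Rightarrow> complex) \<Rightarrow> ('a \<Rightarrow> 'a \<Rightarrow> complex) \<Rightarrow> nat \<Rightarrow> ('a \<Rightarrow> complex mat) set" where
  "Mult X k l N =
     {\<Phi>. (\<forall>z\<in>X. \<Phi> z \<in> carrier_mat N N) \<and>
          (\<forall>f \<in> tensor_elems (rkhs X k) N. mult_op X N \<Phi> f \<in> tensor_elems (rkhs X l) N)}"

definition mult_norm ::
  "'a set \<Rightarrow> ('a \<Rightarrow> 'a \<Rightarrow> complex) \<Rightarrow> ('a \<Rightarrow> 'a \<Rightarrow> complex) \<Rightarrow> nat \<Rightarrow> ('a \<Rightarrow> complex mat) \<Rightarrow> ennreal" where
  "mult_norm X k l N \<Phi> =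
     (SUP f \<in> {f \<in> tensor_elems (rkhs X k) N. tensor_norm (rkhs X k) N f \<le> 1}.
        ennreal (tensor_norm (rkhs X l) N (mult_op X N \<Phi> f)))"


section \<open>Complete Pick pairs and Shimorin certificates\<close>

text \<open>The \<open>nN \<times> nN\<close> block matrix with \<open>N \<times> N\<close> blocks \<open>l(z\<^sub>i, z\<^sub>j) I - k(z\<^sub>i, z\<^sub>j) W\<^sub>i W\<^sub>j\<^sup>*\<close>.\<close>

definition pick_matrix ::
  "('a \<Rightarrow> 'a \<Rightarrow> complex) \<Rightarrow> ('a \<Rightarrow> 'a \<Rightarrow> complex) \<Rightarrow> nat \<Rightarrow> nat \<Rightarrow> (nat \<Rightarrow> 'a) \<Rightarrow> (nat \<Rightarrow> complex mat) \<Rightarrow> complex mat" where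
  "pick_matrix k l n N z W =
     Matrix.mat (n * N) (n * N) (\<lambda>(p, q).
       let i = p div N; j = q div N in
       (l (z i) (z j) \<cdot>\<^sub>m 1\<^sub>m N - k (z i) (z j) \<cdot>\<^sub>m (W i * mat_adjoint (W j))) $$ (p mod N, q mod N))"

definition complete_pick_pair ::
  "'a set \<Rightarrow> ('a \<Rightarrow> 'a \<Rightarrow> complex) \<Rightarrow> ('a \<Rightarrow> 'a \<Rightarrow> complex) \<Rightarrow> bool" where
  "complete_pick_pair X k l \<longleftrightarrow> psd_kernel X k \<and> psd_kernel X l \<and>
     (\<forall>n N z W. n \<ge> 1 \<longrightarrow> N \<ge> 1 \<longrightarrow>
        (\<forall>i<n. z i \<in> X) \<longrightarrow> (\<forall>i<n. W i \<in> carrier_mat N N) \<longrightarrow>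
        pos_semidef (pick_matrix k l n N z W) \<longrightarrow>
        (\<exists>\<Phi> \<in> Mult X k l N. mult_norm X k l N \<Phi> \<le> 1 \<and> (\<forall>i<n. \<Phi> (z i) = W i)))"

definition complete_pick_kernel :: "'a set \<Rightarrow> ('a \<Rightarrow> 'a \<Rightarrow> complex) \<Rightarrow> bool" where
  "complete_pick_kernel X s \<longleftrightarrow> complete_pick_pair X s s"

definition strong_shimorin_certificate ::
  "'a set \<Rightarrow> ('a \<Rightarrow> 'a \<Rightarrow> complex) \<Rightarrow> ('a \<Rightarrow> 'a \<Rightarrow> complex) \<Rightarrow> ('a \<Rightarrow> 'a \<Rightarrow> complex) \<Rightarrow> bool" where
  "strong_shimorin_certificate X k l s \<longleftrightarrow> complete_pick_kernel X s \<and>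
     (\<exists>h g. psd_kernel X h \<and> psd_kernel X g \<and>
        (\<forall>z\<in>X. \<forall>w\<in>X. k z w = (1 - h z w) * s z w \<and> l z w = s z w * g z w))"


section \<open>Diagonal holomorphic kernels\<close>

definition holomorphic_several :: "(complex ^ 'd) set \<Rightarrow> (complex ^ 'd \<Rightarrow> complex) \<Rightarrow> bool" where
  "holomorphic_several \<Omega> f \<longleftrightarrow>
     (\<forall>z\<in>\<Omega>. \<exists>D. (f has_derivative D) (at z) \<and> (\<forall>c v. D (c *s v) = c * D v))"

definition vec_monom :: "complex ^ 'd \<Rightarrow> nat ^ 'd \<Rightarrow> complex" where
  "vec_monom z a = (\<Prod>i\<in>UNIV. (z $ i) ^ (a $ i))"

text \<open>The expansion at \<open>0\<close> is a statement about a neighbourhood of \<open>(0, 0)\<close> only: the series need not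
  converge on the whole of \<open>\<Omega> \<times> \<Omega>\<close>.\<close>

definition diagonal_holomorphic_kernel ::
  "(complex ^ 'd) set \<Rightarrow> (complex ^ 'd \<Rightarrow> complex ^ 'd \<Rightarrow> complex) \<Rightarrow> bool" where
  "diagonal_holomorphic_kernel \<Omega> f \<longleftrightarrow> psd_kernel \<Omega> f \<and>
     (\<forall>w\<in>\<Omega>. holomorphic_several \<Omega> (\<lambda>z. f z w)) \<and>
     (\<forall>z\<in>\<Omega>. holomorphic_several \<Omega> (\<lambda>w. cnj (f z w))) \<and>
     (\<exists>c :: nat ^ 'd \<Rightarrow> real. (\<forall>a. c a > 0) \<and>
        (\<exists>r>0. ball 0 r \<subseteq> \<Omega> \<and>
           (\<forall>z \<in> ball 0 r. \<forall>w \<in> ball 0 r.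
              ((\<lambda>a. of_real (c a) * vec_monom z a * cnj (vec_monom w a)) has_sum f z w) UNIV)))"

end

theory Submission
  imports Defs "HOL-Complex_Analysis.Complex_Analysis"
begin

text \<open>
  Write \<open>f\<^sub>w\<close> for the function \<open>f(\<cdot>, w)\<close>, write \<open>f\<^sup>w = f - f\<^sub>w f\<^sub>w\<^sup>* / f(w, w)\<close> for the Schur complement of a
  kernel \<open>f\<close>, that is, the kernel of the functions that vanish at \<open>w\<close>, and order kernels by positivity of
  the difference.

  The adjoint of multiplication by \<open>\<Phi>\<close> maps \<open>l\<^sub>z \<otimes> u\<close> to \<open>k\<^sub>z \<otimes> \<Phi>(z)\<^sup>* u\<close>. Hence \<open>\<Phi>\<close> is a contractive multiplier
  exactly when the matrix kernel \<open>l I - k \<Phi> \<Phi>\<^sup>*\<close> is positive (\<open>psd_of_contractive_multiplier\<close>,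
  \<open>contractive_multiplier_of_psd\<close>), and interpolation asks for the extension of a function with this
  property from a finite set. By compactness it is enough to add one point \<open>w\<close> at a time, and by a
  matrix completion argument a value at \<open>w\<close> exists as soon as \<open>l\<^sup>w I - k\<^sup>w \<Phi> \<Phi>\<^sup>*\<close> is positive
  (\<open>one_point_extension\<close>). If \<open>F\<close> is positive with \<open>F l \<le> l\<^sup>w\<close> and \<open>k\<^sup>w \<le> F k\<close>, this follows from
  \<open>l\<^sup>w I - k\<^sup>w \<Phi> \<Phi>\<^sup>* = F (l I - k \<Phi> \<Phi>\<^sup>*) + (l\<^sup>w - F l) I + (F k - k\<^sup>w) \<Phi> \<Phi>\<^sup>*\<close>. So \<open>(k, l)\<close> is a complete
  Pick pair if there is such an \<open>F\<close> for every \<open>w\<close> (\<open>complete_pick_pair_of_certificate\<close>).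

  A strong Shimorin certificate provides these. By the theorem of McCullough and Quiggin
  (\<open>complete_pick_kernel_certificate\<close>), \<open>F = 1 - s\<^sub>w s\<^sub>w\<^sup>* / (s(w, w) s)\<close> is positive for a complete Pick kernel
  \<open>s\<close>, and it serves every pair \<open>k = (1 - h) s\<close>, \<open>l = s g\<close>
  (\<open>extension_certificate_of_factorization\<close>). Conversely, if \<open>F\<close> is positive with \<open>F(z, z) < 1\<close>, then the
  constant multiples of \<open>1 / (1 - F)\<close> are complete Pick kernels (\<open>complete_pick_kernel_of_ball_kernel\<close>).

  To find a certificate for a diagonal complete Pick pair, take the base point \<open>0\<close>: there \<open>k\<^sup>0 = k - k\<^sub>0\<close> and
  \<open>l\<^sup>0 = l - l\<^sub>0\<close> just lack the constant terms. If a positive \<open>F\<close> satisfies \<open>F l \<le> l - l\<^sub>0\<close> and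
  \<open>k - k\<^sub>0 \<le> F k\<close>, then \<open>s = k\<^sub>0 / (1 - F)\<close>, \<open>h = (F k - k + k\<^sub>0) / k\<^sub>0\<close> and \<open>g = (l - F l) / k\<^sub>0\<close> do what is
  required. A diagonal \<open>F\<close> is found greedily: each coefficient in turn is the least non-negative number for which
  \<open>k - k\<^sub>0 \<le> F k\<close> holds at its index. The Pick property has to show that \<open>F l \<le> l - l\<^sub>0\<close> for this \<open>F\<close>.

  This is done by testing the pair on rows. For data \<open>W\<close> with \<open>W W\<^sup>* = \<Xi>\<close> the Pick property says
  that \<open>k \<Xi> \<le> l\<close> on a finite set implies \<open>k\<^sup>0 \<Xi> \<le> l\<^sup>0\<close> there (\<open>row_extension\<close>). Take for \<open>\<Xi>\<close> a diagonal
  polynomial with coefficients \<open>x\<close>, and as points a fixed number of points tending to \<open>0\<close>. The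
  hypothesis concerns only the coefficients of \<open>l - k \<Xi>\<close> up to some index, while a suitable combination of
  evaluations singles out the next coefficient, \<open>m\<close>, in the conclusion. So if the convolution \<open>x * k\<close>
  is at most \<open>l\<close> before \<open>m\<close>, then it is at most \<open>l\<close> at \<open>m\<close> (\<open>coefficient_test\<close>). In order that multi-indices be linearly
  ordered and the combination exist, the points lie on the curve \<open>t \<mapsto> (p\<^sub>1\<^sup>-\<^sup>t, \<dots>, p\<^sub>d\<^sup>-\<^sup>t)\<close> for distinct
  primes \<open>p\<^sub>i\<close>, on which monomials become the functions \<open>n\<^sup>-\<^sup>t\<close> for distinct integers \<open>n\<close>. With \<open>x\<close> chosen such that
  \<open>x * k = l\<close> at the indices that contribute to \<open>F * l\<close> at \<open>m\<close>, and supported where \<open>F * k = k\<close> at the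
  complementary index, \<open>F * l = F * (x * k) = x * (F * k) = x * k \<le> l\<close> at \<open>m\<close> (\<open>greedy_coefficients\<close>).

  The kernels must finally be defined on all of \<open>\<Omega>\<close>, not only near \<open>0\<close>. Positivity of a diagonal
  holomorphic kernel on \<open>\<Omega>\<close> forces its power series to converge there, by Bessel's inequality for the monomials
  (\<open>diagonal_kernel_series\<close>), and the coefficients of \<open>F\<close> are dominated by those of \<open>l\<close>.
\<close>

no_notation fps_nth (infixl "$" 75)

section \<open>Positive semi-definite functions\<close>

definition herm_form :: "'a set \<Rightarrow> ('a \<Rightarrow> 'a \<Rightarrow> complex) \<Rightarrow> ('a \<Rightarrow> complex) \<Rightarrow> ('a \<Rightarrow> complex) \<Rightarrow> complex"
  where "herm_form S A c d = (\<Sum>x\<in>S. \<Sum>y\<in>S. cnj (c x) * A x y * d y)"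

definition psd :: "'a set \<Rightarrow> ('a \<Rightarrow> 'a \<Rightarrow> complex) \<Rightarrow> bool" where
  "psd X A \<longleftrightarrow> (\<forall>S c. finite S \<longrightarrow> S \<subseteq> X \<longrightarrow> 0 \<le> herm_form S A c c)"

text \<open>If \<open>A w w = 0\<close> and \<open>A\<close> is positive semi-definite, then the row and the column of \<open>w\<close> vanish, and the
  convention for division by \<open>0\<close> makes the complement equal to \<open>A\<close>, as it should be.\<close>

definition schur_compl :: "('a \<Rightarrow> 'a \<Rightarrow> complex) \<Rightarrow> 'a \<Rightarrow> 'a \<Rightarrow> 'a \<Rightarrow> complex" where
  "schur_compl A w = (\<lambda>x y. A x y - A x w * A w y / A w w)"

lemma psdI: "(\<And>S c. finite S \<Longrightarrow> S \<subseteq> X \<Longrightarrow> 0 \<le> herm_form S A c c) \<Longrightarrow> psd X A"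
  by (auto simp: psd_def)

lemma psdD: "psd X A \<Longrightarrow> finite S \<Longrightarrow> S \<subseteq> X \<Longrightarrow> 0 \<le> herm_form S A c c"
  by (auto simp: psd_def)

lemma complex_nonneg_iff: "(0::complex) \<le> z \<longleftrightarrow> z = of_real (Re z) \<and> 0 \<le> Re z"
  by (auto simp: less_eq_complex_def complex_eq_iff)

lemma herm_form_cong:
  assumes "\<And>x y. x \<in> S \<Longrightarrow> y \<in> S \<Longrightarrow> A x y = B x y" "\<And>x. x \<in> S \<Longrightarrow> c x = c' x" "\<And>x. x \<in> S \<Longrightarrow> d x = d' x"
  shows "herm_form S A c d = herm_form S B c' d'"
  unfolding herm_form_def using assms by (auto intro!: sum.cong)

lemma herm_form_extend:
  assumes "finite T" "S \<subseteq> T"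
  shows "herm_form S A c d =
    herm_form T A (\<lambda>x. if x \<in> S then c x else 0) (\<lambda>x. if x \<in> S then d x else 0)"
proof -
  have "herm_form T A (\<lambda>x. if x \<in> S then c x else 0) (\<lambda>x. if x \<in> S then d x else 0) =
     (\<Sum>x\<in>T. if x \<in> S then \<Sum>y\<in>T. if y \<in> S then cnj (c x) * A x y * d y else 0 else 0)"
    unfolding herm_form_def by (auto intro!: sum.cong)
  also have "\<dots> = (\<Sum>x\<in>S. \<Sum>y\<in>S. cnj (c x) * A x y * d y)"
    using assms by (simp add: sum.inter_restrict[symmetric] Int_absorb1)
  finally show ?thesis by (simp add: herm_form_def)
qed

lemma psd_finite_iff:
  assumes "finite S" shows "psd S A \<longleftrightarrow> (\<forall>c. 0 \<le> herm_form S A c c)"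
proof
  assume *: "\<forall>c. 0 \<le> herm_form S A c c"
  show "psd S A"
  proof (rule psdI)
    fix T c assume "T \<subseteq> S"
    then show "0 \<le> herm_form T A c c" using herm_form_extend[OF assms, of T A c c] * by simp
  qed
qed (auto intro: psdD assms)

lemma psd_subset: "psd X A \<Longrightarrow> Y \<subseteq> X \<Longrightarrow> psd Y A"
  by (auto simp: psd_def)

lemma psd_cong: "(\<And>x y. x \<in> X \<Longrightarrow> y \<in> X \<Longrightarrow> A x y = B x y) \<Longrightarrow> psd X A \<longleftrightarrow> psd X B"
  unfolding psd_def by (intro all_cong1 imp_cong refl, subst herm_form_cong[where B = B]) auto

lemma herm_form_add_right: "herm_form S A c (\<lambda>x. d x + e x) = herm_form S A c d + herm_form S A c e"
  by (simp add: herm_form_def algebra_simps sum.distrib)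

lemma herm_form_add_left: "herm_form S A (\<lambda>x. d x + e x) c = herm_form S A d c + herm_form S A e c"
  by (simp add: herm_form_def algebra_simps sum.distrib)

lemma herm_form_scale_right: "herm_form S A c (\<lambda>x. t * d x) = t * herm_form S A c d"
  by (simp add: herm_form_def algebra_simps sum_distrib_left)

lemma herm_form_scale_left: "herm_form S A (\<lambda>x. t * d x) c = cnj t * herm_form S A d c"
  by (simp add: herm_form_def algebra_simps sum_distrib_left)

lemmas herm_form_simps = herm_form_add_right herm_form_add_left herm_form_scale_right herm_form_scale_left

lemma psd_diag: assumes "psd X A" "x \<in> X" shows "0 \<le> A x x"
  using psdD[OF assms(1), of "{x}" "\<lambda>_. 1"] assms(2) by (simp add: herm_form_def)

lemma psd_hermitian: assumes "psd X A" "x \<in> X" "y \<in> X" shows "A y x = cnj (A x y)"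
proof (cases "x = y")
  case True
  then show ?thesis using psd_diag[OF assms(1,2)] by (auto simp: complex_nonneg_iff complex_eq_iff)
next
  case False
  have *: "0 \<le> cnj (c x) * A x x * c x + cnj (c y) * A y y * c y +
     (cnj (c x) * A x y * c y + cnj (c y) * A y x * c x)" for c
    using psdD[OF assms(1), of "{x,y}" c] assms(2,3) False by (simp add: herm_form_def algebra_simps)
  have d: "Im (A x x) = 0" "Im (A y y) = 0"
    using psd_diag[OF assms(1)] assms(2,3) by (auto simp: less_eq_complex_def)
  have "Im (A x y + A y x) = 0" using *[of "\<lambda>_. 1"] d by (auto simp: less_eq_complex_def)
  moreover have "Im (\<i> * A x y - \<i> * A y x) = 0"
    using *[of "\<lambda>z. if z = y then \<i> else 1"] d False by (auto simp: less_eq_complex_def)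
  ultimately show ?thesis by (auto simp: complex_eq_iff)
qed

lemma herm_form_hermitian:
  assumes "\<And>x y. x \<in> S \<Longrightarrow> y \<in> S \<Longrightarrow> A y x = cnj (A x y)" shows "herm_form S A d c = cnj (herm_form S A c d)"
proof -
  have "cnj (herm_form S A c d) = (\<Sum>x\<in>S. \<Sum>y\<in>S. c x * cnj (A x y) * cnj (d y))"
    by (simp add: herm_form_def)
  also have "\<dots> = (\<Sum>x\<in>S. \<Sum>y\<in>S. cnj (d y) * A y x * c x)"
    by (intro sum.cong refl) (simp only: assms[symmetric] mult_ac)
  also have "\<dots> = herm_form S A d c"
    unfolding herm_form_def by (rule sum.swap)
  finally show ?thesis by simp
qed

lemma psd_Cauchy_Schwarz:
  assumes A: "psd X A" and S: "finite S" "S \<subseteq> X"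
  shows "(cmod (herm_form S A c d))\<^sup>2 \<le> Re (herm_form S A c c) * Re (herm_form S A d d)"
proof -
  define al be ga where "al = Re (herm_form S A c c)" and "be = herm_form S A c d"
    and "ga = Re (herm_form S A d d)"
  have al: "herm_form S A c c = of_real al" "0 \<le> al" and ga: "herm_form S A d d = of_real ga" "0 \<le> ga"
    using psdD[OF A S] by (auto simp: complex_nonneg_iff al_def ga_def)
  have dc: "herm_form S A d c = cnj be"
    unfolding be_def by (rule herm_form_hermitian) (use psd_hermitian[OF A] S in auto)
  have *: "0 \<le> al + 2 * Re (t * be) + (cmod t)\<^sup>2 * ga" for t
  proof -
    have "0 \<le> herm_form S A (\<lambda>x. c x + t * d x) (\<lambda>x. c x + t * d x)"
      by (rule psdD[OF A S])
    also have "\<dots> = of_real al + (t * be + cnj (t * be)) + (t * cnj t) * of_real ga"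
      by (simp add: herm_form_simps al ga dc be_def[symmetric] algebra_simps)
    also have "\<dots> = of_real (al + 2 * Re (t * be) + (cmod t)\<^sup>2 * ga)"
      by (simp only: complex_add_cnj complex_norm_square[symmetric] of_real_add of_real_mult of_real_power of_real_numeral)
    finally show ?thesis by (simp add: less_eq_complex_def)
  qed
  show ?thesis
  proof (cases "ga = 0")
    case True
    have "be = 0"
    proof (rule ccontr)
      assume "be \<noteq> 0"
      \<comment> \<open>With \<open>ga = 0\<close> the form is affine in \<open>t\<close>, and this multiple of \<open>cnj be\<close> gives it the value \<open>- al - 2\<close>.\<close>
      define s where "s = (al + 1) / (cmod be)\<^sup>2"
      have "Re (- of_real s * cnj be * be) = - s * (cmod be)\<^sup>2"
        by (simp add: complex_norm_square[symmetric] mult.assoc mult.commute[of "cnj be"] flip: of_real_power)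
      also have "\<dots> = - (al + 1)" using \<open>be \<noteq> 0\<close> by (simp add: s_def)
      finally show False using *[of "- of_real s * cnj be"] True al(2) by simp
    qed
    then show ?thesis using al ga by (simp add: be_def al_def[symmetric] ga_def[symmetric])
  next
    case False
    then have "ga > 0" using ga by simp
    \<comment> \<open>The form is least at \<open>t = - cnj be / ga\<close>.\<close>
    have 1: "Re (- cnj be / of_real ga * be) = - (cmod be)\<^sup>2 / ga"
      by (simp add: complex_norm_square[symmetric] mult.commute[of "cnj be"] Re_divide_of_real flip: of_real_power)
    have 2: "(cmod (- cnj be / of_real ga))\<^sup>2 = (cmod be)\<^sup>2 / ga\<^sup>2"
      by (simp add: norm_divide power_divide)
    have "0 \<le> al - (cmod be)\<^sup>2 / ga"
      using *[of "- cnj be / of_real ga"] unfolding 1 2 using \<open>ga > 0\<close> by (simp add: power2_eq_square)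
    then show ?thesis using \<open>ga > 0\<close> by (simp add: field_simps be_def al_def ga_def)
  qed
qed

lemma psd_entry_bound:
  assumes A: "psd X A" and xy: "x \<in> X" "y \<in> X"
  shows "(cmod (A x y))\<^sup>2 \<le> Re (A x x) * Re (A y y)"
proof -
  have "herm_form {x,y} A (\<lambda>z. if z = u then 1 else 0) (\<lambda>z. if z = v then 1 else 0) = A u v"
    if "u \<in> {x,y}" "v \<in> {x,y}" for u v
    using that by (cases "x = y") (auto simp: herm_form_def)
  then show ?thesis
    using psd_Cauchy_Schwarz[OF A, of "{x,y}" "\<lambda>z. if z = x then 1 else 0" "\<lambda>z. if z = y then 1 else 0"] xy
    by simp
qed

lemma psd_zero_row:
  assumes "psd X A" "x \<in> X" "y \<in> X" "A x x = 0" shows "A x y = 0" "A y x = 0"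
  using psd_entry_bound[OF assms(1-3)] psd_hermitian[OF assms(1-3)] assms(4) by auto

lemma psd_add: "psd X A \<Longrightarrow> psd X B \<Longrightarrow> psd X (\<lambda>x y. A x y + B x y)"
  unfolding psd_def herm_form_def by (auto simp: algebra_simps sum.distrib)

lemma psd_zero: "psd X (\<lambda>x y. 0)"
  by (auto simp: psd_def herm_form_def)

lemma psd_sum: "(\<And>i. i \<in> I \<Longrightarrow> psd X (A i)) \<Longrightarrow> psd X (\<lambda>x y. \<Sum>i\<in>I. A i x y)"
  by (induction I rule: infinite_finite_induct) (auto intro: psd_zero psd_add)

lemma psd_scale: assumes "psd X A" "0 \<le> t" shows "psd X (\<lambda>x y. t * A x y)"
proof (rule psdI)
  fix S c assume "finite S" "S \<subseteq> X"
  then have "0 \<le> t * herm_form S A c c" using psdD[OF assms(1)] assms(2) by (intro mult_nonneg_nonneg) auto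
  then show "0 \<le> herm_form S (\<lambda>x y. t * A x y) c c"
    by (simp add: herm_form_def sum_distrib_left algebra_simps)
qed

lemma psd_conj_scale: assumes "psd X A" shows "psd X (\<lambda>x y. f x * A x y * cnj (f y))"
proof (rule psdI)
  fix S c assume "finite S" "S \<subseteq> X"
  then have "0 \<le> herm_form S A (\<lambda>x. cnj (f x) * c x) (\<lambda>x. cnj (f x) * c x)" using psdD[OF assms(1)] by auto
  then show "0 \<le> herm_form S (\<lambda>x y. f x * A x y * cnj (f y)) c c"
    by (simp add: herm_form_def algebra_simps)
qed

lemma psd_const: "psd X (\<lambda>x y. 1)"
proof (rule psdI)
  fix S and c :: "'a \<Rightarrow> complex" assume "finite S" "S \<subseteq> X"
  have "herm_form S (\<lambda>x y. 1) c c = cnj (\<Sum>x\<in>S. c x) * (\<Sum>x\<in>S. c x)"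
    by (simp add: herm_form_def sum_product)
  also have "\<dots> = of_real ((cmod (\<Sum>x\<in>S. c x))\<^sup>2)"
    by (simp only: mult.commute[of "cnj _"] complex_norm_square)
  finally show "0 \<le> herm_form S (\<lambda>x y. 1) c c"
    by (simp add: less_eq_complex_def)
qed

lemma psd_rank_one: "psd X (\<lambda>x y. f x * cnj (f y))"
  using psd_conj_scale[OF psd_const, of X f] by simp

text \<open>The map need not be injective: the coefficients of a form add up along its fibres.\<close>

lemma psd_pullback:
  assumes A: "psd X A" and p: "\<And>i. i \<in> I \<Longrightarrow> p i \<in> X"
  shows "psd I (\<lambda>i j. A (p i) (p j))"
proof (rule psdI)
  fix S and c :: "_ \<Rightarrow> complex" assume S: "finite S" "S \<subseteq> I"
  define c' where "c' x = (\<Sum>i\<in>{i\<in>S. p i = x}. c i)" for x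
  have inner: "(\<Sum>j\<in>S. f (p j) * c j) = (\<Sum>y\<in>p ` S. f y * c' y)" for f :: "_ \<Rightarrow> complex"
    unfolding c'_def using S(1) by (subst sum.image_gen[of S _ p]) (auto simp: sum_distrib_left intro!: sum.cong)
  have inner': "(\<Sum>j\<in>S. cnj (c j) * f (p j)) = (\<Sum>y\<in>p ` S. cnj (c' y) * f y)" for f :: "_ \<Rightarrow> complex"
    unfolding c'_def using S(1) by (subst sum.image_gen[of S _ p]) (auto simp: sum_distrib_right intro!: sum.cong)
  have "herm_form S (\<lambda>i j. A (p i) (p j)) c c = (\<Sum>i\<in>S. cnj (c i) * (\<Sum>j\<in>S. A (p i) (p j) * c j))"
    by (simp add: herm_form_def sum_distrib_left mult.assoc)
  also have "\<dots> = herm_form (p ` S) A c' c'"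
    by (simp only: inner inner'[of "\<lambda>x. \<Sum>y\<in>p ` S. A x y * c' y"]) (simp add: herm_form_def sum_distrib_left mult.assoc)
  finally show "0 \<le> herm_form S (\<lambda>i j. A (p i) (p j)) c c"
    using psdD[OF A, of "p ` S"] S p by auto
qed

lemma psd_limit:
  assumes lim: "\<And>x y. x \<in> X \<Longrightarrow> y \<in> X \<Longrightarrow> ((\<lambda>n. A n x y) \<longlongrightarrow> B x y) F"
    and A: "\<forall>\<^sub>F n in F. psd X (A n)" and F: "F \<noteq> bot"
  shows "psd X B"
proof (rule psdI)
  fix S c assume S: "finite S" "S \<subseteq> X"
  have t: "((\<lambda>n. herm_form S (A n) c c) \<longlongrightarrow> herm_form S B c c) F"
    unfolding herm_form_def using S lim by (intro tendsto_sum tendsto_mult tendsto_const) auto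
  have ev: "\<forall>\<^sub>F n in F. 0 \<le> herm_form S (A n) c c"
    using A by eventually_elim (use psdD S in auto)
  have "0 \<le> Re (herm_form S B c c)"
    using tendsto_Re[OF t] by (rule tendsto_lowerbound)
      (use ev F in \<open>auto elim!: eventually_mono simp: less_eq_complex_def\<close>)
  moreover have "((\<lambda>n. 0) \<longlongrightarrow> Im (herm_form S B c c)) F"
    using tendsto_Im[OF t] by (rule Lim_transform_eventually) (use ev in \<open>auto elim!: eventually_mono simp: less_eq_complex_def\<close>)
  then have "Im (herm_form S B c c) = 0" using F tendsto_const tendsto_unique by metis
  ultimately show "0 \<le> herm_form S B c c" by (simp add: less_eq_complex_def)
qed

lemma herm_form_diff_rank_one:
  "herm_form S (\<lambda>x y. A x y - f x * g y / t) c d =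
     herm_form S A c d - (\<Sum>x\<in>S. cnj (c x) * f x) * (\<Sum>y\<in>S. g y * d y) / t"
  proof -
  have "(\<Sum>x\<in>S. cnj (c x) * f x) * (\<Sum>y\<in>S. g y * d y) / t =
      (\<Sum>x\<in>S. \<Sum>y\<in>S. cnj (c x) * (f x * g y / t) * d y)"
    by (subst sum_product) (simp add: sum_divide_distrib mult_ac)
  then show ?thesis
    by (simp add: herm_form_def sum_subtractf right_diff_distrib left_diff_distrib)
qed

lemma herm_form_indicator_left:
  assumes "finite T" "w \<in> T"
  shows "herm_form T A (\<lambda>x. if x = w then 1 else 0) d = (\<Sum>y\<in>T. A w y * d y)"
proof -
  have "herm_form T A (\<lambda>x. if x = w then 1 else 0) d = (\<Sum>x\<in>T. if x = w then \<Sum>y\<in>T. A w y * d y else 0)"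
    unfolding herm_form_def by (intro sum.cong) auto
  then show ?thesis using assms by simp
qed

lemma psd_pivot_rank_one:
  assumes A: "psd X A" and w: "w \<in> X" shows "psd X (\<lambda>x y. A x w * A w y / A w w)"
proof -
  have "0 \<le> 1 / A w w"
    using psd_diag[OF A w] by (auto simp: less_eq_complex_def Re_divide Im_divide)
  then have "psd X (\<lambda>x y. 1 / A w w * (A x w * cnj (A y w)))" by (intro psd_scale psd_rank_one)
  then show ?thesis
    by (rule psd_cong[THEN iffD1, rotated]) (simp add: psd_hermitian[OF A _ w])
qed

text \<open>This is the Cauchy--Schwarz inequality between the basis vector of the pivot and an arbitrary vector.\<close>

lemma psd_schur_compl:
  assumes A: "psd X A" and w: "w \<in> X" shows "psd X (schur_compl A w)"
proof (rule psdI)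
  fix S and c :: "'a \<Rightarrow> complex" assume S: "finite S" "S \<subseteq> X"
  define T where "T = insert w S"
  have T: "finite T" "S \<subseteq> T" "T \<subseteq> X" "w \<in> T" using S w by (auto simp: T_def)
  define c' where "c' = (\<lambda>x. if x \<in> S then c x else 0)"
  define e where "e = (\<lambda>x. if x = w then (1::complex) else 0)"
  have e: "herm_form T A e e = A w w"
    unfolding e_def herm_form_indicator_left[OF T(1,4)] using T by (simp add: if_distrib cong: if_cong)
  have ec: "herm_form T A e c' = (\<Sum>y\<in>S. A w y * c y)"
    unfolding e_def herm_form_indicator_left[OF T(1,4)] c'_def
    using T by (intro sum.mono_neutral_cong_right) auto
  define b where "b = (\<Sum>y\<in>S. A w y * c y)"
  have b': "(\<Sum>x\<in>S. cnj (c x) * A x w) = cnj b"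
    unfolding b_def cnj_sum using S psd_hermitian[OF A w] by (intro sum.cong) auto
  obtain a where a: "A w w = of_real a" "a \<ge> 0" using psd_diag[OF A w] by (auto simp: complex_nonneg_iff)
  obtain q where q: "herm_form S A c c = of_real q" "q \<ge> 0" using psdD[OF A S] by (auto simp: complex_nonneg_iff)
  have "herm_form T A c' c' = herm_form S A c c"
    unfolding c'_def by (rule herm_form_extend[symmetric, OF T(1,2)])
  then have cs: "(cmod b)\<^sup>2 \<le> a * q"
    using psd_Cauchy_Schwarz[OF A T(1,3), of e c'] by (simp add: e ec b_def a q)
  have "herm_form S (schur_compl A w) c c = of_real (q - (cmod b)\<^sup>2 / a)"
    unfolding schur_compl_def herm_form_diff_rank_one b' b_def[symmetric] q a
    by (simp add: mult.commute[of "cnj _"] complex_norm_square[symmetric])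
  moreover have "(cmod b)\<^sup>2 / a \<le> q" using cs a q by (cases "a = 0") (auto simp: field_simps)
  ultimately show "0 \<le> herm_form S (schur_compl A w) c c"
    by (simp add: less_eq_complex_def del: of_real_diff of_real_divide of_real_power)
qed

lemma schur_compl_pivot:
  assumes "psd X A" "w \<in> X" "x \<in> X"
  shows "schur_compl A w w x = 0" "schur_compl A w x w = 0"
  using psd_zero_row[OF assms(1,2,3)] by (auto simp: schur_compl_def)

text \<open>Gaussian elimination: a column that borders a positive semi-definite matrix in a positive
  semi-definite way lies in its range, even when the matrix is singular.\<close>

lemma psd_border_in_range:
  assumes "finite J" "psd (insert q J) A"
  shows "\<exists>y. \<forall>j\<in>J. A j q = (\<Sum>i\<in>J. A j i * y i)"
  using assms
proof (induction J arbitrary: A rule: finite_induct)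
  case (insert i J)
  let ?X = "insert q (insert i J)"
  note A = insert.prems
  have "psd (insert q J) (schur_compl A i)"
    using psd_schur_compl[OF A, of i] by (rule psd_subset) auto
  then obtain y where y: "\<And>j. j \<in> J \<Longrightarrow> schur_compl A i j q = (\<Sum>i'\<in>J. schur_compl A i j i' * y i')"
    using insert.IH by blast
  define yi where "yi = (A i q - (\<Sum>j\<in>J. A i j * y j)) / A i i"
  have z: "A i x = 0" "A x i = 0" if "A i i = 0" "x \<in> ?X" for x
    using psd_zero_row[OF A, of i x] that by auto
  have i: "A i q = A i i * yi + (\<Sum>j\<in>J. A i j * y j)"
    using z by (cases "A i i = 0") (auto simp: yi_def)
  have "A j q = A j i * yi + (\<Sum>i'\<in>J. A j i' * y i')" if "j \<in> J" for j
  proof -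
    have "A j q = schur_compl A i j q + A j i * A i q / A i i" by (simp add: schur_compl_def)
    also have "schur_compl A i j q = (\<Sum>i'\<in>J. A j i' * y i') - A j i * (\<Sum>i'\<in>J. A i i' * y i') / A i i"
      by (subst y[OF that]) (simp add: schur_compl_def left_diff_distrib sum_subtractf sum_distrib_left sum_divide_distrib mult.assoc)
    finally show ?thesis by (simp add: yi_def diff_divide_distrib right_diff_distrib)
  qed
  with i insert.hyps have "\<forall>j\<in>insert i J. A j q = (\<Sum>i'\<in>insert i J. A j i' * (y(i := yi)) i')"
    by (auto intro!: sum.cong)
  then show ?case by blast
qed auto

text \<open>Cholesky's algorithm: the pivot \<open>i\<close> contributes the column numbered \<open>N\<close>, and the Schur complement, whose row at \<open>i\<close>
  vanishes, contributes the others.\<close>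

lemma psd_Gram:
  assumes "finite S" "psd S A"
  shows "\<exists>N (b :: 'a \<Rightarrow> nat \<Rightarrow> complex). \<forall>x\<in>S. \<forall>y\<in>S. A x y = (\<Sum>r<N. b x r * cnj (b y r))"
  using assms
proof (induction S arbitrary: A rule: finite_induct)
  case (insert i J)
  note A = insert.prems
  have "psd J (schur_compl A i)"
    using psd_schur_compl[OF A, of i] by (rule psd_subset) auto
  then obtain N and b :: "'a \<Rightarrow> nat \<Rightarrow> complex" where
    b: "\<And>x y. x \<in> J \<Longrightarrow> y \<in> J \<Longrightarrow> schur_compl A i x y = (\<Sum>r<N. b x r * cnj (b y r))"
    using insert.IH by blast
  define b' where "b' x r = (if r = N then A x i / of_real (sqrt (Re (A i i))) else if x = i then 0 else b x r)" for x r
  have sq: "of_real (sqrt (Re (A i i))) * of_real (sqrt (Re (A i i))) = A i i"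
    using psd_diag[OF A, of i] by (simp add: complex_nonneg_iff flip: of_real_mult)
  have 1: "b' x N * cnj (b' y N) = A x i * A i y / A i i" if "x \<in> insert i J" "y \<in> insert i J" for x y
    using psd_hermitian[OF A, of y i] that by (simp add: b'_def sq)
  have 2: "(\<Sum>r<N. b' x r * cnj (b' y r)) = schur_compl A i x y" if "x \<in> insert i J" "y \<in> insert i J" for x y
  proof (cases "x = i \<or> y = i")
    case True
    then have "schur_compl A i x y = 0" using schur_compl_pivot[OF A, of i] that by auto
    moreover have "(\<Sum>r<N. b' x r * cnj (b' y r)) = 0" using True by (intro sum.neutral) (auto simp: b'_def)
    ultimately show ?thesis by simp
  next
    case False
    then show ?thesis using that b[of x y] by (auto simp: b'_def intro!: sum.cong)
  qed
  have "A x y = (\<Sum>r<Suc N. b' x r * cnj (b' y r))" if "x \<in> insert i J" "y \<in> insert i J" for x y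
    using that by (simp add: 1 2 schur_compl_def)
  then show ?case by blast
qed auto

lemma psd_Gram_kernel: "psd X (\<lambda>x y. \<Sum>r\<in>R. b x r * cnj (b y r))"
  by (intro psd_sum psd_rank_one)

text \<open>The Schur product theorem: a Gram factorization of \<open>A\<close> reduces it to \<open>A\<close> of rank one.\<close>

lemma psd_mult:
  assumes A: "psd X A" and B: "psd X B" shows "psd X (\<lambda>x y. A x y * B x y)"
proof (rule psdI)
  fix S c assume S: "finite S" "S \<subseteq> X"
  obtain N and b :: "'a \<Rightarrow> nat \<Rightarrow> complex" where
    b: "\<forall>x\<in>S. \<forall>y\<in>S. A x y = (\<Sum>r<N. b x r * cnj (b y r))"
    using psd_Gram[OF S(1) psd_subset[OF A S(2)]] by blast
  have "psd S (\<lambda>x y. \<Sum>r<N. b x r * B x y * cnj (b y r))"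
    by (intro psd_sum psd_conj_scale psd_subset[OF B S(2)])
  then have "psd S (\<lambda>x y. A x y * B x y)"
    by (subst psd_cong[where B = "\<lambda>x y. \<Sum>r<N. b x r * B x y * cnj (b y r)"])
       (auto simp: b sum_distrib_left mult_ac)
  then show "0 \<le> herm_form S (\<lambda>x y. A x y * B x y) c c" by (rule psdD) (use S in auto)
qed

lemma psd_power: "psd X A \<Longrightarrow> psd X (\<lambda>x y. A x y ^ n)"
  by (induction n) (auto intro: psd_const psd_mult)

lemma psd_geometric:
  assumes A: "psd X A" and lt: "\<And>x. x \<in> X \<Longrightarrow> Re (A x x) < 1"
  shows "\<And>x y. x \<in> X \<Longrightarrow> y \<in> X \<Longrightarrow> cmod (A x y) < 1" and "psd X (\<lambda>x y. 1 / (1 - A x y))"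
proof -
  show less: "cmod (A x y) < 1" if "x \<in> X" "y \<in> X" for x y
  proof -
    have "Re (A x x) * Re (A y y) < 1 * 1"
      using psd_diag[OF A] lt that by (intro mult_strict_mono') (auto simp: less_eq_complex_def)
    then have "(cmod (A x y))\<^sup>2 < 1" using psd_entry_bound[OF A that] by linarith
    then show ?thesis by (simp add: power_less_one_iff abs_square_less_1)
  qed
  show "psd X (\<lambda>x y. 1 / (1 - A x y))"
  proof (rule psd_limit[where F = sequentially and A = "\<lambda>n x y. \<Sum>i<n. A x y ^ i"])
    show "(\<lambda>n. \<Sum>i<n. A x y ^ i) \<longlonglongrightarrow> 1 / (1 - A x y)" if "x \<in> X" "y \<in> X" for x y
      using geometric_sums[OF less[OF that]] by (simp add: sums_def)
  qed (auto intro!: always_eventually psd_sum psd_power A)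
qed

section \<open>Completing partially specified positive semi-definite matrices\<close>

lemma herm_form_restrict:
  assumes "finite T" "S \<subseteq> T" "\<And>x. x \<in> T - S \<Longrightarrow> c x = 0" "\<And>x. x \<in> T - S \<Longrightarrow> d x = 0"
  shows "herm_form T A c d = herm_form S A c d"
  using herm_form_extend[OF assms(1,2), of A c d] assms(3,4)
  by (auto intro!: herm_form_cong)

lemma psd_zero_extend:
  fixes A :: "'a \<Rightarrow> 'a \<Rightarrow> complex"
  assumes A: "psd S A" and z: "\<And>x y. x \<in> T - S \<Longrightarrow> y \<in> T \<Longrightarrow> A x y = 0 \<and> A y x = 0"
  shows "psd T A"
proof (rule psdI)
  fix U and c :: "'a \<Rightarrow> complex" assume U: "finite U" "U \<subseteq> T"
  define c' where "c' x = (if x \<in> S then c x else 0)" for x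
  have "herm_form U A c c = herm_form U A c' c'"
    unfolding herm_form_def using U z by (intro sum.cong refl) (auto simp: c'_def subset_iff)
  also have "\<dots> = herm_form (U \<inter> S) A c' c'"
    by (rule herm_form_restrict) (use U in \<open>auto simp: c'_def\<close>)
  finally show "0 \<le> herm_form U A c c" using psdD[OF A] U by auto
qed

lemma psd_delta: "psd X (\<lambda>x y. if x = y then 1 else 0)"
proof (rule psdI)
  fix S c assume S: "finite S"
  have "herm_form S (\<lambda>x y. if x = y then 1 else 0) c c = (\<Sum>x\<in>S. of_real ((cmod (c x))\<^sup>2))"
    unfolding herm_form_def using S
    by (intro sum.cong refl) (simp add: if_distrib if_distribR mult.commute[of "cnj _"] cong: if_cong flip: complex_norm_square)
  also have "\<dots> = of_real (\<Sum>x\<in>S. (cmod (c x))\<^sup>2)" by simp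
  finally show "0 \<le> herm_form S (\<lambda>x y. if x = y then 1 else 0) c c"
    by (simp add: less_eq_complex_def sum_nonneg)
qed

text \<open>The basis vector \<open>q\<close> minus its projection \<open>y q\<close> to the span of \<open>J\<close> is orthogonal to \<open>J\<close>. The
  unspecified entries, those between \<open>P\<close> and \<open>Q\<close>, are chosen so that it is also orthogonal to \<open>P\<close>.\<close>

lemma psd_block_completion:
  fixes A :: "'i \<Rightarrow> 'i \<Rightarrow> complex"
  assumes fin: "finite J" "finite P" "finite Q"
    and disj: "J \<inter> P = {}" "J \<inter> Q = {}" "P \<inter> Q = {}"
    and JP: "psd (J \<union> P) A" and JQ: "psd (J \<union> Q) A"
  shows "\<exists>B. psd (J \<union> P \<union> Q) B \<and> (\<forall>i\<in>J \<union> P. \<forall>j\<in>J \<union> P. B i j = A i j) \<and>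
     (\<forall>i\<in>J \<union> Q. \<forall>j\<in>J \<union> Q. B i j = A i j)"
proof -
  have "\<exists>y. \<forall>j\<in>J. A j q = (\<Sum>i\<in>J. A j i * y i)" if "q \<in> Q" for q
    by (rule psd_border_in_range[OF fin(1) psd_subset[OF JQ]]) (use that in auto)
  then obtain y where y: "\<And>q j. q \<in> Q \<Longrightarrow> j \<in> J \<Longrightarrow> A j q = (\<Sum>i\<in>J. A j i * y q i)" by metis
  define x where "x p q = (\<Sum>i\<in>J. A p i * y q i)" for p q
  define B where "B i j = (if i \<in> P \<and> j \<in> Q then x i j else if i \<in> Q \<and> j \<in> P then cnj (x j i) else A i j)" for i j
  define T where "T = J \<union> P \<union> Q"
  have T: "finite T" using fin by (simp add: T_def)
  have BP: "B i j = A i j" if "i \<in> J \<union> P" "j \<in> J \<union> P" for i j using that disj by (auto simp: B_def)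
  have BQ: "B i j = A i j" if "i \<in> J \<union> Q" "j \<in> J \<union> Q" for i j using that disj by (auto simp: B_def)
  have Bh: "B j i = cnj (B i j)" if "i \<in> T" "j \<in> T" for i j
    using that psd_hermitian[OF JP, of i j] psd_hermitian[OF JQ, of i j] disj by (auto simp: B_def T_def)
  have BiQ: "B i q = (\<Sum>j\<in>J. A i j * y q j)" if "i \<in> J \<union> P" "q \<in> Q" for i q
    using that disj y by (auto simp: B_def x_def)
  have "0 \<le> herm_form T B c c" for c
  proof -
    \<comment> \<open>The part \<open>v\<close> of \<open>c\<close> is orthogonal to \<open>J \<union> P\<close>, and \<open>u\<close> is supported there.\<close>
    define s where "s i = (\<Sum>q\<in>Q. c q * y q i)" for i
    define u where "u i = (if i \<in> Q then 0 else if i \<in> J then c i + s i else c i)" for i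
    define v where "v i = (if i \<in> Q then c i else if i \<in> J then - s i else 0)" for i
    have c: "c = (\<lambda>i. u i + v i)" by (auto simp: u_def v_def fun_eq_iff)
    have "cnj (u i) * (\<Sum>j\<in>T. B i j * v j) = 0" if "i \<in> T" for i
    proof (cases "i \<in> Q")
      case False
      then have i: "i \<in> J \<union> P" using that by (auto simp: T_def)
      have "(\<Sum>j\<in>T. B i j * v j) = (\<Sum>j\<in>J \<union> Q. B i j * v j)"
        using T disj by (intro sum.mono_neutral_right) (auto simp: T_def v_def)
      also have "\<dots> = (\<Sum>j\<in>J. B i j * v j) + (\<Sum>j\<in>Q. B i j * v j)"
        using fin disj by (intro sum.union_disjoint) auto
      also have "(\<Sum>j\<in>J. B i j * v j) = (\<Sum>j\<in>J. - (\<Sum>q\<in>Q. A i j * (c q * y q j)))"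
        using i disj by (intro sum.cong refl) (auto simp: v_def s_def BP sum_distrib_left)
      also have "\<dots> = - (\<Sum>q\<in>Q. \<Sum>j\<in>J. A i j * (c q * y q j))"
        by (simp add: sum_negf sum.swap[of _ Q J])
      also have "\<dots> = - (\<Sum>q\<in>Q. B i q * v q)"
        using i by (simp add: BiQ v_def sum_distrib_left mult_ac)
      finally show ?thesis by simp
    qed (simp add: u_def)
    then have uv: "herm_form T B u v = 0"
      by (simp add: herm_form_def mult.assoc flip: sum_distrib_left)
    have vu: "herm_form T B v u = cnj (herm_form T B u v)"
      by (rule herm_form_hermitian) (rule Bh)
    have "herm_form T B u u = herm_form (J \<union> P) A u u"
      by (subst herm_form_restrict[of T "J \<union> P"]) (use T BP in \<open>auto simp: T_def u_def intro!: herm_form_cong\<close>)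
    then have uu: "0 \<le> herm_form T B u u" using psdD[OF JP] fin by auto
    have "herm_form T B v v = herm_form (J \<union> Q) A v v"
      by (subst herm_form_restrict[of T "J \<union> Q"]) (use T BQ disj in \<open>auto simp: T_def v_def intro!: herm_form_cong\<close>)
    then have vv: "0 \<le> herm_form T B v v" using psdD[OF JQ] fin by auto
    have "herm_form T B c c = herm_form T B u u + herm_form T B v v"
      by (subst (1 2) c) (simp add: herm_form_add_left herm_form_add_right uv vu)
    then show ?thesis using uu vv by simp
  qed
  then have "psd T B" using psd_finite_iff[OF T] by blast
  then show ?thesis using BP BQ unfolding T_def by blast
qed

text \<open>The vectors of \<open>Q\<close> are orthogonal, so that they can be eliminated one after the other without
  changing each other's pivots.\<close>

lemma psd_schur_compl_block:
  assumes "finite Q" "psd (X \<union> Q) B" "\<And>q r. q \<in> Q \<Longrightarrow> r \<in> Q \<Longrightarrow> B q r = (if q = r then t else 0)"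
  shows "psd X (\<lambda>i j. B i j - (\<Sum>q\<in>Q. B i q * B q j / t))"
  using assms
proof (induction Q arbitrary: B rule: finite_induct)
  case empty
  then show ?case by simp
next
  case (insert q Q)
  have qr: "B q r = 0" "B r q = 0" if "r \<in> Q" for r using insert.prems(2)[of q r] insert.prems(2)[of r q] insert.hyps that by auto
  have t: "B q q = t" using insert.prems(2) by simp
  have "psd (X \<union> insert q Q) (schur_compl B q)" by (rule psd_schur_compl[OF insert.prems(1)]) simp
  then have 1: "psd (X \<union> Q) (schur_compl B q)" by (rule psd_subset) auto
  have 2: "schur_compl B q r r' = (if r = r' then t else 0)" if "r \<in> Q" "r' \<in> Q" for r r'
    using insert.prems(2)[of r r'] that qr by (simp add: schur_compl_def)
  have "psd X (\<lambda>i j. schur_compl B q i j - (\<Sum>r\<in>Q. schur_compl B q i r * schur_compl B q r j / t))"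
    by (rule insert.IH[OF 1 2])
  also have "(\<lambda>i j. schur_compl B q i j - (\<Sum>r\<in>Q. schur_compl B q i r * schur_compl B q r j / t)) =
     (\<lambda>i j. B i j - (\<Sum>q\<in>insert q Q. B i q * B q j / t))"
    using insert.hyps qr by (simp add: schur_compl_def t diff_diff_eq)
  finally show ?case .
qed

section \<open>Extending interpolation data\<close>

text \<open>The matrix kernel \<open>l I - k \<Phi> \<Phi>\<^sup>*\<close> as a scalar kernel: the matrix index becomes a second component of the
  points. Its positivity on \<open>X \<times> {..<N}\<close> is that of all its finite block matrices.\<close>

definition pick_kernel ::
  "('a \<Rightarrow> 'a \<Rightarrow> complex) \<Rightarrow> ('a \<Rightarrow> 'a \<Rightarrow> complex) \<Rightarrow> nat \<Rightarrow> ('a \<Rightarrow> nat \<Rightarrow> nat \<Rightarrow> complex) \<Rightarrow>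
    'a \<times> nat \<Rightarrow> 'a \<times> nat \<Rightarrow> complex" where
  "pick_kernel k l N \<Phi> p q =
     (if snd p = snd q then l (fst p) (fst q) else 0) -
     k (fst p) (fst q) * (\<Sum>c<N. \<Phi> (fst p) (snd p) c * cnj (\<Phi> (fst q) (snd q) c))"

lemma psd_diagonal_blocks:
  assumes "psd X l" "\<And>p. p \<in> I \<Longrightarrow> fst p \<in> X"
  shows "psd I (\<lambda>p q. if snd p = snd q then l (fst p) (fst q) else 0)"
proof -
  have "psd I (\<lambda>p q. (if snd p = snd q then 1 else 0) * l (fst p) (fst q))"
    by (intro psd_mult psd_pullback[OF psd_delta[of UNIV], where p = snd] psd_pullback[OF assms(1)] assms(2)) auto
  then show ?thesis by (rule back_subst[where P = "psd I"]) (auto simp: fun_eq_iff)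
qed

lemma psd_pick_scale:
  assumes k: "psd X k" and I: "\<And>p. p \<in> I \<Longrightarrow> fst p \<in> X"
  shows "psd I (\<lambda>p q. k (fst p) (fst q) * (\<Sum>c<N. \<Phi> (fst p) (snd p) c * cnj (\<Phi> (fst q) (snd q) c)))"
  by (intro psd_mult psd_pullback[OF k] psd_Gram_kernel I)

text \<open>A contraction \<open>T\<close> with \<open>T (l\<^sub>x \<otimes> u) = k\<^sub>x \<otimes> (\<Phi> x)\<^sup>* u\<close> for \<open>x \<in> E\<close> is to be extended to the vectors \<open>l\<^sub>w \<otimes> u\<close>. Let \<open>Q\<close> be the
  projection to \<open>k\<^sub>w \<otimes> \<complex>\<^sup>N\<close>. That \<open>1 - T\<^sup>* T\<close> is positive means that the block matrix with the diagonal blocks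
  \<open>1 - T\<^sup>* (1 - Q) T\<close> and \<open>1\<close> and the block \<open>T\<^sup>* Q\<close> off the diagonal is positive. In the index set, \<open>True\<close> marks the vectors
  \<open>l\<^sub>x \<otimes> e\<^sub>a\<close> and \<open>False\<close> the vectors \<open>k\<^sub>w \<otimes> e\<^sub>c\<close>. Since \<open>k\<^sup>w\<close> vanishes at \<open>w\<close>, the unknown value \<open>\<Phi> w\<close> enters only into
  the entries between \<open>l\<^sub>w\<close> and \<open>k\<^sub>w\<close>, and these are filled in by the completion.\<close>

lemma one_point_extension:
  assumes E: "finite E" "w \<notin> E" and k: "psd (insert w E) k" and l: "psd (insert w E) l"
    and kw: "k w w \<noteq> 0" and lw: "l w w \<noteq> 0"
    and H1: "psd (E \<times> {..<N}) (pick_kernel k l N \<Phi>)"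
    and H2: "psd (E \<times> {..<N}) (pick_kernel (schur_compl k w) (schur_compl l w) N \<Phi>)"
  shows "\<exists>D. psd (insert w E \<times> {..<N}) (pick_kernel k l N (\<Phi>(w := D)))"
proof -
  define J where "J = {True} \<times> E \<times> {..<N}"
  define P where "P = {True} \<times> {w} \<times> {..<N}"
  define Q where "Q = {False} \<times> {w} \<times> {..<N}"
  have fin: "finite J" "finite P" "finite Q" using E by (auto simp: J_def P_def Q_def)
  have disj: "J \<inter> P = {}" "J \<inter> Q = {}" "P \<inter> Q = {}" using E by (auto simp: J_def P_def Q_def)
  \<comment> \<open>The entry between the index \<open>i\<close> and \<open>k\<^sub>w \<otimes> e\<^sub>c\<close>; at \<open>l\<^sub>w\<close> the completion replaces it.\<close>
  define g where "g i c = (if fst i then k (fst (snd i)) w * \<Phi> (fst (snd i)) (snd (snd i)) c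
      else if snd (snd i) = c then k w w else 0)" for i :: "bool \<times> 'a \<times> nat" and c
  define A where "A i j =
     (if fst i \<and> fst j then pick_kernel (schur_compl k w) l N \<Phi> (snd i) (snd j)
      else (\<Sum>c<N. g i c * cnj (g j c)) / k w w)" for i j :: "bool \<times> 'a \<times> nat"
  have khe: "k w x = cnj (k x w)" if "x \<in> insert w E" for x using psd_hermitian[OF k _ , of x w] that by auto
  have kwr: "cnj (k w w) = k w w" using khe[of w] by simp
  have k0: "schur_compl k w w x = 0" "schur_compl k w x w = 0" if "x \<in> insert w E" for x
    using schur_compl_pivot[OF k, of w x] that by auto
  have l0: "schur_compl l w w x = 0" "schur_compl l w x w = 0" if "x \<in> insert w E" for x
    using schur_compl_pivot[OF l, of w x] that by auto
  have kpos: "0 \<le> 1 / k w w" and lpos: "0 \<le> 1 / l w w"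
    using psd_diag[OF k, of w] psd_diag[OF l, of w] by (auto simp: less_eq_complex_def complex_is_Real_iff[symmetric] Re_divide Im_divide)
  have JP: "psd (J \<union> P) A"
  proof -
    have "psd (insert w E \<times> {..<N}) (pick_kernel (schur_compl k w) (schur_compl l w) N \<Phi>)"
      using H2 by (rule psd_zero_extend) (auto simp: pick_kernel_def k0 l0)
    moreover have "psd (insert w E) (\<lambda>x y. 1 / l w w * (l x w * cnj (l y w)))"
      by (intro psd_scale psd_rank_one lpos)
    then have "psd (insert w E \<times> {..<N}) (\<lambda>p q. if snd p = snd q then 1 / l w w * (l (fst p) w * cnj (l (fst q) w)) else 0)"
      by (rule psd_diagonal_blocks) auto
    ultimately have "psd (insert w E \<times> {..<N}) (\<lambda>p q. pick_kernel (schur_compl k w) (schur_compl l w) N \<Phi> p q +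
        (if snd p = snd q then 1 / l w w * (l (fst p) w * cnj (l (fst q) w)) else 0))"
      by (rule psd_add)
    then have *: "psd (J \<union> P) (\<lambda>i j. pick_kernel (schur_compl k w) (schur_compl l w) N \<Phi> (snd i) (snd j) +
        (if snd (snd i) = snd (snd j) then 1 / l w w * (l (fst (snd i)) w * cnj (l (fst (snd j)) w)) else 0))"
      by (rule psd_pullback) (auto simp: J_def P_def)
    have lhe: "l x w * l w y / l w w = 1 / l w w * (l x w * cnj (l y w))" if "y \<in> insert w E" for x y
      using psd_hermitian[OF l, of y w] that by auto
    show ?thesis
      by (rule psd_cong[THEN iffD1, OF _ *])
         (auto simp: A_def J_def P_def pick_kernel_def schur_compl_def[of l] lhe simp del: times_divide_eq_left)
  qed
  have JQ: "psd (J \<union> Q) A"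
  proof -
    have "psd J (\<lambda>i j. if fst i \<and> fst j then pick_kernel k l N \<Phi> (snd i) (snd j) else 0)"
      by (subst psd_cong[where B = "\<lambda>i j. pick_kernel k l N \<Phi> (snd i) (snd j)"])
         (auto simp: J_def intro!: psd_pullback[OF H1])
    then have "psd (J \<union> Q) (\<lambda>i j. if fst i \<and> fst j then pick_kernel k l N \<Phi> (snd i) (snd j) else 0)"
      by (rule psd_zero_extend) (auto simp: J_def Q_def)
    moreover have "psd (J \<union> Q) (\<lambda>i j. 1 / k w w * (\<Sum>c<N. g i c * cnj (g j c)))"
      by (intro psd_scale kpos psd_Gram_kernel)
    ultimately have *: "psd (J \<union> Q) (\<lambda>i j. (if fst i \<and> fst j then pick_kernel k l N \<Phi> (snd i) (snd j) else 0) +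
        1 / k w w * (\<Sum>c<N. g i c * cnj (g j c)))"
      by (rule psd_add)
    have gg: "(\<Sum>c<N. g (True, x, a) c * cnj (g (True, y, b) c)) =
       k x w * k w y * (\<Sum>c<N. \<Phi> x a c * cnj (\<Phi> y b c))" if "x \<in> E" "y \<in> E" for x y a b
      using khe[of y] that by (simp add: g_def sum_distrib_left mult_ac)
    show ?thesis
      by (rule psd_cong[THEN iffD1, OF _ *])
         (auto simp: A_def J_def Q_def pick_kernel_def schur_compl_def[of k] left_diff_distrib gg)
  qed
  obtain B where B: "psd (J \<union> P \<union> Q) B"
    and BP: "\<And>i j. i \<in> J \<union> P \<Longrightarrow> j \<in> J \<union> P \<Longrightarrow> B i j = A i j"
    and BQ: "\<And>i j. i \<in> J \<union> Q \<Longrightarrow> j \<in> J \<union> Q \<Longrightarrow> B i j = A i j"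
    using psd_block_completion[OF fin disj JP JQ] by metis
  \<comment> \<open>The completed entries are those of \<open>k(w, w) D\<close>.\<close>
  define D where "D a b = B (True, w, a) (False, w, b) / k w w" for a b
  define \<Psi> where "\<Psi> = \<Phi>(w := D)"
  have delta: "(\<Sum>c<N. (if b = c then t else 0) * f c) = t * f b" "(\<Sum>c<N. f c * (if b = c then t else 0)) = f b * t"
    if "b < N" for b and t :: complex and f
  proof -
    have "(\<Sum>c<N. (if b = c then t else 0) * f c) = (\<Sum>c<N. if b = c then t * f c else 0)"
      "(\<Sum>c<N. f c * (if b = c then t else 0)) = (\<Sum>c<N. if b = c then f c * t else 0)"
      by (intro sum.cong; simp)+
    then show "(\<Sum>c<N. (if b = c then t else 0) * f c) = t * f b" "(\<Sum>c<N. f c * (if b = c then t else 0)) = f b * t"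
      using that by simp_all
  qed
  have cif: "cnj (if b = c then k w w else 0) = (if b = c then k w w else 0)" for b c :: nat
    using kwr by simp
  have QQ: "B q r = (if q = r then k w w else 0)" if "q \<in> Q" "r \<in> Q" for q r
  proof -
    have "B q r = A q r" using BQ that by auto
    also have "\<dots> = (if q = r then k w w else 0)"
      using that kw by (auto simp: A_def g_def Q_def delta cif simp del: mult_if_delta complex_cnj_zero_iff split: if_splits)
    finally show ?thesis .
  qed
  have LQ: "B (True, x, a) (False, w, b) = k x w * \<Psi> x a b" if "x \<in> insert w E" "a < N" "b < N" for x a b
  proof (cases "x = w")
    case True
    then show ?thesis using kw by (simp add: \<Psi>_def D_def)
  next
    case False
    then have "B (True, x, a) (False, w, b) = A (True, x, a) (False, w, b)"
      using that by (intro BQ) (auto simp: J_def Q_def)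
    also have "\<dots> = k x w * \<Phi> x a b"
      using that kw by (simp add: A_def g_def delta cif del: mult_if_delta)
    finally show ?thesis using False by (simp add: \<Psi>_def)
  qed
  have QL: "B (False, w, b) (True, x, a) = k w x * cnj (\<Psi> x a b)" if "x \<in> insert w E" "a < N" "b < N" for x a b
    using psd_hermitian[OF B, of "(True, x, a)" "(False, w, b)"] LQ[OF that] khe[of x] that
    by (auto simp: J_def P_def Q_def)
  have LL: "B (True, x, a) (True, y, b) = (if a = b then l x y else 0) -
       schur_compl k w x y * (\<Sum>c<N. \<Psi> x a c * cnj (\<Psi> y b c))"
    if "x \<in> insert w E" "y \<in> insert w E" "a < N" "b < N" for x y a b
  proof -
    have "B (True, x, a) (True, y, b) = A (True, x, a) (True, y, b)"
      using that by (intro BP) (auto simp: J_def P_def)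
    then show ?thesis using that k0 by (auto simp: A_def pick_kernel_def \<Psi>_def)
  qed
  \<comment> \<open>Eliminating the vectors \<open>k\<^sub>w \<otimes> e\<^sub>c\<close> brings in the part \<open>k\<^sub>w k\<^sub>w\<^sup>* / k(w, w)\<close> of \<open>k\<close>, which \<open>k\<^sup>w\<close> lacks.\<close>
  have "psd (J \<union> P) (\<lambda>i j. B i j - (\<Sum>q\<in>Q. B i q * B q j / k w w))"
    by (rule psd_schur_compl_block[OF fin(3) B QQ])
  then have *: "psd (insert w E \<times> {..<N}) (\<lambda>p q. B (True, p) (True, q) - (\<Sum>r\<in>Q. B (True, p) r * B r (True, q) / k w w))"
    by (rule psd_pullback) (auto simp: J_def P_def)
  have eq: "B (True, p) (True, q) - (\<Sum>r\<in>Q. B (True, p) r * B r (True, q) / k w w) = pick_kernel k l N \<Psi> p q"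
    if pq: "p \<in> insert w E \<times> {..<N}" "q \<in> insert w E \<times> {..<N}" for p q
  proof -
    obtain x a y b where [simp]: "p = (x, a)" "q = (y, b)" by (cases p, cases q)
    have "(\<Sum>r\<in>Q. B (True, p) r * B r (True, q) / k w w) =
        (\<Sum>c<N. B (True, x, a) (False, w, c) * B (False, w, c) (True, y, b) / k w w)"
      by (rule sum.reindex_bij_witness[where j = "\<lambda>r. snd (snd r)" and i = "\<lambda>c. (False, w, c)"]) (auto simp: Q_def)
    also have "\<dots> = k x w * k w y / k w w * (\<Sum>c<N. \<Psi> x a c * cnj (\<Psi> y b c))"
      using pq by (simp add: LQ QL sum_distrib_left mult_ac)
    finally show ?thesis using pq LL[of x y a b]
      by (auto simp: pick_kernel_def schur_compl_def left_diff_distrib)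
  qed
  have "psd (insert w E \<times> {..<N}) (pick_kernel k l N \<Psi>)"
    by (rule psd_cong[THEN iffD1, OF eq *])
  then show ?thesis unfolding \<Psi>_def by blast
qed

text \<open>With \<open>F\<close> as below, positivity of \<open>l I - k \<Phi> \<Phi>\<^sup>*\<close> implies the condition for extending \<open>\<Phi>\<close> to \<open>w\<close>, whatever
  \<open>\<Phi>\<close> is.\<close>

definition extension_certificate :: "'a set \<Rightarrow> ('a \<Rightarrow> 'a \<Rightarrow> complex) \<Rightarrow> ('a \<Rightarrow> 'a \<Rightarrow> complex) \<Rightarrow> bool" where
  "extension_certificate X k l \<longleftrightarrow> (\<forall>w\<in>X. k w w \<noteq> 0 \<and> l w w \<noteq> 0 \<and> (\<exists>F. psd X F \<and>
      psd X (\<lambda>x y. schur_compl l w x y - F x y * l x y) \<and>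
      psd X (\<lambda>x y. F x y * k x y - schur_compl k w x y)))"

lemma finite_extension:
  assumes k: "psd X k" and l: "psd X l" and cert: "extension_certificate X k l"
    and D: "finite D" "D \<subseteq> X" "psd (D \<times> {..<N}) (pick_kernel k l N \<Phi>)"
    and E: "finite E" "E \<subseteq> X"
  shows "\<exists>\<Psi>. psd ((D \<union> E) \<times> {..<N}) (pick_kernel k l N \<Psi>) \<and> (\<forall>x\<in>D. \<Psi> x = \<Phi> x)"
  using E
proof (induction E rule: finite_induct)
  case empty
  then show ?case using D by auto
next
  case (insert w E)
  then obtain \<Psi> where \<Psi>: "psd ((D \<union> E) \<times> {..<N}) (pick_kernel k l N \<Psi>)" "\<forall>x\<in>D. \<Psi> x = \<Phi> x" by auto
  have w: "w \<in> X" using insert.prems by auto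
  show ?case
  proof (cases "w \<in> D")
    case True
    then have "D \<union> insert w E = D \<union> E" by auto
    then show ?thesis using \<Psi> by auto
  next
    case False
    let ?E = "D \<union> E"
    have E: "finite ?E" "w \<notin> ?E" "?E \<subseteq> X" "insert w ?E \<subseteq> X" using D insert False by auto
    obtain F where F: "psd X F" and Fl: "psd X (\<lambda>x y. schur_compl l w x y - F x y * l x y)"
      and Fk: "psd X (\<lambda>x y. F x y * k x y - schur_compl k w x y)" and nz: "k w w \<noteq> 0" "l w w \<noteq> 0"
      using cert w unfolding extension_certificate_def by blast
    have X: "fst p \<in> X" if "p \<in> ?E \<times> {..<N}" for p :: "'a \<times> nat" using that E(3) by auto
    \<comment> \<open>The sum is \<open>l\<^sup>w I - k\<^sup>w \<Psi> \<Psi>\<^sup>*\<close>, because the terms that contain \<open>F\<close> cancel.\<close>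
    have "psd (?E \<times> {..<N}) (\<lambda>p q. F (fst p) (fst q) * pick_kernel k l N \<Psi> p q +
        ((if snd p = snd q then schur_compl l w (fst p) (fst q) - F (fst p) (fst q) * l (fst p) (fst q) else 0) +
         (F (fst p) (fst q) * k (fst p) (fst q) - schur_compl k w (fst p) (fst q)) *
            (\<Sum>c<N. \<Psi> (fst p) (snd p) c * cnj (\<Psi> (fst q) (snd q) c))))"
      by (intro psd_add psd_mult psd_pullback[OF F] \<Psi>(1) psd_diagonal_blocks[OF Fl] psd_pick_scale[OF Fk] X)
    then have "psd (?E \<times> {..<N}) (pick_kernel (schur_compl k w) (schur_compl l w) N \<Psi>)"
      by (rule back_subst[where P = "psd _"]) (auto simp: pick_kernel_def fun_eq_iff algebra_simps)
    then obtain V where V: "psd (insert w ?E \<times> {..<N}) (pick_kernel k l N (\<Psi>(w := V)))"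
      using one_point_extension[OF E(1,2) psd_subset[OF k E(4)] psd_subset[OF l E(4)] nz \<Psi>(1)] by blast
    then show ?thesis proof (intro exI conjI)
      show "psd ((D \<union> insert w E) \<times> {..<N}) (pick_kernel k l N (\<Psi>(w := V)))" using V by simp
      show "\<forall>x\<in>D. (\<Psi>(w := V)) x = \<Phi> x" using \<Psi>(2) False by (metis fun_upd_other)
    qed
  qed
qed

lemma pick_kernel_bound:
  assumes "psd (X \<times> {..<N}) (pick_kernel k l N \<Phi>)" "psd X k" "k x x \<noteq> 0" "x \<in> X" "a < N" "b < N"
  shows "cmod (\<Phi> x a b) \<le> sqrt (Re (l x x) / Re (k x x))"
proof -
  have k: "k x x = of_real (Re (k x x))" "0 < Re (k x x)"
    using psd_diag[OF assms(2,4)] assms(3) unfolding complex_nonneg_iff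
    by (metis, metis of_real_0 order_le_less)
  have "0 \<le> pick_kernel k l N \<Phi> (x, a) (x, a)" using assms by (intro psd_diag[OF assms(1)]) auto
  also have "\<dots> = l x x - k x x * (\<Sum>c<N. of_real ((cmod (\<Phi> x a c))\<^sup>2))"
    by (simp add: pick_kernel_def flip: complex_norm_square)
  also have "\<dots> = l x x - of_real (Re (k x x) * (\<Sum>c<N. (cmod (\<Phi> x a c))\<^sup>2))"
    by (subst k(1)) simp
  finally have "Re (k x x) * (\<Sum>c<N. (cmod (\<Phi> x a c))\<^sup>2) \<le> Re (l x x)"
    by (simp add: less_eq_complex_def del: of_real_mult of_real_sum of_real_power)
  moreover have "(cmod (\<Phi> x a b))\<^sup>2 \<le> (\<Sum>c<N. (cmod (\<Phi> x a c))\<^sup>2)"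
    using assms by (intro member_le_sum) auto
  ultimately have "(cmod (\<Phi> x a b))\<^sup>2 * Re (k x x) \<le> Re (l x x)"
    using k(2) by (smt (verit) mult.commute mult_left_mono)
  then have "(cmod (\<Phi> x a b))\<^sup>2 \<le> Re (l x x) / Re (k x x)" using k(2) by (simp add: pos_le_divide_eq)
  then show ?thesis by (metis real_le_rsqrt)
qed

lemma compact_PiE_type:
  assumes "\<And>i. compact (K i)"
  shows "compact (PiE UNIV K)"
  using compactin_PiE[of "\<lambda>i. euclidean" UNIV K] assms
  by (simp add: euclidean_product_topology)

text \<open>Extensions to the finite subsets are glued together by Tychonoff's theorem, since the entries at each
  point are bounded.\<close>

lemma global_extension:
  assumes k: "psd X k" and l: "psd X l" and cert: "extension_certificate X k l"
    and D: "finite D" "D \<subseteq> X" "psd (D \<times> {..<N}) (pick_kernel k l N \<Phi>)"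
  shows "\<exists>\<Psi>. psd (X \<times> {..<N}) (pick_kernel k l N \<Psi>) \<and> (\<forall>x\<in>D. \<forall>a<N. \<forall>b<N. \<Psi> x a b = \<Phi> x a b)"
proof -
  \<comment> \<open>Entries outside the range of interest are fixed at \<open>0\<close> in order that the product of all ranges be compact.\<close>
  define K :: "'a \<times> nat \<times> nat \<Rightarrow> complex set" where "K = (\<lambda>(x, a, b). if x \<in> X \<and> a < N \<and> b < N then cball 0 (sqrt (Re (l x x) / Re (k x x))) else {0})"
  define C where "C = (\<lambda>(S, c). {G. 0 \<le> herm_form S (pick_kernel k l N (\<lambda>x a b. G (x, a, b))) c c \<and>
     (\<forall>x\<in>D. \<forall>a<N. \<forall>b<N. G (x, a, b) = \<Phi> x a b)})"
  define I :: "(('a \<times> nat) set \<times> ('a \<times> nat \<Rightarrow> complex)) set" where "I = {(S, c). finite S \<and> S \<subseteq> X \<times> {..<N}}"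
  have cpt: "compact (PiE UNIV K)"
    by (rule compact_PiE_type) (auto simp: K_def split: prod.splits)
  have closed: "closed (C i)" if "i \<in> I" for i
  proof -
    obtain S c where [simp]: "i = (S, c)" by (cases i)
    have "continuous_on UNIV (\<lambda>G :: 'a \<times> nat \<times> nat \<Rightarrow> complex. herm_form S (pick_kernel k l N (\<lambda>x a b. G (x, a, b))) c c)"
      unfolding herm_form_def pick_kernel_def
      by (intro continuous_intros continuous_on_product_coordinates)
    then have "closed {G :: 'a \<times> nat \<times> nat \<Rightarrow> complex. 0 \<le> Re (herm_form S (pick_kernel k l N (\<lambda>x a b. G (x, a, b))) c c) \<and>
        Im (herm_form S (pick_kernel k l N (\<lambda>x a b. G (x, a, b))) c c) = 0}"
      by (intro closed_Collect_conj closed_Collect_le closed_Collect_eq continuous_intros)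
    moreover have "closed {G :: 'a \<times> nat \<times> nat \<Rightarrow> complex. \<forall>x\<in>D. \<forall>a\<in>{..<N}. \<forall>b\<in>{..<N}. G (x, a, b) = \<Phi> x a b}"
      unfolding Ball_def
      by (intro closed_Collect_all closed_Collect_imp closed_Collect_eq continuous_intros continuous_on_product_coordinates) auto
    ultimately have "closed ({G. 0 \<le> Re (herm_form S (pick_kernel k l N (\<lambda>x a b. G (x, a, b))) c c) \<and>
        Im (herm_form S (pick_kernel k l N (\<lambda>x a b. G (x, a, b))) c c) = 0} \<inter> {G. \<forall>x\<in>D. \<forall>a\<in>{..<N}. \<forall>b\<in>{..<N}. G (x, a, b) = \<Phi> x a b})"
      by (rule closed_Int)
    then show ?thesis
      by (rule back_subst[where P = closed]) (auto simp: C_def less_eq_complex_def)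
  qed
  have fip: "PiE UNIV K \<inter> \<Inter>(C ` F) \<noteq> {}" if F: "finite F" "F \<subseteq> I" for F
  proof -
    define E where "E = (\<Union>i\<in>F. fst ` fst i)"
    have E: "finite E" "E \<subseteq> X" using F by (fastforce simp: E_def I_def)+
    obtain \<Psi> where \<Psi>: "psd ((D \<union> E) \<times> {..<N}) (pick_kernel k l N \<Psi>)" "\<forall>x\<in>D. \<Psi> x = \<Phi> x"
      using finite_extension[OF k l cert D E] by blast
    define G where "G = (\<lambda>(x, a, b). if x \<in> D \<union> E \<and> a < N \<and> b < N then \<Psi> x a b else 0)"
    have "cmod (\<Psi> x a b) \<le> sqrt (Re (l x x) / Re (k x x))" if "x \<in> D \<union> E" "a < N" "b < N" for x a b
      using pick_kernel_bound[OF \<Psi>(1) psd_subset[OF k], of x a b] that D E cert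
      unfolding extension_certificate_def by auto
    moreover have "0 \<le> Re (l x x) / Re (k x x)" if "x \<in> X" for x
      using psd_diag[OF k that] psd_diag[OF l that] by (simp add: less_eq_complex_def)
    ultimately have "G i \<in> K i" for i
      using D E by (auto simp: G_def K_def split: prod.splits)
    then have 1: "G \<in> PiE UNIV K" by (auto simp: PiE_def)
    have 2: "G \<in> C i" if "i \<in> F" for i
    proof -
      obtain S c where [simp]: "i = (S, c)" by (cases i)
      have S: "finite S" "S \<subseteq> E \<times> {..<N}" using that F by (force simp: E_def I_def)+
      have "herm_form S (pick_kernel k l N (\<lambda>x a b. G (x, a, b))) c c = herm_form S (pick_kernel k l N \<Psi>) c c"
        by (rule herm_form_cong) (use S in \<open>auto simp: pick_kernel_def G_def intro!: sum.cong\<close>)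
      moreover have "0 \<le> herm_form S (pick_kernel k l N \<Psi>) c c"
        by (rule psdD[OF \<Psi>(1)]) (use S in auto)
      moreover have "\<forall>x\<in>D. \<forall>a<N. \<forall>b<N. G (x, a, b) = \<Phi> x a b" using \<Psi>(2) by (auto simp: G_def)
      ultimately show ?thesis by (auto simp: C_def)
    qed
    show ?thesis using 1 2 by auto
  qed
  have fipB: "PiE UNIV K \<inter> \<Inter>B \<noteq> {}" if B: "B \<subseteq> C ` I" "finite B" for B
  proof -
    obtain F where "F \<subseteq> I" "finite F" "B = C ` F" using finite_subset_image[OF B(2,1)] by blast
    then show ?thesis using fip by simp
  qed
  have "PiE UNIV K \<inter> \<Inter>(C ` I) \<noteq> {}"
  proof (rule compact_fip[THEN iffD1, rule_format, OF cpt])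
    show "closed Z" if "Z \<in> C ` I" for Z using that closed by blast
  qed (rule fipB)
  then obtain G where G: "\<And>i. i \<in> I \<Longrightarrow> G \<in> C i" by auto
  have "psd (X \<times> {..<N}) (pick_kernel k l N (\<lambda>x a b. G (x, a, b)))"
  proof (rule psdI)
    fix S c assume "finite S" "S \<subseteq> X \<times> {..<N}"
    then have "(S, c) \<in> I" by (auto simp: I_def)
    then show "0 \<le> herm_form S (pick_kernel k l N (\<lambda>x a b. G (x, a, b))) c c"
      using G by (force simp: C_def)
  qed
  moreover have "({}, \<lambda>_. 0) \<in> I" by (auto simp: I_def)
  then have "\<forall>x\<in>D. \<forall>a<N. \<forall>b<N. G (x, a, b) = \<Phi> x a b" using G by (force simp: C_def)
  ultimately show ?thesis by (intro exI[of _ "\<lambda>x a b. G (x, a, b)"]) auto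
qed

section \<open>Reproducing kernel Hilbert spaces\<close>

text \<open>Functions on \<open>X\<close> that are bounded as functionals on the span of the kernel sections; the reproducing
  kernel Hilbert space consists of them, and its norm squared is the least bound.\<close>

definition kernel_bounded :: "'a set \<Rightarrow> ('a \<Rightarrow> 'a \<Rightarrow> complex) \<Rightarrow> real \<Rightarrow> ('a \<Rightarrow> complex) \<Rightarrow> bool" where
  "kernel_bounded X k C f \<longleftrightarrow> (\<forall>S c. finite S \<longrightarrow> S \<subseteq> X \<longrightarrow>
     (cmod (\<Sum>x\<in>S. cnj (c x) * f x))\<^sup>2 \<le> C * Re (herm_form S k c c))"

lemma kernel_boundedD:
  "kernel_bounded X k C f \<Longrightarrow> finite S \<Longrightarrow> S \<subseteq> X \<Longrightarrow>
    (cmod (\<Sum>x\<in>S. cnj (c x) * f x))\<^sup>2 \<le> C * Re (herm_form S k c c)"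
  by (auto simp: kernel_bounded_def)

lemma psd_form_nonneg: "psd X k \<Longrightarrow> finite S \<Longrightarrow> S \<subseteq> X \<Longrightarrow> 0 \<le> Re (herm_form S k c c)"
  using psdD[of X k S c] by (simp add: less_eq_complex_def)

lemma psd_form_real: "psd X k \<Longrightarrow> finite S \<Longrightarrow> S \<subseteq> X \<Longrightarrow> herm_form S k c c = of_real (Re (herm_form S k c c))"
  using psdD[of X k S c] by (simp add: complex_nonneg_iff)

lemma kernel_bounded_mono:
  assumes "psd X k" "kernel_bounded X k C f" "C \<le> C'" shows "kernel_bounded X k C' f"
  unfolding kernel_bounded_def
proof (intro allI impI)
  fix S c assume S: "finite S" "S \<subseteq> X"
  have "C * Re (herm_form S k c c) \<le> C' * Re (herm_form S k c c)"
    using psd_form_nonneg[OF assms(1) S] assms(3) by (intro mult_right_mono) auto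
  then show "(cmod (\<Sum>x\<in>S. cnj (c x) * f x))\<^sup>2 \<le> C' * Re (herm_form S k c c)"
    using kernel_boundedD[OF assms(2) S, of c] by linarith
qed

lemma kernel_bounded_point:
  assumes "kernel_bounded X k C f" "x \<in> X" shows "(cmod (f x))\<^sup>2 \<le> C * Re (k x x)"
  using kernel_boundedD[OF assms(1), of "{x}" "\<lambda>_. 1"] assms(2) by (simp add: herm_form_def)

lemma kernel_bounded_scale:
  "kernel_bounded X k C f \<Longrightarrow> kernel_bounded X k ((cmod t)\<^sup>2 * C) (\<lambda>z. t * f z)"
  unfolding kernel_bounded_def
  by (simp add: mult.left_commute[of _ t] norm_mult power_mult_distrib mult.assoc mult_left_mono flip: sum_distrib_left)

lemma kernel_bounded_add:
  assumes "kernel_bounded X k C f" "kernel_bounded X k C' g"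
  shows "kernel_bounded X k (2 * C + 2 * C') (\<lambda>z. f z + g z)"
  unfolding kernel_bounded_def
proof (intro allI impI)
  fix S c assume S: "finite S" "S \<subseteq> X"
  let ?a = "\<Sum>x\<in>S. cnj (c x) * f x" and ?b = "\<Sum>x\<in>S. cnj (c x) * g x"
  have "(cmod (?a + ?b))\<^sup>2 \<le> (cmod ?a + cmod ?b)\<^sup>2" by (intro power_mono norm_triangle_ineq) auto
  also have "\<dots> \<le> 2 * (cmod ?a)\<^sup>2 + 2 * (cmod ?b)\<^sup>2"
    using sum_squares_bound[of "cmod ?a" "cmod ?b"] by (simp add: power2_eq_square algebra_simps)
  also have "\<dots> \<le> (2 * C + 2 * C') * Re (herm_form S k c c)"
    using kernel_boundedD[OF assms(1) S, of c] kernel_boundedD[OF assms(2) S, of c] by (simp add: algebra_simps)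
  finally show "(cmod (\<Sum>x\<in>S. cnj (c x) * (f x + g x)))\<^sup>2 \<le> (2 * C + 2 * C') * Re (herm_form S k c c)"
    by (simp add: algebra_simps sum.distrib)
qed

definition represents :: "('a \<Rightarrow> 'a \<Rightarrow> complex) \<Rightarrow> 'a set \<Rightarrow> ('a \<Rightarrow> complex) \<Rightarrow> ('a \<Rightarrow> complex) \<Rightarrow> bool" where
  "represents k S y f \<longleftrightarrow> (\<forall>x\<in>S. f x = (\<Sum>x'\<in>S. k x x' * y x'))"

lemma represents_sum:
  "represents k S y f \<Longrightarrow> (\<Sum>x\<in>S. cnj (c x) * f x) = herm_form S k c y"
  by (simp add: represents_def herm_form_def sum_distrib_left mult.assoc)

text \<open>Boundedness says that the matrix of \<open>k\<close> on \<open>S\<close> remains positive semi-definite when it is bordered by \<open>f\<close>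
  with the bound in the corner; so \<open>f\<close> is in the range of the matrix.\<close>

lemma represents_exists:
  assumes k: "psd X k" and f: "kernel_bounded X k C f" and S: "finite S" "S \<subseteq> X"
  shows "\<exists>y. represents k S y f"
proof -
  define C' where "C' = max C 0"
  have f: "kernel_bounded X k C' f" and C': "0 \<le> C'"
    using kernel_bounded_mono[OF k f, of C'] by (auto simp: C'_def)
  define A where "A p q = (case (p, q) of (Some x, Some y) \<Rightarrow> k x y | (Some x, None) \<Rightarrow> f x
     | (None, Some y) \<Rightarrow> cnj (f y) | (None, None) \<Rightarrow> of_real C')" for p q
  have "psd (insert None (Some ` S)) A"
    unfolding psd_finite_iff[OF finite.insertI[OF finite_imageI[OF S(1)]]]
  proof
    fix c :: "'a option \<Rightarrow> complex"
    define d where "d x = c (Some x)" for x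
    define t where "t = c None"
    define b where "b = (\<Sum>x\<in>S. cnj (d x) * f x)"
    define q where "q = Re (herm_form S k d d)"
    have q: "herm_form S k d d = of_real q" "0 \<le> q"
      using psd_form_real[OF k S] psd_form_nonneg[OF k S] by (auto simp: q_def)
    have "herm_form (insert None (Some ` S)) A c c =
       cnj t * of_real C' * t + cnj t * cnj b + (b * t + herm_form S k d d)"
      using S by (simp add: herm_form_def sum.reindex sum.distrib A_def b_def d_def t_def sum_distrib_left sum_distrib_right mult_ac)
    also have "\<dots> = of_real (C' * (cmod t)\<^sup>2 + 2 * Re (b * t) + q)"
    proof -
      have "cnj t * of_real C' * t = of_real (C' * (cmod t)\<^sup>2)"
        by (simp only: of_real_mult complex_norm_square mult_ac)
      moreover have "cnj t * cnj b + b * t = of_real (2 * Re (b * t))"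
        using complex_add_cnj[of "b * t"] by (simp add: add.commute mult.commute)
      moreover have "cnj t * of_real C' * t + cnj t * cnj b + (b * t + herm_form S k d d) =
          cnj t * of_real C' * t + (cnj t * cnj b + b * t) + herm_form S k d d" by simp
      ultimately show ?thesis by (simp only: q(1) of_real_add)
    qed
    finally have eq: "herm_form (insert None (Some ` S)) A c c = of_real (C' * (cmod t)\<^sup>2 + 2 * Re (b * t) + q)" .
    have "(2 * cmod (b * t))\<^sup>2 = 4 * (cmod b)\<^sup>2 * (cmod t)\<^sup>2" by (simp add: norm_mult power_mult_distrib)
    also have "\<dots> \<le> 4 * (C' * q) * (cmod t)\<^sup>2"
      using kernel_boundedD[OF f S, of d] by (intro mult_right_mono mult_left_mono) (auto simp: b_def q_def)
    also have "\<dots> \<le> (C' * (cmod t)\<^sup>2 + q)\<^sup>2"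
      using sum_squares_bound[of "C' * (cmod t)\<^sup>2" q] by (simp add: power2_eq_square algebra_simps)
    finally have "2 * cmod (b * t) \<le> C' * (cmod t)\<^sup>2 + q"
      by (rule power2_le_imp_le) (use C' q(2) in simp)
    then have "0 \<le> C' * (cmod t)\<^sup>2 + 2 * Re (b * t) + q"
      using abs_Re_le_cmod[of "b * t"] by linarith
    then show "0 \<le> herm_form (insert None (Some ` S)) A c c"
      unfolding eq by (simp add: less_eq_complex_def del: of_real_add)
  qed
  then obtain y where "\<forall>j\<in>Some ` S. A j None = (\<Sum>i\<in>Some ` S. A j i * y i)"
    using psd_border_in_range[of "Some ` S" None A] S by auto
  then show ?thesis
    by (intro exI[of _ "\<lambda>x. y (Some x)"]) (auto simp: represents_def A_def sum.reindex)
qed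

definition finite_coeffs :: "('a \<Rightarrow> 'a \<Rightarrow> complex) \<Rightarrow> 'a set \<Rightarrow> ('a \<Rightarrow> complex) \<Rightarrow> 'a \<Rightarrow> complex" where
  "finite_coeffs k S f = (SOME y. represents k S y f)"

text \<open>The inner product of the restrictions to a finite set, in the finite-dimensional space of the
  restricted kernel.\<close>

definition finite_inner :: "('a \<Rightarrow> 'a \<Rightarrow> complex) \<Rightarrow> 'a set \<Rightarrow> ('a \<Rightarrow> complex) \<Rightarrow> ('a \<Rightarrow> complex) \<Rightarrow> complex" where
  "finite_inner k S f g = (\<Sum>x\<in>S. cnj (finite_coeffs k S g x) * f x)"

lemma finite_coeffs:
  assumes "psd X k" "kernel_bounded X k C f" "finite S" "S \<subseteq> X"
  shows "represents k S (finite_coeffs k S f) f"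
  unfolding finite_coeffs_def
  by (rule someI_ex[of "\<lambda>y. represents k S y f"]) (rule represents_exists[OF assms])

lemma finite_inner_eq:
  assumes k: "psd X k" and S: "finite S" "S \<subseteq> X" and f: "represents k S y f" and g: "represents k S y' g"
  shows "finite_inner k S f g = herm_form S k y' y"
proof -
  have g': "represents k S (finite_coeffs k S g) g"
    unfolding finite_coeffs_def using g by (rule someI[of "\<lambda>y. represents k S y g"])
  have h: "herm_form S k c d = cnj (herm_form S k d c)" for c d
    by (rule herm_form_hermitian) (use psd_hermitian[OF k] S in auto)
  have "finite_inner k S f g = cnj (herm_form S k y (finite_coeffs k S g))"
    unfolding finite_inner_def represents_sum[OF f] by (rule h)
  also have "\<dots> = cnj (herm_form S k y y')"
    by (simp flip: represents_sum[OF g] represents_sum[OF g'])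
  finally show ?thesis by (simp only: h[of y' y])
qed

lemma finite_inner_self:
  assumes k: "psd X k" and f: "kernel_bounded X k C f" and S: "finite S" "S \<subseteq> X"
  shows "finite_inner k S f f = herm_form S k (finite_coeffs k S f) (finite_coeffs k S f)"
    and "0 \<le> finite_inner k S f f"
  using finite_inner_eq[OF k S finite_coeffs[OF k f S] finite_coeffs[OF k f S]] psdD[OF k S] by auto

text \<open>Restriction from \<open>T\<close> to \<open>S\<close> is an orthogonal projection.\<close>

lemma finite_inner_mono:
  assumes k: "psd X k" and f: "kernel_bounded X k C f" and S: "S \<subseteq> T" "finite T" "T \<subseteq> X"
  shows "Re (finite_inner k S f f) \<le> Re (finite_inner k T f f)"
proof -
  have S': "finite S" "S \<subseteq> X" using S finite_subset by auto
  define y where "y = finite_coeffs k S f"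
  define y' where "y' x = (if x \<in> S then y x else 0)" for x
  define a where "a = Re (finite_inner k S f f)"
  have a: "finite_inner k S f f = herm_form S k y y" "finite_inner k S f f = of_real a" "0 \<le> a"
    using finite_inner_self[OF k f S'] by (auto simp: complex_nonneg_iff y_def a_def)
  have yy: "herm_form T k y' y' = of_real a"
    using herm_form_extend[OF S(2,1), of k y y] a unfolding y'_def by metis
  have "of_real a = (\<Sum>x\<in>S. cnj (y x) * f x)"
    unfolding a(2)[symmetric] finite_inner_def y_def ..
  also have "\<dots> = (\<Sum>x\<in>T. cnj (y' x) * f x)"
    using S by (intro sum.mono_neutral_cong_left) (auto simp: y'_def)
  also have "\<dots> = herm_form T k y' (finite_coeffs k T f)"
    by (rule represents_sum[OF finite_coeffs[OF k f S(2,3)]])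
  finally have eq: "herm_form T k y' (finite_coeffs k T f) = of_real a" ..
  have "(cmod (of_real a))\<^sup>2 \<le> a * Re (finite_inner k T f f)"
    using psd_Cauchy_Schwarz[OF k S(2,3), of y' "finite_coeffs k T f"]
    unfolding eq yy finite_inner_self(1)[OF k f S(2,3)] by simp
  then have "a * a \<le> a * Re (finite_inner k T f f)" using a(3) by (simp add: power2_eq_square)
  moreover have "0 \<le> Re (finite_inner k T f f)"
    using finite_inner_self(2)[OF k f S(2,3)] by (simp add: less_eq_complex_def)
  ultimately show ?thesis using a(3) unfolding a_def[symmetric] by (cases "a = 0") auto
qed

lemma finite_inner_le:
  assumes k: "psd X k" and f: "kernel_bounded X k C f" and C: "0 \<le> C" and S: "finite S" "S \<subseteq> X"
  shows "Re (finite_inner k S f f) \<le> C"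
proof -
  define a where "a = Re (finite_inner k S f f)"
  have a: "finite_inner k S f f = of_real a" "0 \<le> a"
    using finite_inner_self[OF k f S] by (auto simp: complex_nonneg_iff a_def)
  have "(cmod (of_real a))\<^sup>2 \<le> C * a"
    using kernel_boundedD[OF f S, of "finite_coeffs k S f"] finite_inner_self(1)[OF k f S] a
    by (metis a_def finite_inner_def)
  then have "a * a \<le> C * a" using a by (simp add: power2_eq_square)
  then show ?thesis using a C unfolding a_def[symmetric] by (cases "a = 0") auto
qed

text \<open>The least bound of \<open>f\<close> is the supremum of the norms of its restrictions to finite sets.\<close>

lemma kernel_boundedI:
  assumes k: "psd X k" and f: "kernel_bounded X k C' f"
    and le: "\<And>S. finite S \<Longrightarrow> S \<subseteq> X \<Longrightarrow> Re (finite_inner k S f f) \<le> C"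
  shows "kernel_bounded X k C f"
  unfolding kernel_bounded_def
proof (intro allI impI)
  fix S c assume S: "finite S" "S \<subseteq> X"
  have "(cmod (\<Sum>x\<in>S. cnj (c x) * f x))\<^sup>2 \<le> Re (herm_form S k c c) * Re (finite_inner k S f f)"
    unfolding represents_sum[OF finite_coeffs[OF k f S]] finite_inner_self[OF k f S]
    by (rule psd_Cauchy_Schwarz[OF k S])
  also have "\<dots> \<le> C * Re (herm_form S k c c)"
    using mult_right_mono[OF le[OF S] psd_form_nonneg[OF k S, of c]] by (simp add: mult.commute)
  finally show "(cmod (\<Sum>x\<in>S. cnj (c x) * f x))\<^sup>2 \<le> C * Re (herm_form S k c c)" .
qed

subsection \<open>Existence\<close>

definition bounded_functions :: "'a set \<Rightarrow> ('a \<Rightarrow> 'a \<Rightarrow> complex) \<Rightarrow> ('a \<Rightarrow> complex) set" where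
  "bounded_functions X k = {f. (\<forall>z. z \<notin> X \<longrightarrow> f z = 0) \<and> (\<exists>C. kernel_bounded X k C f)}"

definition limit_inner :: "'a set \<Rightarrow> ('a \<Rightarrow> 'a \<Rightarrow> complex) \<Rightarrow> ('a \<Rightarrow> complex) \<Rightarrow> ('a \<Rightarrow> complex) \<Rightarrow> complex" where
  "limit_inner X k f g = Lim (finite_subsets_at_top X) (\<lambda>S. finite_inner k S f g)"

definition bounded_function_space :: "'a set \<Rightarrow> ('a \<Rightarrow> 'a \<Rightarrow> complex) \<Rightarrow> 'a function_space" where
  "bounded_function_space X k = \<lparr>elems = bounded_functions X k,
     inprod = (\<lambda>f g. if f \<in> bounded_functions X k \<and> g \<in> bounded_functions X k then limit_inner X k f g else 0)\<rparr>"

context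
  fixes X :: "'a set" and k :: "'a \<Rightarrow> 'a \<Rightarrow> complex"
  assumes k: "psd X k"
begin

lemma bounded_functions_add: "f \<in> bounded_functions X k \<Longrightarrow> g \<in> bounded_functions X k \<Longrightarrow> (\<lambda>z. f z + g z) \<in> bounded_functions X k"
  by (auto simp: bounded_functions_def intro: kernel_bounded_add)

lemma bounded_functions_scale: "f \<in> bounded_functions X k \<Longrightarrow> (\<lambda>z. t * f z) \<in> bounded_functions X k"
  by (auto simp: bounded_functions_def intro: kernel_bounded_scale)

lemma bounded_functions_diff: "f \<in> bounded_functions X k \<Longrightarrow> g \<in> bounded_functions X k \<Longrightarrow> (\<lambda>z. f z - g z) \<in> bounded_functions X k"
  using bounded_functions_add[of f "\<lambda>z. (-1) * g z"] bounded_functions_scale[of g "-1"] by simp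

lemma bounded_functionsE:
  assumes "f \<in> bounded_functions X k"
  obtains C where "kernel_bounded X k C f" "0 \<le> C" "\<And>z. z \<notin> X \<Longrightarrow> f z = 0"
proof -
  obtain C where "kernel_bounded X k C f" "\<And>z. z \<notin> X \<Longrightarrow> f z = 0" using assms by (auto simp: bounded_functions_def)
  then show thesis using that[of "max C 0"] kernel_bounded_mono[OF k, of C f "max C 0"] by simp
qed

lemma finite_inner_add: "finite_inner k S (\<lambda>z. f z + g z) h = finite_inner k S f h + finite_inner k S g h"
  by (simp add: finite_inner_def algebra_simps sum.distrib)

lemma finite_inner_scale: "finite_inner k S (\<lambda>z. t * f z) h = t * finite_inner k S f h"
  by (simp add: finite_inner_def algebra_simps sum_distrib_left)

lemma finite_inner_cnj:
  assumes "f \<in> bounded_functions X k" "g \<in> bounded_functions X k" "finite S" "S \<subseteq> X"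
  shows "finite_inner k S g f = cnj (finite_inner k S f g)"
proof -
  obtain C C' where C: "kernel_bounded X k C f" "kernel_bounded X k C' g"
    using assms by (auto simp: bounded_functions_def)
  note r = finite_coeffs[OF k C(1) assms(3,4)] finite_coeffs[OF k C(2) assms(3,4)]
  show ?thesis
    unfolding finite_inner_eq[OF k assms(3,4) r(1,2)] finite_inner_eq[OF k assms(3,4) r(2,1)]
    by (rule herm_form_hermitian) (use psd_hermitian[OF k] assms in auto)
qed

text \<open>The norms of the restrictions increase and are bounded. By polarization the inner products of restrictions converge, too.\<close>

lemma finite_inner_self_converges:
  assumes "f \<in> bounded_functions X k"
  shows "\<exists>L. ((\<lambda>S. finite_inner k S f f) \<longlongrightarrow> of_real L) (finite_subsets_at_top X)"
proof -
  obtain C where C: "kernel_bounded X k C f" "0 \<le> C" using assms by (rule bounded_functionsE)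
  define a where "a S = Re (finite_inner k S f f)" for S
  define FS where "FS = {S. finite S \<and> S \<subseteq> X}"
  have bdd: "bdd_above (a ` FS)"
    using finite_inner_le[OF k C] by (auto simp: a_def FS_def intro!: bdd_aboveI[of _ C])
  have ne: "{} \<in> FS" by (simp add: FS_def)
  have "(a \<longlongrightarrow> (SUP S\<in>FS. a S)) (finite_subsets_at_top X)"
  proof (rule order_tendstoI)
    fix b assume "b < (SUP S\<in>FS. a S)"
    then obtain S where S: "S \<in> FS" "b < a S" using less_cSUP_iff[of FS a b] bdd ne by auto
    have "b < a T" if "S \<subseteq> T" "finite T" "T \<subseteq> X" for T
      using finite_inner_mono[OF k C(1) that] S(2) by (simp add: a_def)
    then show "\<forall>\<^sub>F T in finite_subsets_at_top X. b < a T"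
      unfolding eventually_finite_subsets_at_top using S(1) by (auto simp: FS_def)
  next
    fix b assume b: "(SUP S\<in>FS. a S) < b"
    have "a T < b" if "finite T" "T \<subseteq> X" for T
      using cSUP_upper[OF _ bdd, of T] that b by (auto simp: FS_def)
    then show "\<forall>\<^sub>F T in finite_subsets_at_top X. a T < b"
      by (auto simp: eventually_finite_subsets_at_top)
  qed
  then have "((\<lambda>S. of_real (a S)) \<longlongrightarrow> complex_of_real (SUP S\<in>FS. a S)) (finite_subsets_at_top X)"
    by (rule tendsto_of_real)
  moreover have "\<forall>\<^sub>F S in finite_subsets_at_top X. complex_of_real (a S) = finite_inner k S f f"
    using finite_inner_self[OF k C(1)] by (auto simp: eventually_finite_subsets_at_top a_def complex_nonneg_iff)
  ultimately show ?thesis by (intro exI) (rule Lim_transform_eventually)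
qed

lemma finite_inner_polarization:
  assumes "f \<in> bounded_functions X k" "g \<in> bounded_functions X k" "finite S" "S \<subseteq> X"
  shows "of_real (2 * Re (finite_inner k S f g)) =
    finite_inner k S (\<lambda>z. f z + g z) (\<lambda>z. f z + g z) - finite_inner k S f f - finite_inner k S g g"
proof -
  note fg = bounded_functions_add[OF assms(1,2)]
  have "finite_inner k S (\<lambda>z. f z + g z) (\<lambda>z. f z + g z) =
      finite_inner k S f f + finite_inner k S g f + (finite_inner k S f g + finite_inner k S g g)"
    using finite_inner_cnj[OF fg assms(1) assms(3,4)] finite_inner_cnj[OF fg assms(2) assms(3,4)]
      finite_inner_cnj[OF assms(1,2) assms(3,4)]
      finite_inner_cnj[OF assms(1,1) assms(3,4)] finite_inner_cnj[OF assms(2,2) assms(3,4)]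
    by (simp add: finite_inner_add)
  then show ?thesis
    using complex_add_cnj[of "finite_inner k S f g"] finite_inner_cnj[OF assms] by (simp add: algebra_simps)
qed

lemma finite_inner_Re_converges:
  assumes "f \<in> bounded_functions X k" "g \<in> bounded_functions X k"
  shows "\<exists>L. ((\<lambda>S. Re (finite_inner k S f g)) \<longlongrightarrow> L) (finite_subsets_at_top X)"
proof -
  obtain L1 L2 L3 where L:
    "((\<lambda>S. finite_inner k S (\<lambda>z. f z + g z) (\<lambda>z. f z + g z)) \<longlongrightarrow> of_real L1) (finite_subsets_at_top X)"
    "((\<lambda>S. finite_inner k S f f) \<longlongrightarrow> of_real L2) (finite_subsets_at_top X)"
    "((\<lambda>S. finite_inner k S g g) \<longlongrightarrow> of_real L3) (finite_subsets_at_top X)"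
    using finite_inner_self_converges[OF bounded_functions_add[OF assms]]
      finite_inner_self_converges[OF assms(1)] finite_inner_self_converges[OF assms(2)] by blast
  have "((\<lambda>S. finite_inner k S (\<lambda>z. f z + g z) (\<lambda>z. f z + g z) - finite_inner k S f f - finite_inner k S g g)
       \<longlongrightarrow> of_real L1 - of_real L2 - of_real L3) (finite_subsets_at_top X)"
    by (intro tendsto_diff L)
  then have "((\<lambda>S. complex_of_real (2 * Re (finite_inner k S f g))) \<longlongrightarrow> of_real L1 - of_real L2 - of_real L3) (finite_subsets_at_top X)"
    by (rule Lim_transform_eventually)
       (use finite_inner_polarization[OF assms] in \<open>auto simp: eventually_finite_subsets_at_top\<close>)
  from tendsto_Re[OF this] have "((\<lambda>S. 2 * Re (finite_inner k S f g)) \<longlongrightarrow> L1 - L2 - L3) (finite_subsets_at_top X)"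
    by simp
  from tendsto_mult_left[OF this, of "1/2"] show ?thesis by auto
qed

lemma limit_inner:
  assumes "f \<in> bounded_functions X k" "g \<in> bounded_functions X k"
  shows "((\<lambda>S. finite_inner k S f g) \<longlongrightarrow> limit_inner X k f g) (finite_subsets_at_top X)"
proof -
  obtain L1 L2 where L: "((\<lambda>S. Re (finite_inner k S f g)) \<longlongrightarrow> L1) (finite_subsets_at_top X)"
    "((\<lambda>S. Re (finite_inner k S (\<lambda>z. - \<i> * f z) g)) \<longlongrightarrow> L2) (finite_subsets_at_top X)"
    using finite_inner_Re_converges[OF assms]
      finite_inner_Re_converges[OF bounded_functions_scale[OF assms(1), of "- \<i>"] assms(2)] by blast
  have "((\<lambda>S. Complex (Re (finite_inner k S f g)) (Re (finite_inner k S (\<lambda>z. - \<i> * f z) g)))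
      \<longlongrightarrow> Complex L1 L2) (finite_subsets_at_top X)"
    by (intro tendsto_Complex L)
  moreover have "Complex (Re (finite_inner k S f g)) (Re (finite_inner k S (\<lambda>z. - \<i> * f z) g)) = finite_inner k S f g" for S
    by (subst finite_inner_scale) (simp add: complex_eq_iff)
  ultimately have "((\<lambda>S. finite_inner k S f g) \<longlongrightarrow> Complex L1 L2) (finite_subsets_at_top X)" by simp
  then show ?thesis unfolding limit_inner_def by (simp add: tendsto_Lim)
qed

lemma limit_inner_eqI:
  assumes "f \<in> bounded_functions X k" "g \<in> bounded_functions X k"
    "((\<lambda>S. finite_inner k S f g) \<longlongrightarrow> L) (finite_subsets_at_top X)"
  shows "limit_inner X k f g = L"
  using tendsto_unique[OF _ limit_inner[OF assms(1,2)] assms(3)] by simp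

lemma limit_inner_add:
  assumes "f \<in> bounded_functions X k" "g \<in> bounded_functions X k" "h \<in> bounded_functions X k"
  shows "limit_inner X k (\<lambda>z. f z + g z) h = limit_inner X k f h + limit_inner X k g h"
  by (rule limit_inner_eqI) (use assms in \<open>auto simp: finite_inner_add intro!: tendsto_add limit_inner bounded_functions_add\<close>)

lemma limit_inner_scale:
  assumes "f \<in> bounded_functions X k" "h \<in> bounded_functions X k"
  shows "limit_inner X k (\<lambda>z. t * f z) h = t * limit_inner X k f h"
  by (rule limit_inner_eqI) (use assms in \<open>auto simp: finite_inner_scale intro!: tendsto_mult_left limit_inner bounded_functions_scale\<close>)

lemma limit_inner_cnj:
  assumes "f \<in> bounded_functions X k" "g \<in> bounded_functions X k"
  shows "limit_inner X k g f = cnj (limit_inner X k f g)"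
proof (rule limit_inner_eqI[OF assms(2,1)])
  show "((\<lambda>S. finite_inner k S g f) \<longlongrightarrow> cnj (limit_inner X k f g)) (finite_subsets_at_top X)"
    by (rule Lim_transform_eventually[OF tendsto_cnj[OF limit_inner[OF assms]]])
       (use finite_inner_cnj[OF assms] in \<open>auto simp: eventually_finite_subsets_at_top\<close>)
qed

lemma limit_inner_self_bound:
  assumes f: "f \<in> bounded_functions X k"
  shows "0 \<le> limit_inner X k f f" "kernel_bounded X k (Re (limit_inner X k f f)) f"
    "kernel_bounded X k C f \<Longrightarrow> 0 \<le> C \<Longrightarrow> Re (limit_inner X k f f) \<le> C"
proof -
  obtain C' where C': "kernel_bounded X k C' f" using f by (rule bounded_functionsE)
  note lim = limit_inner[OF f f]
  have ev: "\<forall>\<^sub>F S in finite_subsets_at_top X. 0 \<le> finite_inner k S f f"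
    using finite_inner_self(2)[OF k C'] by (auto simp: eventually_finite_subsets_at_top)
  have "0 \<le> Re (limit_inner X k f f)"
    by (rule tendsto_lowerbound[OF tendsto_Re[OF lim]])
       (use ev in \<open>auto elim!: eventually_mono simp: less_eq_complex_def\<close>)
  moreover have "((\<lambda>S. 0) \<longlongrightarrow> Im (limit_inner X k f f)) (finite_subsets_at_top X)"
    using tendsto_Im[OF lim] by (rule Lim_transform_eventually) (use ev in \<open>auto elim!: eventually_mono simp: less_eq_complex_def\<close>)
  then have "Im (limit_inner X k f f) = 0"
    using tendsto_unique[OF _ tendsto_const] finite_subsets_at_top_neq_bot by metis
  ultimately show "0 \<le> limit_inner X k f f" by (simp add: less_eq_complex_def)
  show "kernel_bounded X k (Re (limit_inner X k f f)) f"
  proof (rule kernel_boundedI[OF k C'])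
    fix S assume S: "finite S" "S \<subseteq> X"
    show "Re (finite_inner k S f f) \<le> Re (limit_inner X k f f)"
      by (rule tendsto_lowerbound[OF tendsto_Re[OF lim]])
         (use finite_inner_mono[OF k C', of S] S in \<open>auto simp: eventually_finite_subsets_at_top\<close>)
  qed
  show "Re (limit_inner X k f f) \<le> C" if "kernel_bounded X k C f" "0 \<le> C"
    by (rule tendsto_upperbound[OF tendsto_Re[OF lim]])
       (use finite_inner_le[OF k that] in \<open>auto simp: eventually_finite_subsets_at_top\<close>)
qed

text \<open>A Cauchy sequence converges pointwise, and the bounds of differences pass to the limit because each of them is about
  finitely many points.\<close>

lemma bounded_function_space_complete:
  assumes u: "\<And>n. u n \<in> bounded_functions X k"
    and Cauchy: "\<And>e. e > 0 \<Longrightarrow> \<exists>M. \<forall>m\<ge>M. \<forall>n\<ge>M. fs_norm (bounded_function_space X k) (\<lambda>z. u m z - u n z) < e"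
  shows "\<exists>f\<in>bounded_functions X k. (\<lambda>n. fs_norm (bounded_function_space X k) (\<lambda>z. u n z - f z)) \<longlonglongrightarrow> 0"
proof -
  let ?H = "bounded_function_space X k"
  have norm: "fs_norm ?H h = sqrt (Re (limit_inner X k h h))" if "h \<in> bounded_functions X k" for h
    using that by (simp add: fs_norm_def bounded_function_space_def)
  have norm_ge: "0 \<le> Re (limit_inner X k h h)" if "h \<in> bounded_functions X k" for h
    using limit_inner_self_bound(1)[OF that] by (simp add: less_eq_complex_def)
  have ud: "(\<lambda>z. u m z - u n z) \<in> bounded_functions X k" for m n by (rule bounded_functions_diff[OF u u])
  have ub: "\<exists>M. \<forall>m\<ge>M. \<forall>n\<ge>M. kernel_bounded X k (e\<^sup>2) (\<lambda>z. u m z - u n z)" if e: "e > 0" for e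
  proof -
    obtain M where M: "\<forall>m\<ge>M. \<forall>n\<ge>M. fs_norm ?H (\<lambda>z. u m z - u n z) < e" using Cauchy[OF e] by blast
    have "kernel_bounded X k (e\<^sup>2) (\<lambda>z. u m z - u n z)" if "m \<ge> M" "n \<ge> M" for m n
    proof (rule kernel_bounded_mono[OF k limit_inner_self_bound(2)[OF ud]])
      have "sqrt (Re (limit_inner X k (\<lambda>z. u m z - u n z) (\<lambda>z. u m z - u n z))) < e"
        using M that norm[OF ud] by auto
      then show "Re (limit_inner X k (\<lambda>z. u m z - u n z) (\<lambda>z. u m z - u n z)) \<le> e\<^sup>2"
        using norm_ge[OF ud] by (meson less_imp_le sqrt_le_D)
    qed
    then show ?thesis by blast
  qed
  have "\<exists>L. (\<lambda>n. u n x) \<longlonglongrightarrow> L" for x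
  proof (cases "x \<in> X")
    case True
    have "Cauchy (\<lambda>n. u n x)"
    proof (rule CauchyI)
      fix e :: real assume e: "e > 0"
      define d where "d = e / (sqrt (Re (k x x)) + 1)"
      have kx: "0 \<le> Re (k x x)" using psd_diag[OF k True] by (simp add: less_eq_complex_def)
      have pos: "0 < sqrt (Re (k x x)) + 1" using kx by (simp add: add_nonneg_pos)
      have d: "d > 0" "d * sqrt (Re (k x x)) < e"
        using e pos by (auto simp: d_def pos_divide_less_eq algebra_simps)
      obtain M where M: "\<And>m n. m \<ge> M \<Longrightarrow> n \<ge> M \<Longrightarrow> kernel_bounded X k (d\<^sup>2) (\<lambda>z. u m z - u n z)" using ub[OF d(1)] by blast
      have "norm (u m x - u n x) < e" if "m \<ge> M" "n \<ge> M" for m n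
      proof -
        have "(cmod (u m x - u n x))\<^sup>2 \<le> d\<^sup>2 * Re (k x x)"
          using kernel_bounded_point[OF M[OF that] True] by simp
        also have "\<dots> = (d * sqrt (Re (k x x)))\<^sup>2" using kx by (simp add: power_mult_distrib)
        finally have "cmod (u m x - u n x) \<le> d * sqrt (Re (k x x))"
          by (rule power2_le_imp_le) (use d kx in auto)
        then show ?thesis using d by simp
      qed
      then show "\<exists>M. \<forall>m\<ge>M. \<forall>n\<ge>M. norm (u m x - u n x) < e" by blast
    qed
    then show ?thesis using Cauchy_convergent_iff convergent_def by blast
  next
    case False
    then have "u n x = 0" for n using u[of n] by (auto simp: bounded_functions_def)
    then show ?thesis by auto
  qed
  then obtain f where f: "\<And>x. (\<lambda>n. u n x) \<longlonglongrightarrow> f x" by metis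
  have fX: "f z = 0" if "z \<notin> X" for z
  proof -
    have "u n z = 0" for n using that u[of n] by (auto simp: bounded_functions_def)
    then show ?thesis using f[of z] by (simp add: LIMSEQ_const_iff)
  qed
  have fb: "\<exists>M. \<forall>n\<ge>M. kernel_bounded X k (e\<^sup>2) (\<lambda>z. u n z - f z)" if e: "e > 0" for e
  proof -
    obtain M where M: "\<And>m n. m \<ge> M \<Longrightarrow> n \<ge> M \<Longrightarrow> kernel_bounded X k (e\<^sup>2) (\<lambda>z. u m z - u n z)"
      using ub[OF e] by blast
    have "kernel_bounded X k (e\<^sup>2) (\<lambda>z. u n z - f z)" if "n \<ge> M" for n
      unfolding kernel_bounded_def
    proof (intro allI impI)
      fix S c assume S: "finite S" "S \<subseteq> X"
      have "(\<lambda>m. (cmod (\<Sum>x\<in>S. cnj (c x) * (u n x - u m x)))\<^sup>2) \<longlonglongrightarrow> (cmod (\<Sum>x\<in>S. cnj (c x) * (u n x - f x)))\<^sup>2"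
        by (intro tendsto_intros f)
      then show "(cmod (\<Sum>x\<in>S. cnj (c x) * (u n x - f x)))\<^sup>2 \<le> e\<^sup>2 * Re (herm_form S k c c)"
        by (rule tendsto_upperbound)
           (auto intro!: eventually_sequentiallyI[of M] kernel_boundedD[OF M[OF that] S])
    qed
    then show ?thesis by blast
  qed
  obtain M1 where M1: "kernel_bounded X k (1\<^sup>2) (\<lambda>z. u M1 z - f z)" using fb[of 1] by auto
  then have "(\<lambda>z. u M1 z - f z) \<in> bounded_functions X k"
    using fX u[of M1] by (auto simp: bounded_functions_def)
  from bounded_functions_diff[OF u[of M1] this] have fB: "f \<in> bounded_functions X k" by simp
  have "(\<lambda>n. fs_norm ?H (\<lambda>z. u n z - f z)) \<longlonglongrightarrow> 0"
  proof (rule LIMSEQ_I)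
    fix e :: real assume e: "e > 0"
    obtain M where M: "\<And>n. n \<ge> M \<Longrightarrow> kernel_bounded X k ((e/2)\<^sup>2) (\<lambda>z. u n z - f z)" using fb[of "e/2"] e by auto
    have "norm (fs_norm ?H (\<lambda>z. u n z - f z) - 0) < e" if "n \<ge> M" for n
    proof -
      have h: "(\<lambda>z. u n z - f z) \<in> bounded_functions X k" by (rule bounded_functions_diff[OF u fB])
      have "Re (limit_inner X k (\<lambda>z. u n z - f z) (\<lambda>z. u n z - f z)) \<le> (e/2)\<^sup>2"
        by (rule limit_inner_self_bound(3)[OF h M[OF that]]) simp
      then have "fs_norm ?H (\<lambda>z. u n z - f z) \<le> e/2"
        unfolding norm[OF h] using e by (intro real_le_lsqrt) (auto simp: norm_ge[OF h])
      moreover have "0 \<le> fs_norm ?H (\<lambda>z. u n z - f z)" unfolding norm[OF h] using norm_ge[OF h] by simp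
      ultimately show ?thesis using e by simp
    qed
    then show "\<exists>M. \<forall>n\<ge>M. norm (fs_norm ?H (\<lambda>z. u n z - f z) - 0) < e" by blast
  qed
  then show ?thesis using fB by blast
qed

lemma bounded_function_space_hilbert: "hilbert_function_space X (bounded_function_space X k)"
proof -
  have z: "(\<lambda>z. 0) \<in> bounded_functions X k"
    by (auto simp: bounded_functions_def kernel_bounded_def intro!: exI[of _ 0])
  have d: "f = (\<lambda>z. 0)" if f: "f \<in> bounded_functions X k" and 0: "limit_inner X k f f = 0" for f
  proof
    fix x
    show "f x = 0"
    proof (cases "x \<in> X")
      case True
      then show ?thesis using kernel_bounded_point[OF limit_inner_self_bound(2)[OF f]] 0 by auto
    next
      case False
      then show ?thesis using f by (auto simp: bounded_functions_def)
    qed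
  qed
  have E: "elems (bounded_function_space X k) = bounded_functions X k"
    by (simp add: bounded_function_space_def)
  have I: "inprod (bounded_function_space X k) f g = limit_inner X k f g"
    if "f \<in> bounded_functions X k" "g \<in> bounded_functions X k" for f g
    using that by (simp add: bounded_function_space_def)
  show ?thesis
    unfolding hilbert_function_space_def E
  proof (intro conjI ballI allI impI)
    fix f z assume "f \<in> bounded_functions X k" "z \<notin> X"
    then show "f z = 0" by (simp add: bounded_functions_def)
  next
    fix f g h assume *: "f \<in> bounded_functions X k" "g \<in> bounded_functions X k" "h \<in> bounded_functions X k"
    show "inprod (bounded_function_space X k) (\<lambda>z. f z + g z) h =
        inprod (bounded_function_space X k) f h + inprod (bounded_function_space X k) g h"
      by (simp only: I * bounded_functions_add limit_inner_add)
  next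
    fix c f g assume *: "f \<in> bounded_functions X k" "g \<in> bounded_functions X k"
    show "inprod (bounded_function_space X k) (\<lambda>z. c * f z) g = c * inprod (bounded_function_space X k) f g"
      by (simp only: I * bounded_functions_scale limit_inner_scale)
  next
    fix f g assume *: "f \<in> bounded_functions X k" "g \<in> bounded_functions X k"
    show "inprod (bounded_function_space X k) g f = cnj (inprod (bounded_function_space X k) f g)"
      unfolding I[OF *] I[OF *(2,1)] by (rule limit_inner_cnj[OF *])
  next
    fix f assume *: "f \<in> bounded_functions X k"
    show "0 \<le> inprod (bounded_function_space X k) f f"
      unfolding I[OF * *] by (rule limit_inner_self_bound(1)[OF *])
  next
    fix f assume *: "f \<in> bounded_functions X k" "inprod (bounded_function_space X k) f f = 0"
    then show "f = (\<lambda>z. 0)" using d[OF *(1)] I[OF *(1,1)] by simp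
  next
    fix f g assume "f \<notin> bounded_functions X k \<or> g \<notin> bounded_functions X k"
    then show "inprod (bounded_function_space X k) f g = 0" by (auto simp: bounded_function_space_def)
  next
    fix u :: "nat \<Rightarrow> 'a \<Rightarrow> complex"
    assume u: "\<forall>n. u n \<in> bounded_functions X k"
      "\<forall>e>0. \<exists>M. \<forall>m\<ge>M. \<forall>n\<ge>M. fs_norm (bounded_function_space X k) (\<lambda>z. u m z - u n z) < e"
    show "\<exists>f\<in>bounded_functions X k. (\<lambda>n. fs_norm (bounded_function_space X k) (\<lambda>z. u n z - f z)) \<longlonglongrightarrow> 0"
    proof (rule bounded_function_space_complete)
      show "u n \<in> bounded_functions X k" for n using u(1) by blast
      show "\<exists>M. \<forall>m\<ge>M. \<forall>n\<ge>M. fs_norm (bounded_function_space X k) (\<lambda>z. u m z - u n z) < e" if "e > 0" for e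
        using u(2) that by blast
    qed
  qed (rule z bounded_functions_add bounded_functions_scale; assumption?)+
qed

text \<open>A combination of values of \<open>k\<^sub>w\<close> is a value of the form of \<open>k\<close> with the basis vector \<open>e\<close> of \<open>w\<close> on one side, so that
  the Cauchy--Schwarz inequality applies.\<close>

lemma kernel_section_bounded:
  assumes "w \<in> X" shows "kernel_section X k w \<in> bounded_functions X k"
proof -
  have "kernel_bounded X k (Re (k w w)) (kernel_section X k w)"
    unfolding kernel_bounded_def
  proof (intro allI impI)
    fix S and c :: "'a \<Rightarrow> complex" assume S: "finite S" "S \<subseteq> X"
    define T where "T = insert w S"
    have T: "finite T" "T \<subseteq> X" "S \<subseteq> T" "w \<in> T" using S assms by (auto simp: T_def)
    define e where "e = (\<lambda>x. if x = w then (1::complex) else 0)"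
    define c' where "c' = (\<lambda>x. if x \<in> S then c x else 0)"
    have cc: "herm_form T k c' c' = herm_form S k c c"
      unfolding c'_def by (rule herm_form_extend[symmetric, OF T(1,3)])
    have ee: "herm_form T k e e = k w w"
      unfolding e_def herm_form_indicator_left[OF T(1,4)] using T by (simp add: if_distrib cong: if_cong)
    have "herm_form T k c' e = cnj (herm_form T k e c')"
      by (rule herm_form_hermitian) (use psd_hermitian[OF k] T in auto)
    also have "\<dots> = (\<Sum>x\<in>T. cnj (c' x) * k x w)"
      unfolding e_def herm_form_indicator_left[OF T(1,4)] cnj_sum
      using psd_hermitian[OF k _ assms] T by (intro sum.cong) (auto simp: mult.commute)
    also have "\<dots> = (\<Sum>x\<in>S. cnj (c x) * kernel_section X k w x)"
      using T S by (intro sum.mono_neutral_cong_right) (auto simp: c'_def kernel_section_def)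
    finally show "(cmod (\<Sum>x\<in>S. cnj (c x) * kernel_section X k w x))\<^sup>2 \<le> Re (k w w) * Re (herm_form S k c c)"
      using psd_Cauchy_Schwarz[OF k T(1,2), of c' e] by (simp add: cc ee mult.commute)
  qed
  then show ?thesis by (auto simp: bounded_functions_def kernel_section_def)
qed

lemma bounded_function_space_rkhs: "is_rkhs X k (bounded_function_space X k)"
proof -
  have "limit_inner X k f (kernel_section X k w) = f w" if w: "w \<in> X" and f: "f \<in> bounded_functions X k" for w f
  proof (rule limit_inner_eqI[OF f kernel_section_bounded[OF w]])
    obtain C where C: "kernel_bounded X k C f" using f by (rule bounded_functionsE)
    have "finite_inner k S f (kernel_section X k w) = f w" if S: "finite S" "S \<subseteq> X" "w \<in> S" for S
    proof -
      have r: "represents k S (\<lambda>x. if x = w then 1 else 0) (kernel_section X k w)"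
        using S by (auto simp: represents_def kernel_section_def if_distrib cong: if_cong)
      note rf = finite_coeffs[OF k C S(1,2)]
      show ?thesis
        unfolding finite_inner_eq[OF k S(1,2) rf r] herm_form_indicator_left[OF S(1,3)]
        by (rule rf[unfolded represents_def, rule_format, OF S(3), symmetric])
    qed
    then have "\<forall>\<^sub>F S in finite_subsets_at_top X. f w = finite_inner k S f (kernel_section X k w)"
      unfolding eventually_finite_subsets_at_top
      by (intro exI[of _ "{w}"] conjI allI impI) (use w in simp_all)
    then show "((\<lambda>S. finite_inner k S f (kernel_section X k w)) \<longlongrightarrow> f w) (finite_subsets_at_top X)"
      by (rule Lim_transform_eventually[OF tendsto_const])
  qed
  then show ?thesis
    unfolding is_rkhs_def using bounded_function_space_hilbert kernel_section_bounded
    by (auto simp: bounded_function_space_def)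
qed

end

subsection \<open>Uniqueness\<close>

context
  fixes X :: "'a set" and H :: "'a function_space"
  assumes H: "hilbert_function_space X H"
begin

lemmas H' = H[unfolded hilbert_function_space_def]

lemma hfs_outside: "f \<in> elems H \<Longrightarrow> z \<notin> X \<Longrightarrow> f z = 0"
  by (rule H'[THEN conjunct1, rule_format])

lemma hfs_zero: "(\<lambda>z. 0) \<in> elems H"
  by (rule H'[THEN conjunct2, THEN conjunct1, rule_format])

lemma hfs_add: "f \<in> elems H \<Longrightarrow> g \<in> elems H \<Longrightarrow> (\<lambda>z. f z + g z) \<in> elems H"
  by (rule H'[THEN conjunct2, THEN conjunct2, THEN conjunct1, rule_format])

lemma hfs_scale: "f \<in> elems H \<Longrightarrow> (\<lambda>z. t * f z) \<in> elems H"
  by (rule H'[THEN conjunct2, THEN conjunct2, THEN conjunct2, THEN conjunct1, rule_format])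

lemma hfs_inner_add: "f \<in> elems H \<Longrightarrow> g \<in> elems H \<Longrightarrow> h \<in> elems H \<Longrightarrow>
    inprod H (\<lambda>z. f z + g z) h = inprod H f h + inprod H g h"
  by (rule H'[THEN conjunct2, THEN conjunct2, THEN conjunct2, THEN conjunct2, THEN conjunct1, rule_format])

lemma hfs_inner_scale: "f \<in> elems H \<Longrightarrow> g \<in> elems H \<Longrightarrow> inprod H (\<lambda>z. t * f z) g = t * inprod H f g"
  by (rule H'[THEN conjunct2, THEN conjunct2, THEN conjunct2, THEN conjunct2, THEN conjunct2, THEN conjunct1, rule_format])

lemma hfs_inner_cnj: "f \<in> elems H \<Longrightarrow> g \<in> elems H \<Longrightarrow> inprod H g f = cnj (inprod H f g)"
  by (rule H'[THEN conjunct2, THEN conjunct2, THEN conjunct2, THEN conjunct2, THEN conjunct2, THEN conjunct2, THEN conjunct1, rule_format])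

lemma hfs_inner_nonneg: "f \<in> elems H \<Longrightarrow> 0 \<le> inprod H f f"
  by (rule H'[THEN conjunct2, THEN conjunct2, THEN conjunct2, THEN conjunct2, THEN conjunct2, THEN conjunct2, THEN conjunct2, THEN conjunct1, rule_format])

lemma hfs_inner_outside: "f \<notin> elems H \<or> g \<notin> elems H \<Longrightarrow> inprod H f g = 0"
  by (rule H'[THEN conjunct2, THEN conjunct2, THEN conjunct2, THEN conjunct2, THEN conjunct2, THEN conjunct2, THEN conjunct2, THEN conjunct2, THEN conjunct2, THEN conjunct1, rule_format])

lemma hfs_complete:
  assumes "\<And>n. u n \<in> elems H" "\<And>e. e > 0 \<Longrightarrow> \<exists>M. \<forall>m\<ge>M. \<forall>n\<ge>M. fs_norm H (\<lambda>z. u m z - u n z) < e"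
  shows "\<exists>f\<in>elems H. (\<lambda>n. fs_norm H (\<lambda>z. u n z - f z)) \<longlonglongrightarrow> 0"
  by (rule H'[THEN conjunct2, THEN conjunct2, THEN conjunct2, THEN conjunct2, THEN conjunct2, THEN conjunct2, THEN conjunct2, THEN conjunct2, THEN conjunct2, THEN conjunct2, rule_format]) (use assms in auto)

lemma hfs_diff: "f \<in> elems H \<Longrightarrow> g \<in> elems H \<Longrightarrow> (\<lambda>z. f z - g z) \<in> elems H"
  using hfs_add[of f "\<lambda>z. (-1) * g z"] hfs_scale[of g "-1"] by simp

lemma hfs_inner_diff_left:
  "f \<in> elems H \<Longrightarrow> g \<in> elems H \<Longrightarrow> h \<in> elems H \<Longrightarrow> inprod H (\<lambda>z. f z - g z) h = inprod H f h - inprod H g h"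
  using hfs_inner_add[of f "\<lambda>z. (-1) * g z" h] hfs_inner_scale[of g h "-1"] hfs_scale[of g "-1"] by simp

lemma hfs_inner_diff_right:
  assumes "f \<in> elems H" "g \<in> elems H" "h \<in> elems H"
  shows "inprod H h (\<lambda>z. f z - g z) = inprod H h f - inprod H h g"
  by (simp only: hfs_inner_cnj[OF hfs_diff[OF assms(1,2)] assms(3)] hfs_inner_diff_left[OF assms]
      hfs_inner_cnj[OF assms(1,3)] hfs_inner_cnj[OF assms(2,3)] complex_cnj_diff)

lemma hfs_comb:
  assumes "finite S" "\<And>x. x \<in> S \<Longrightarrow> u x \<in> elems H"
  shows "(\<lambda>z. \<Sum>x\<in>S. c x * u x z) \<in> elems H"
    and "g \<in> elems H \<Longrightarrow> inprod H (\<lambda>z. \<Sum>x\<in>S. c x * u x z) g = (\<Sum>x\<in>S. c x * inprod H (u x) g)"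
proof -
  have "(\<lambda>z. \<Sum>x\<in>S. c x * u x z) \<in> elems H \<and>
     (g \<in> elems H \<longrightarrow> inprod H (\<lambda>z. \<Sum>x\<in>S. c x * u x z) g = (\<Sum>x\<in>S. c x * inprod H (u x) g))"
    using assms
  proof (induction S rule: finite_induct)
    case empty
    have "inprod H (\<lambda>z. 0) g = 0" if "g \<in> elems H" using hfs_inner_scale[OF hfs_zero that, of 0] by simp
    then show ?case by (simp add: hfs_zero)
  next
    case (insert x S)
    then have IH: "(\<lambda>z. \<Sum>x\<in>S. c x * u x z) \<in> elems H"
      "g \<in> elems H \<Longrightarrow> inprod H (\<lambda>z. \<Sum>x\<in>S. c x * u x z) g = (\<Sum>x\<in>S. c x * inprod H (u x) g)" and x: "u x \<in> elems H"
      by auto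
    show ?case
      using insert.hyps IH hfs_add[OF hfs_scale[OF x] IH(1)] hfs_inner_add[OF hfs_scale[OF x] IH(1)] hfs_inner_scale[OF x]
      by simp
  qed
  then show "(\<lambda>z. \<Sum>x\<in>S. c x * u x z) \<in> elems H"
    and "g \<in> elems H \<Longrightarrow> inprod H (\<lambda>z. \<Sum>x\<in>S. c x * u x z) g = (\<Sum>x\<in>S. c x * inprod H (u x) g)" by auto
qed

lemma hfs_comb_right:
  assumes "finite S" "\<And>x. x \<in> S \<Longrightarrow> u x \<in> elems H" "g \<in> elems H"
  shows "inprod H g (\<lambda>z. \<Sum>x\<in>S. c x * u x z) = (\<Sum>x\<in>S. cnj (c x) * inprod H g (u x))"
proof -
  have "inprod H g (\<lambda>z. \<Sum>x\<in>S. c x * u x z) = cnj (\<Sum>x\<in>S. c x * inprod H (u x) g)"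
    using hfs_inner_cnj[OF hfs_comb(1)[of S u c, OF assms(1,2)] assms(3)] hfs_comb(2)[of S u g c, OF assms] by simp
  also have "\<dots> = (\<Sum>x\<in>S. cnj (c x) * cnj (inprod H (u x) g))" by simp
  also have "\<dots> = (\<Sum>x\<in>S. cnj (c x) * inprod H g (u x))"
    by (intro sum.cong refl arg_cong2[where f = "(*)"] hfs_inner_cnj[symmetric] assms)
  finally show ?thesis .
qed

lemma hfs_psd: "psd (elems H) (\<lambda>g f. inprod H f g)"
proof (rule psdI)
  fix S c assume S: "finite S" "S \<subseteq> elems H"
  let ?h = "\<lambda>z. \<Sum>f\<in>S. c f * f z"
  have h: "?h \<in> elems H" by (rule hfs_comb(1)) (use S in auto)
  have "0 \<le> inprod H ?h ?h" by (rule hfs_inner_nonneg[OF h])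
  also have "\<dots> = (\<Sum>g\<in>S. cnj (c g) * inprod H ?h g)"
    by (rule hfs_comb_right) (use S h in auto)
  also have "\<dots> = (\<Sum>g\<in>S. cnj (c g) * (\<Sum>f\<in>S. c f * inprod H f g))"
  proof (rule sum.cong[OF refl])
    fix g assume "g \<in> S"
    then have "inprod H ?h g = (\<Sum>f\<in>S. c f * inprod H f g)" by (intro hfs_comb(2)) (use S in auto)
    then show "cnj (c g) * inprod H ?h g = cnj (c g) * (\<Sum>f\<in>S. c f * inprod H f g)" by simp
  qed
  also have "\<dots> = herm_form S (\<lambda>g f. inprod H f g) c c"
    by (simp add: herm_form_def sum_distrib_left mult_ac)
  finally show "0 \<le> herm_form S (\<lambda>g f. inprod H f g) c c" .
qed

lemma hfs_Cauchy_Schwarz: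
  "f \<in> elems H \<Longrightarrow> g \<in> elems H \<Longrightarrow> (cmod (inprod H f g))\<^sup>2 \<le> Re (inprod H f f) * Re (inprod H g g)"
  using psd_entry_bound[OF hfs_psd, of g f] by (simp add: mult.commute)

end

context
  fixes X :: "'a set" and k :: "'a \<Rightarrow> 'a \<Rightarrow> complex" and H :: "'a function_space"
  assumes H: "is_rkhs X k H"
begin

lemma is_rkhs_hilbert: "hilbert_function_space X H"
  and is_rkhs_section: "w \<in> X \<Longrightarrow> kernel_section X k w \<in> elems H"
  and is_rkhs_reproducing: "w \<in> X \<Longrightarrow> f \<in> elems H \<Longrightarrow> inprod H f (kernel_section X k w) = f w"
  using H by (auto simp: is_rkhs_def)

definition kernel_comb :: "'a set \<Rightarrow> ('a \<Rightarrow> complex) \<Rightarrow> 'a \<Rightarrow> complex" where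
  "kernel_comb S c = (\<lambda>z. \<Sum>x\<in>S. c x * kernel_section X k x z)"

lemma kernel_comb:
  assumes "finite S" "S \<subseteq> X"
  shows "kernel_comb S c \<in> elems H"
    and "f \<in> elems H \<Longrightarrow> inprod H f (kernel_comb S c) = (\<Sum>x\<in>S. cnj (c x) * f x)"
    and "inprod H (kernel_comb S c) (kernel_comb S c) = herm_form S k c c"
proof -
  show 1: "kernel_comb S c \<in> elems H"
    unfolding kernel_comb_def by (rule hfs_comb[OF is_rkhs_hilbert]) (use assms is_rkhs_section in auto)
  show 2: "inprod H f (kernel_comb S c) = (\<Sum>x\<in>S. cnj (c x) * f x)" if "f \<in> elems H" for f
  proof -
    have "inprod H f (kernel_comb S c) = (\<Sum>x\<in>S. cnj (c x) * inprod H f (kernel_section X k x))"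
      unfolding kernel_comb_def by (rule hfs_comb_right[OF is_rkhs_hilbert]) (use assms is_rkhs_section that in auto)
    also have "\<dots> = (\<Sum>x\<in>S. cnj (c x) * f x)"
      using assms that by (intro sum.cong refl) (auto simp: is_rkhs_reproducing)
    finally show ?thesis .
  qed
  show "inprod H (kernel_comb S c) (kernel_comb S c) = herm_form S k c c"
    unfolding 2[OF 1] herm_form_def
    using assms by (auto simp: kernel_comb_def kernel_section_def sum_distrib_left mult_ac intro!: sum.cong)
qed

lemma is_rkhs_bounded:
  assumes f: "f \<in> elems H" shows "kernel_bounded X k (Re (inprod H f f)) f"
  unfolding kernel_bounded_def
proof (intro allI impI)
  fix S c assume S: "finite S" "S \<subseteq> X"
  show "(cmod (\<Sum>x\<in>S. cnj (c x) * f x))\<^sup>2 \<le> Re (inprod H f f) * Re (herm_form S k c c)"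
    using hfs_Cauchy_Schwarz[OF is_rkhs_hilbert f kernel_comb(1)[OF S], of c]
    unfolding kernel_comb(2)[OF S f] kernel_comb(3)[OF S] .
qed

lemma kernel_comb_represents:
  assumes "represents k S y f" "S \<subseteq> X" "x \<in> S" shows "kernel_comb S y x = f x"
  using assms by (auto simp: represents_def kernel_comb_def kernel_section_def mult.commute intro!: sum.cong)

text \<open>The combination \<open>p S\<close> of kernel sections that agrees with \<open>f\<close> on \<open>S\<close> has norm squared \<open>a S\<close>, which
  increases with \<open>S\<close> and is at most \<open>C\<close>. Along a sequence of sets on which it tends to its supremum \<open>M\<close>, the
  functions \<open>p S\<close> form a Cauchy sequence. Its limit agrees with \<open>f\<close> also at points \<open>x\<close> that are in none of
  these sets, since adding \<open>x\<close> to a set changes \<open>p S\<close> by little.\<close>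

lemma is_rkhs_memberI:
  assumes k: "psd X k" and f0: "\<And>z. z \<notin> X \<Longrightarrow> f z = 0" and f: "kernel_bounded X k C f" and C: "0 \<le> C"
  shows "f \<in> elems H" "Re (inprod H f f) \<le> C"
proof -
  note hil = is_rkhs_hilbert
  define a where "a S = Re (finite_inner k S f f)" for S
  define p where "p S = kernel_comb S (finite_coeffs k S f)" for S
  define FS where "FS = {S. finite S \<and> S \<subseteq> X}"
  define M where "M = (SUP S\<in>FS. a S)"
  have pE: "p S \<in> elems H" if "S \<in> FS" for S using that kernel_comb(1) by (auto simp: p_def FS_def)
  have pf: "p S x = f x" if "S \<in> FS" "x \<in> S" for S x
    unfolding p_def by (rule kernel_comb_represents) (use that finite_coeffs[OF k f] in \<open>auto simp: FS_def\<close>)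
  have ip: "inprod H h (p S) = (\<Sum>x\<in>S. cnj (finite_coeffs k S f x) * h x)" if "S \<in> FS" "h \<in> elems H" for S h
    unfolding p_def by (rule kernel_comb(2)) (use that in \<open>auto simp: FS_def\<close>)
  have ia: "inprod H h (p S) = of_real (a S)" if "S \<in> FS" "h \<in> elems H" "\<And>x. x \<in> S \<Longrightarrow> h x = f x" for S h
  proof -
    have "inprod H h (p S) = finite_inner k S f f"
      unfolding ip[OF that(1,2)] finite_inner_def using that(3) by (intro sum.cong) auto
    also have "\<dots> = of_real (a S)"
      using finite_inner_self[OF k f] that(1) by (auto simp: FS_def a_def complex_nonneg_iff)
    finally show ?thesis .
  qed
  have diff: "Re (inprod H (\<lambda>z. p T z - p S z) (\<lambda>z. p T z - p S z)) = a T - a S"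
    "Re (inprod H (\<lambda>z. p S z - p T z) (\<lambda>z. p S z - p T z)) = a T - a S" if "S \<in> FS" "T \<in> FS" "S \<subseteq> T" for S T
  proof -
    have TS1: "inprod H (p T) (p S) = of_real (a S)"
      by (rule ia[OF that(1) pE[OF that(2)]]) (use pf[OF that(2)] that(3) in blast)
    have TS2: "inprod H (p S) (p T) = of_real (a S)"
      unfolding hfs_inner_cnj[OF hil pE[OF that(2)] pE[OF that(1)]] TS1 by simp
    note TS = TS1 TS2
    have SS: "inprod H (p S) (p S) = of_real (a S)" "inprod H (p T) (p T) = of_real (a T)"
      using ia[OF that(1) pE[OF that(1)] pf[OF that(1)]] ia[OF that(2) pE[OF that(2)] pf[OF that(2)]] by auto
    note e = pE[OF that(1)] pE[OF that(2)]
    show "Re (inprod H (\<lambda>z. p T z - p S z) (\<lambda>z. p T z - p S z)) = a T - a S"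
      using hfs_inner_diff_left[OF hil e(2,1) hfs_diff[OF hil e(2,1)]]
        hfs_inner_diff_right[OF hil e(2,1,1)] hfs_inner_diff_right[OF hil e(2,1,2)] by (simp add: TS SS)
    show "Re (inprod H (\<lambda>z. p S z - p T z) (\<lambda>z. p S z - p T z)) = a T - a S"
      using hfs_inner_diff_left[OF hil e(1,2) hfs_diff[OF hil e(1,2)]]
        hfs_inner_diff_right[OF hil e(1,2,1)] hfs_inner_diff_right[OF hil e(1,2,2)] by (simp add: TS SS)
  qed
  have aC: "a S \<le> C" if "S \<in> FS" for S using finite_inner_le[OF k f C] that by (auto simp: a_def FS_def)
  then have bdd: "bdd_above (a ` FS)" by (auto intro!: bdd_aboveI[of _ C])
  have ne: "{} \<in> FS" by (simp add: FS_def)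
  have aM: "a S \<le> M" if "S \<in> FS" for S unfolding M_def by (rule cSUP_upper[OF that bdd])
  have "\<exists>S\<in>FS. M - 1 / real (Suc n) < a S" for n
    using less_cSUP_iff[of FS a "M - 1 / real (Suc n)"] bdd ne unfolding M_def by auto
  then obtain S where S: "\<And>n. S n \<in> FS" "\<And>n. M - 1 / real (Suc n) < a (S n)" by metis
  define T where "T n = (\<Union>i\<le>n. S i)" for n
  have T: "T n \<in> FS" for n using S(1) by (auto simp: T_def FS_def)
  have Tmono: "T m \<subseteq> T n" if "m \<le> n" for m n using that by (fastforce simp: T_def)
  have amono: "a U \<le> a V" if "U \<subseteq> V" "V \<in> FS" for U V
    using finite_inner_mono[OF k f that(1)] that(2) by (simp add: a_def FS_def)
  have aT: "M - 1 / real (Suc n) < a (T n)" for n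
    using S(2)[of n] amono[of "S n" "T n"] T[of n] by (force simp: T_def)
  have near: "a V - a (T n) \<le> 1 / real (Suc n)" if "V \<in> FS" for V n
    using aM[OF that] aT[of n] by linarith
  have "\<exists>g\<in>elems H. (\<lambda>n. fs_norm H (\<lambda>z. p (T n) z - g z)) \<longlonglongrightarrow> 0"
  proof (rule hfs_complete[OF hil])
    show "p (T n) \<in> elems H" for n by (rule pE[OF T])
    fix e :: real assume e: "e > 0"
    then obtain M0 where M0: "1 / real (Suc M0) < e\<^sup>2" using nat_approx_posE[of "e\<^sup>2"] by auto
    have "fs_norm H (\<lambda>z. p (T m) z - p (T n) z) < e" if "m \<ge> M0" "n \<ge> M0" for m n
    proof -
      have le: "1 / real (Suc i) < e\<^sup>2" if "i \<ge> M0" for i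
        using M0 that by (smt (verit) frac_le of_nat_0_less_iff of_nat_mono zero_less_Suc Suc_le_mono)
      have "Re (inprod H (\<lambda>z. p (T m) z - p (T n) z) (\<lambda>z. p (T m) z - p (T n) z)) < e\<^sup>2"
      proof (cases "m \<le> n")
        case True
        then show ?thesis using diff(2)[OF T T Tmono[OF True]] near[OF T[of n], of m] le[OF that(1)] by linarith
      next
        case False
        then have "n \<le> m" by simp
        then show ?thesis using diff(1)[OF T T Tmono[OF \<open>n \<le> m\<close>]] near[OF T[of m], of n] le[OF that(2)] by linarith
      qed
      then show ?thesis unfolding fs_norm_def using e by (intro real_less_lsqrt) auto
    qed
    then show "\<exists>M. \<forall>m\<ge>M. \<forall>n\<ge>M. fs_norm H (\<lambda>z. p (T m) z - p (T n) z) < e" by blast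
  qed
  then obtain g where g: "g \<in> elems H" and lim: "(\<lambda>n. fs_norm H (\<lambda>z. p (T n) z - g z)) \<longlonglongrightarrow> 0" by blast
  have norm2: "(fs_norm H h)\<^sup>2 = Re (inprod H h h)" if "h \<in> elems H" for h
    using hfs_inner_nonneg[OF hil that] by (simp add: fs_norm_def less_eq_complex_def)
  have nn: "0 \<le> fs_norm H h" if "h \<in> elems H" for h
    using hfs_inner_nonneg[OF hil that] by (simp add: fs_norm_def less_eq_complex_def)
  have gf: "g x = f x" for x
  proof (cases "x \<in> X")
    case False
    then show ?thesis using hfs_outside[OF hil g] f0 by simp
  next
    case True
    have "(\<lambda>n. p (T n) x - g x) \<longlonglongrightarrow> 0"
    proof (rule Lim_null_comparison)
      have "(\<lambda>n. fs_norm H (\<lambda>z. p (T n) z - g z) * sqrt (Re (k x x))) \<longlonglongrightarrow> 0 * sqrt (Re (k x x))"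
        by (intro tendsto_intros lim)
      then show "(\<lambda>n. fs_norm H (\<lambda>z. p (T n) z - g z) * sqrt (Re (k x x))) \<longlonglongrightarrow> 0" by simp
      have "cmod (p (T n) x - g x) \<le> fs_norm H (\<lambda>z. p (T n) z - g z) * sqrt (Re (k x x))" for n
      proof -
        have d: "(\<lambda>z. p (T n) z - g z) \<in> elems H" by (rule hfs_diff[OF hil pE[OF T] g])
        have "0 \<le> Re (k x x)" using psd_diag[OF k True] by (simp add: less_eq_complex_def)
        then have "(cmod (p (T n) x - g x))\<^sup>2 \<le> (fs_norm H (\<lambda>z. p (T n) z - g z) * sqrt (Re (k x x)))\<^sup>2"
          using kernel_bounded_point[OF is_rkhs_bounded[OF d] True]
          unfolding power_mult_distrib norm2[OF d] by simp
        then show ?thesis by (rule power2_le_imp_le) (use \<open>0 \<le> Re (k x x)\<close> nn[OF d] in simp)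
      qed
      then show "\<forall>\<^sub>F n in sequentially. cmod (p (T n) x - g x) \<le> fs_norm H (\<lambda>z. p (T n) z - g z) * sqrt (Re (k x x))" by simp
    qed
    then have 1: "(\<lambda>n. p (T n) x) \<longlonglongrightarrow> g x" by (rule LIM_zero_cancel)
    have "(\<lambda>n. p (T n) x - f x) \<longlonglongrightarrow> 0"
    proof (rule Lim_null_comparison)
      have "(\<lambda>n. sqrt (1 / real (Suc n) * Re (k x x))) \<longlonglongrightarrow> sqrt (0 * Re (k x x))"
        by (intro tendsto_intros LIMSEQ_Suc[OF lim_1_over_n])
      then show "(\<lambda>n. sqrt (1 / real (Suc n) * Re (k x x))) \<longlonglongrightarrow> 0" by simp
      have "cmod (p (T n) x - f x) \<le> sqrt (1 / real (Suc n) * Re (k x x))" for n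
      proof -
        let ?V = "insert x (T n)"
        have V: "?V \<in> FS" using T[of n] True by (auto simp: FS_def)
        have d: "(\<lambda>z. p (T n) z - p ?V z) \<in> elems H" by (rule hfs_diff[OF hil pE[OF T] pE[OF V]])
        have "Re (inprod H (\<lambda>z. p (T n) z - p ?V z) (\<lambda>z. p (T n) z - p ?V z)) \<le> 1 / real (Suc n)"
          using diff(2)[OF T[of n] V subset_insertI] near[OF V, of n] by linarith
        from kernel_bounded_point[OF kernel_bounded_mono[OF k is_rkhs_bounded[OF d] this] True]
        have "(cmod (p (T n) x - f x))\<^sup>2 \<le> 1 / real (Suc n) * Re (k x x)" using pf[OF V] by simp
        then show ?thesis by (rule real_le_rsqrt)
      qed
      then show "\<forall>\<^sub>F n in sequentially. cmod (p (T n) x - f x) \<le> sqrt (1 / real (Suc n) * Re (k x x))" by simp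
    qed
    then have 2: "(\<lambda>n. p (T n) x) \<longlonglongrightarrow> f x" by (rule LIM_zero_cancel)
    show ?thesis by (rule LIMSEQ_unique[OF 1 2])
  qed
  then have "g = f" by auto
  then show fE: "f \<in> elems H" using g by simp
  have "(\<lambda>n. inprod H f (p (T n)) - inprod H f f) \<longlonglongrightarrow> 0"
  proof (rule Lim_null_comparison)
    have "(\<lambda>n. fs_norm H f * fs_norm H (\<lambda>z. p (T n) z - g z)) \<longlonglongrightarrow> fs_norm H f * 0"
      by (intro tendsto_intros lim)
    then show "(\<lambda>n. fs_norm H f * fs_norm H (\<lambda>z. p (T n) z - f z)) \<longlonglongrightarrow> 0" by (simp add: \<open>g = f\<close>)
    have "cmod (inprod H f (p (T n)) - inprod H f f) \<le> fs_norm H f * fs_norm H (\<lambda>z. p (T n) z - f z)" for n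
    proof -
      have d: "(\<lambda>z. p (T n) z - f z) \<in> elems H" by (rule hfs_diff[OF hil pE[OF T] fE])
      show ?thesis
        unfolding hfs_inner_diff_right[OF hil pE[OF T] fE fE, symmetric]
      proof (rule power2_le_imp_le)
        show "(cmod (inprod H f (\<lambda>z. p (T n) z - f z)))\<^sup>2 \<le> (fs_norm H f * fs_norm H (\<lambda>z. p (T n) z - f z))\<^sup>2"
          using hfs_Cauchy_Schwarz[OF hil fE d] unfolding power_mult_distrib norm2[OF d] norm2[OF fE] .
      qed (use nn[OF fE] nn[OF d] in simp)
    qed
    then show "\<forall>\<^sub>F n in sequentially. cmod (inprod H f (p (T n)) - inprod H f f) \<le>
       fs_norm H f * fs_norm H (\<lambda>z. p (T n) z - f z)" by simp
  qed
  then have "(\<lambda>n. inprod H f (p (T n))) \<longlonglongrightarrow> inprod H f f" by (rule LIM_zero_cancel)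
  then have limRe: "(\<lambda>n. Re (inprod H f (p (T n)))) \<longlonglongrightarrow> Re (inprod H f f)" by (rule tendsto_Re)
  have leC: "Re (inprod H f (p (T n))) \<le> C" for n using ia[OF T fE] aC[OF T] by simp
  show "Re (inprod H f f) \<le> C"
    by (rule tendsto_upperbound[OF limRe]) (use leC in auto)
qed

end

lemma is_rkhs_elems:
  assumes H: "is_rkhs X k H" and k: "psd X k" shows "elems H = bounded_functions X k"
proof (intro equalityI subsetI)
  fix f assume "f \<in> elems H"
  then show "f \<in> bounded_functions X k"
    using is_rkhs_bounded[OF H] hfs_outside[OF is_rkhs_hilbert[OF H]] by (auto simp: bounded_functions_def)
next
  fix f assume "f \<in> bounded_functions X k"
  then obtain C where "kernel_bounded X k C f" "0 \<le> C" "\<And>z. z \<notin> X \<Longrightarrow> f z = 0"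
    by (rule bounded_functionsE[OF k]) (rule that)
  then show "f \<in> elems H" using is_rkhs_memberI[OF H k] by blast
qed

text \<open>The elements are the bounded functions, their norms are the least bounds, and the norm determines the inner
  product by polarization.\<close>

lemma is_rkhs_unique:
  assumes H: "is_rkhs X k H" and H': "is_rkhs X k H'" and k: "psd X k"
  shows "H = H'"
proof -
  have E: "elems H = elems H'" using is_rkhs_elems[OF H k] is_rkhs_elems[OF H' k] by simp
  note hil = is_rkhs_hilbert[OF H] and hil' = is_rkhs_hilbert[OF H']
  have le: "Re (inprod H1 f f) \<le> Re (inprod H2 f f)"
    if "is_rkhs X k H1" "is_rkhs X k H2" "f \<in> elems H1" "f \<in> elems H2" for f H1 H2
    using is_rkhs_memberI(2)[OF that(1) k _ is_rkhs_bounded[OF that(2,4)]]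
      hfs_outside[OF is_rkhs_hilbert[OF that(1)] that(3)] hfs_inner_nonneg[OF is_rkhs_hilbert[OF that(2)] that(4)]
    by (auto simp: less_eq_complex_def)
  have N: "Re (inprod H f f) = Re (inprod H' f f)" if "f \<in> elems H" for f
  proof -
    have f': "f \<in> elems H'" using that E by simp
    show ?thesis using le[OF H H' that f'] le[OF H' H f' that] by linarith
  qed
  have polar: "2 * Re (inprod K f g) = Re (inprod K (\<lambda>z. f z + g z) (\<lambda>z. f z + g z)) - Re (inprod K f f) - Re (inprod K g g)"
    if K: "hilbert_function_space X K" and f: "f \<in> elems K" and g: "g \<in> elems K" for K f g
  proof -
    note fg = hfs_add[OF K f g]
    have 1: "inprod K f (\<lambda>z. f z + g z) = inprod K f f + inprod K f g"
      unfolding hfs_inner_cnj[OF K fg f] hfs_inner_add[OF K f g f]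
      by (simp flip: hfs_inner_cnj[OF K f f] hfs_inner_cnj[OF K g f])
    have 2: "inprod K g (\<lambda>z. f z + g z) = cnj (inprod K f g) + inprod K g g"
      unfolding hfs_inner_cnj[OF K fg g] hfs_inner_add[OF K f g g]
      by (simp flip: hfs_inner_cnj[OF K g g])
    show ?thesis unfolding hfs_inner_add[OF K f g fg] 1 2 by simp
  qed
  have Re: "Re (inprod H f g) = Re (inprod H' f g)" if "f \<in> elems H" "g \<in> elems H" for f g
    using polar[OF hil that] polar[OF hil', of f g] N[OF hfs_add[OF hil that]] N[OF that(1)] N[OF that(2)] that E by simp
  have "inprod H f g = inprod H' f g" for f g
  proof (cases "f \<in> elems H \<and> g \<in> elems H")
    case True
    then have fg: "f \<in> elems H" "g \<in> elems H" "f \<in> elems H'" "g \<in> elems H'" using E by auto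
    have "Im (inprod H f g) = Im (inprod H' f g)"
      using Re[OF hfs_scale[OF hil fg(1), of "- \<i>"] fg(2)]
        hfs_inner_scale[OF hil fg(1,2), of "- \<i>"] hfs_inner_scale[OF hil' fg(3,4), of "- \<i>"] by simp
    then show ?thesis using Re[OF fg(1,2)] by (simp add: complex_eq_iff)
  next
    case False
    then show ?thesis using hfs_inner_outside[OF hil] hfs_inner_outside[OF hil'] E by metis
  qed
  then show ?thesis using E by (intro function_space.equality) (auto simp: fun_eq_iff)
qed

lemma rkhs_is_rkhs:
  assumes "psd X k" shows "is_rkhs X k (rkhs X k)"
  unfolding rkhs_def
  by (rule theI[where P = "is_rkhs X k", OF bounded_function_space_rkhs[OF assms]])
     (rule is_rkhs_unique[OF _ bounded_function_space_rkhs[OF assms] assms])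

lemma rkhs_norm_sq:
  assumes "psd X k" "f \<in> elems (rkhs X k)"
  shows "(fs_norm (rkhs X k) f)\<^sup>2 = Re (inprod (rkhs X k) f f)"
  using hfs_inner_nonneg[OF is_rkhs_hilbert[OF rkhs_is_rkhs[OF assms(1)]] assms(2)]
  by (simp add: fs_norm_def less_eq_complex_def)

lemma rkhs_bounded:
  assumes "psd X k" "f \<in> elems (rkhs X k)"
  shows "kernel_bounded X k ((fs_norm (rkhs X k) f)\<^sup>2) f"
  unfolding rkhs_norm_sq[OF assms] by (rule is_rkhs_bounded[OF rkhs_is_rkhs[OF assms(1)] assms(2)])

lemma rkhs_memberI:
  assumes "psd X k" "\<And>z. z \<notin> X \<Longrightarrow> f z = 0" "kernel_bounded X k C f" "0 \<le> C"
  shows "f \<in> elems (rkhs X k)" "(fs_norm (rkhs X k) f)\<^sup>2 \<le> C"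
proof -
  note m = is_rkhs_memberI[OF rkhs_is_rkhs[OF assms(1)] assms]
  show "f \<in> elems (rkhs X k)" by (rule m(1))
  show "(fs_norm (rkhs X k) f)\<^sup>2 \<le> C" using rkhs_norm_sq[OF assms(1) m(1)] m(2) by linarith
qed

lemma rkhs_norm_approx:
  assumes k: "psd X k" and f: "f \<in> elems (rkhs X k)" and e: "e > 0"
  shows "\<exists>S. finite S \<and> S \<subseteq> X \<and> (\<forall>T. S \<subseteq> T \<longrightarrow> finite T \<longrightarrow> T \<subseteq> X \<longrightarrow>
    (fs_norm (rkhs X k) f)\<^sup>2 - e < Re (finite_inner k T f f))"
proof -
  let ?N = "(fs_norm (rkhs X k) f)\<^sup>2"
  note b = rkhs_bounded[OF k f]
  have "\<exists>S. finite S \<and> S \<subseteq> X \<and> ?N - e < Re (finite_inner k S f f)"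
  proof (rule ccontr)
    assume "\<not> ?thesis"
    then have le: "\<And>S. finite S \<Longrightarrow> S \<subseteq> X \<Longrightarrow> Re (finite_inner k S f f) \<le> ?N - e" by (meson linorder_not_less)
    have "0 \<le> ?N - e" using le[of "{}"] by (simp add: finite_inner_def)
    have z: "f z = 0" if "z \<notin> X" for z
      using hfs_outside[OF is_rkhs_hilbert[OF rkhs_is_rkhs[OF k]] f that] .
    have "?N \<le> ?N - e"
      by (rule rkhs_memberI(2)[OF k z kernel_boundedI[OF k b le] \<open>0 \<le> ?N - e\<close>])
    then show False using e by simp
  qed
  then obtain S where S: "finite S" "S \<subseteq> X" "?N - e < Re (finite_inner k S f f)" by blast
  have "?N - e < Re (finite_inner k T f f)" if "S \<subseteq> T" "finite T" "T \<subseteq> X" for T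
    using finite_inner_mono[OF k b that] S(3) by linarith
  then show ?thesis using S(1,2) by blast
qed

section \<open>Contractive multipliers\<close>

text \<open>For \<open>v = \<Sum> c(x, a) l\<^sub>x \<otimes> e\<^sub>a\<close>, this is the norm squared of \<open>v\<close> minus that of its image under the adjoint of
  multiplication by \<open>\<Phi>\<close>.\<close>

lemma herm_form_blocks:
  fixes N :: nat
  assumes "finite E"
  shows "herm_form (E \<times> {..<N}) (pick_kernel k l N \<Phi>) c c =
    (\<Sum>a<N. herm_form E l (\<lambda>x. c (x, a)) (\<lambda>x. c (x, a))) -
    (\<Sum>r<N. herm_form E k (\<lambda>x. \<Sum>b<N. cnj (\<Phi> x b r) * c (x, b)) (\<lambda>x. \<Sum>b<N. cnj (\<Phi> x b r) * c (x, b)))"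
proof -
  have "herm_form (E \<times> {..<N}) (pick_kernel k l N \<Phi>) c c =
     (\<Sum>x\<in>E. \<Sum>a<N. \<Sum>y\<in>E. \<Sum>b<N. cnj (c (x, a)) * (if a = b then l x y else 0) * c (y, b)) -
     (\<Sum>x\<in>E. \<Sum>a<N. \<Sum>y\<in>E. \<Sum>b<N. cnj (c (x, a)) * (k x y * (\<Sum>r<N. \<Phi> x a r * cnj (\<Phi> y b r))) * c (y, b))"
    unfolding herm_form_def
    by (simp add: sum.cartesian_product' pick_kernel_def left_diff_distrib right_diff_distrib sum_subtractf cong: if_cong)
  also have "(\<Sum>x\<in>E. \<Sum>a<N. \<Sum>y\<in>E. \<Sum>b<N. cnj (c (x, a)) * (if a = b then l x y else 0) * c (y, b)) =
     (\<Sum>x\<in>E. \<Sum>a<N. \<Sum>y\<in>E. cnj (c (x, a)) * l x y * c (y, a))"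
    by (intro sum.cong refl) (simp add: if_distrib if_distribR cong: if_cong)
  also have "\<dots> = (\<Sum>a<N. herm_form E l (\<lambda>x. c (x, a)) (\<lambda>x. c (x, a)))"
    unfolding herm_form_def by (rule sum.swap)
  also have "(\<Sum>x\<in>E. \<Sum>a<N. \<Sum>y\<in>E. \<Sum>b<N. cnj (c (x, a)) * (k x y * (\<Sum>r<N. \<Phi> x a r * cnj (\<Phi> y b r))) * c (y, b)) =
     (\<Sum>x\<in>E. \<Sum>y\<in>E. \<Sum>r<N. \<Sum>a<N. \<Sum>b<N. cnj (c (x, a)) * k x y * \<Phi> x a r * cnj (\<Phi> y b r) * c (y, b))"
  proof (rule sum.cong[OF refl])
    fix x
    have "(\<Sum>a<N. \<Sum>y\<in>E. \<Sum>b<N. cnj (c (x, a)) * (k x y * (\<Sum>r<N. \<Phi> x a r * cnj (\<Phi> y b r))) * c (y, b)) =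
      (\<Sum>y\<in>E. \<Sum>a<N. \<Sum>b<N. cnj (c (x, a)) * (k x y * (\<Sum>r<N. \<Phi> x a r * cnj (\<Phi> y b r))) * c (y, b))"
      by (rule sum.swap)
    also have "\<dots> = (\<Sum>y\<in>E. \<Sum>a<N. \<Sum>b<N. \<Sum>r<N. cnj (c (x, a)) * k x y * \<Phi> x a r * cnj (\<Phi> y b r) * c (y, b))"
      by (simp add: sum_distrib_left sum_distrib_right mult_ac)
    also have "\<dots> = (\<Sum>y\<in>E. \<Sum>a<N. \<Sum>r<N. \<Sum>b<N. cnj (c (x, a)) * k x y * \<Phi> x a r * cnj (\<Phi> y b r) * c (y, b))"
      by (intro sum.cong refl sum.swap)
    also have "\<dots> = (\<Sum>y\<in>E. \<Sum>r<N. \<Sum>a<N. \<Sum>b<N. cnj (c (x, a)) * k x y * \<Phi> x a r * cnj (\<Phi> y b r) * c (y, b))"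
      by (intro sum.cong refl sum.swap)
    finally show "(\<Sum>a<N. \<Sum>y\<in>E. \<Sum>b<N. cnj (c (x, a)) * (k x y * (\<Sum>r<N. \<Phi> x a r * cnj (\<Phi> y b r))) * c (y, b)) =
      (\<Sum>y\<in>E. \<Sum>r<N. \<Sum>a<N. \<Sum>b<N. cnj (c (x, a)) * k x y * \<Phi> x a r * cnj (\<Phi> y b r) * c (y, b))" .
  qed
  also have "\<dots> = (\<Sum>x\<in>E. \<Sum>r<N. \<Sum>y\<in>E. \<Sum>a<N. \<Sum>b<N. cnj (c (x, a)) * k x y * \<Phi> x a r * cnj (\<Phi> y b r) * c (y, b))"
    by (intro sum.cong refl sum.swap)
  also have "\<dots> = (\<Sum>r<N. \<Sum>x\<in>E. \<Sum>y\<in>E. \<Sum>a<N. \<Sum>b<N. cnj (c (x, a)) * k x y * \<Phi> x a r * cnj (\<Phi> y b r) * c (y, b))"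
    by (rule sum.swap)
  also have "\<dots> = (\<Sum>r<N. herm_form E k (\<lambda>x. \<Sum>b<N. cnj (\<Phi> x b r) * c (x, b)) (\<lambda>x. \<Sum>b<N. cnj (\<Phi> x b r) * c (x, b)))"
    unfolding herm_form_def
    by (simp add: sum_distrib_left sum_distrib_right mult_ac)
  finally show ?thesis .
qed

lemma psd_blocksI:
  assumes "\<And>E c. finite E \<Longrightarrow> E \<subseteq> X \<Longrightarrow> 0 \<le> herm_form (E \<times> {..<N}) A c c"
  shows "psd (X \<times> {..<N::nat}) A"
proof (rule psdI)
  fix S c assume S: "finite S" "S \<subseteq> X \<times> {..<N}"
  let ?E = "fst ` S"
  have E: "finite ?E" "?E \<subseteq> X" "finite (?E \<times> {..<N})" "S \<subseteq> ?E \<times> {..<N}" using S by force+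
  have "0 \<le> herm_form (?E \<times> {..<N}) A (\<lambda>x. if x \<in> S then c x else 0) (\<lambda>x. if x \<in> S then c x else 0)"
    by (rule assms[OF E(1,2)])
  then show "0 \<le> herm_form S A c c" using herm_form_extend[OF E(3,4), of A c c] by simp
qed

text \<open>The Cauchy--Schwarz inequality in the tensor product with \<open>\<complex>\<^sup>N\<close>, between \<open>F\<close> and a combination of kernel
  sections.\<close>

lemma tensor_pairing_bound:
  assumes l: "psd X l" and F: "\<And>a. a < N \<Longrightarrow> F a \<in> elems (rkhs X l)" and E: "finite E" "E \<subseteq> X"
  shows "(cmod (\<Sum>a<N. \<Sum>x\<in>E. cnj (c a x) * F a x))\<^sup>2 \<le>
    (\<Sum>a<N. (fs_norm (rkhs X l) (F a))\<^sup>2) * (\<Sum>a<N. Re (herm_form E l (c a) (c a)))"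
proof -
  define n where "n a = fs_norm (rkhs X l) (F a)" for a
  define q where "q a = sqrt (Re (herm_form E l (c a) (c a)))" for a
  have q: "(q a)\<^sup>2 = Re (herm_form E l (c a) (c a))" for a
    using psd_form_nonneg[OF l E, of "c a"] by (simp add: q_def)
  have "cmod (\<Sum>a<N. \<Sum>x\<in>E. cnj (c a x) * F a x) \<le> (\<Sum>a<N. cmod (\<Sum>x\<in>E. cnj (c a x) * F a x))"
    by (rule norm_sum)
  also have "\<dots> \<le> (\<Sum>a<N. \<bar>n a\<bar> * \<bar>q a\<bar>)"
  proof (rule sum_mono)
    fix a assume "a \<in> {..<N}"
    then have "(cmod (\<Sum>x\<in>E. cnj (c a x) * F a x))\<^sup>2 \<le> (\<bar>n a\<bar> * \<bar>q a\<bar>)\<^sup>2"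
      using kernel_boundedD[OF rkhs_bounded[OF l F] E, of a "c a"] by (simp add: n_def q power_mult_distrib)
    then show "cmod (\<Sum>x\<in>E. cnj (c a x) * F a x) \<le> \<bar>n a\<bar> * \<bar>q a\<bar>"
      by (rule power2_le_imp_le) simp
  qed
  also have "\<dots> \<le> L2_set n {..<N} * L2_set q {..<N}" by (rule L2_set_mult_ineq)
  finally have "(cmod (\<Sum>a<N. \<Sum>x\<in>E. cnj (c a x) * F a x))\<^sup>2 \<le> (L2_set n {..<N} * L2_set q {..<N})\<^sup>2"
    by (rule power_mono) simp
  also have "\<dots> = (\<Sum>a<N. (n a)\<^sup>2) * (\<Sum>a<N. (q a)\<^sup>2)"
    by (simp add: L2_set_def power_mult_distrib sum_nonneg)
  finally show ?thesis by (simp add: n_def q)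
qed

context
  fixes X :: "'a set" and k l :: "'a \<Rightarrow> 'a \<Rightarrow> complex"
  assumes k: "psd X k" and l: "psd X l"
begin

lemma kernel_comb_norm:
  assumes E: "finite E" "E \<subseteq> X"
  shows "kernel_comb X k E c \<in> elems (rkhs X k)"
    "(fs_norm (rkhs X k) (kernel_comb X k E c))\<^sup>2 = Re (herm_form E k c c)"
  using kernel_comb[OF rkhs_is_rkhs[OF k] E] rkhs_norm_sq[OF k] by auto

text \<open>The pairing of \<open>\<Phi> f\<close> with a combination of kernel sections is that of \<open>f\<close> with the image of the combination under the
  adjoint.\<close>

lemma sum_pairing_swap:
  fixes N :: nat
  assumes "\<And>x a. x \<in> E \<Longrightarrow> a < N \<Longrightarrow> F a x = (\<Sum>r<N. \<Phi> x a r * f r x)"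
  shows "(\<Sum>a<N. \<Sum>x\<in>E. cnj (c (x, a)) * F a x) =
    (\<Sum>r<N. \<Sum>x\<in>E. cnj (\<Sum>b<N. cnj (\<Phi> x b r) * c (x, b)) * f r x)"
proof -
  have "(\<Sum>a<N. \<Sum>x\<in>E. cnj (c (x, a)) * F a x) = (\<Sum>a<N. \<Sum>x\<in>E. \<Sum>r<N. cnj (c (x, a)) * (\<Phi> x a r * f r x))"
    using assms by (simp add: sum_distrib_left)
  also have "\<dots> = (\<Sum>x\<in>E. \<Sum>a<N. \<Sum>r<N. cnj (c (x, a)) * (\<Phi> x a r * f r x))" by (rule sum.swap)
  also have "\<dots> = (\<Sum>x\<in>E. \<Sum>r<N. \<Sum>a<N. cnj (c (x, a)) * (\<Phi> x a r * f r x))" by (intro sum.cong refl sum.swap)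
  also have "\<dots> = (\<Sum>r<N. \<Sum>x\<in>E. \<Sum>a<N. cnj (c (x, a)) * (\<Phi> x a r * f r x))" by (rule sum.swap)
  also have "\<dots> = (\<Sum>r<N. \<Sum>x\<in>E. cnj (\<Sum>b<N. cnj (\<Phi> x b r) * c (x, b)) * f r x)"
    by (simp add: sum_distrib_left mult_ac)
  finally show ?thesis .
qed

lemma mult_op_component:
  assumes "\<Phi> z \<in> carrier_mat N N" "f z \<in> carrier_vec N" "z \<in> X" "a < N"
  shows "vec_index (mult_op X N \<Phi> f z) a = (\<Sum>r<N. \<Phi> z $$ (a, r) * vec_index (f z) r)"
  using assms by (simp add: mult_op_def scalar_prod_def row_def lessThan_atLeast0)

text \<open>The multiplier is tested on the image of a combination of kernel sections under its adjoint, normalized by \<open>\<tau>\<close>.\<close>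

theorem psd_of_contractive_multiplier:
  assumes \<Phi>: "\<Phi> \<in> Mult X k l N" and norm: "mult_norm X k l N \<Phi> \<le> 1"
  shows "psd (X \<times> {..<N}) (pick_kernel k l N (\<lambda>x a b. \<Phi> x $$ (a, b)))"
proof (rule psd_blocksI)
  fix E and c :: "'a \<times> nat \<Rightarrow> complex" assume E: "finite E" "E \<subseteq> X"
  define d where "d r x = (\<Sum>b<N. cnj (\<Phi> x $$ (b, r)) * c (x, b))" for r x
  define t where "t = (\<Sum>r<N. Re (herm_form E k (d r) (d r)))"
  define s where "s = (\<Sum>a<N. Re (herm_form E l (\<lambda>x. c (x, a)) (\<lambda>x. c (x, a))))"
  have t0: "0 \<le> t" unfolding t_def by (intro sum_nonneg psd_form_nonneg[OF k E])
  have s0: "0 \<le> s" unfolding s_def by (intro sum_nonneg psd_form_nonneg[OF l E])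
  have form: "herm_form (E \<times> {..<N}) (pick_kernel k l N (\<lambda>x a b. \<Phi> x $$ (a, b))) c c = of_real (s - t)"
    unfolding herm_form_blocks[OF E(1)] s_def t_def d_def[symmetric]
    by (simp only: of_real_diff of_real_sum psd_form_real[OF k E, symmetric] psd_form_real[OF l E, symmetric])
  have "t \<le> s"
  proof (cases "t = 0")
    case True
    then show ?thesis using s0 by simp
  next
    case False
    then have tpos: "t > 0" using t0 by simp
    define \<tau> where "\<tau> = 1 / sqrt t"
    define g where "g r = kernel_comb X k E (\<lambda>x. of_real \<tau> * d r x)" for r
    define f where "f z = Matrix.vec N (\<lambda>r. g r z)" for z
    have gE: "g r \<in> elems (rkhs X k)" for r unfolding g_def by (rule kernel_comb_norm[OF E])
    have gn: "(fs_norm (rkhs X k) (g r))\<^sup>2 = \<tau>\<^sup>2 * Re (herm_form E k (d r) (d r))" for r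
      unfolding g_def kernel_comb_norm[OF E] herm_form_scale_left herm_form_scale_right
      by (simp add: power2_eq_square)
    have comp: "(\<lambda>z. vec_index (f z) r) = g r" if "r < N" for r using that by (simp add: f_def)
    have fE: "f \<in> tensor_elems (rkhs X k) N"
      unfolding tensor_elems_def using comp gE by (auto simp: f_def)
    have "(\<Sum>i<N. (fs_norm (rkhs X k) (\<lambda>z. vec_index (f z) i))\<^sup>2) = (\<Sum>r<N. (fs_norm (rkhs X k) (g r))\<^sup>2)"
      by (intro sum.cong refl) (simp add: comp)
    also have "\<dots> = \<tau>\<^sup>2 * t" by (simp add: gn t_def sum_distrib_left)
    also have "\<dots> = 1" using tpos by (simp add: \<tau>_def power_divide)
    finally have fn: "tensor_norm (rkhs X k) N f \<le> 1" by (simp add: tensor_norm_def)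
    define F where "F a z = vec_index (mult_op X N \<Phi> f z) a" for a z
    have "mult_op X N \<Phi> f \<in> tensor_elems (rkhs X l) N" using \<Phi> fE by (auto simp: Mult_def)
    then have FE: "F a \<in> elems (rkhs X l)" if "a < N" for a using that by (auto simp: tensor_elems_def F_def[abs_def])
    have "ennreal (tensor_norm (rkhs X l) N (mult_op X N \<Phi> f)) \<le> mult_norm X k l N \<Phi>"
      unfolding mult_norm_def using fE fn by (intro SUP_upper) auto
    then have "ennreal (tensor_norm (rkhs X l) N (mult_op X N \<Phi> f)) \<le> ennreal 1"
      unfolding ennreal_1 using norm by (rule order_trans)
    then have "tensor_norm (rkhs X l) N (mult_op X N \<Phi> f) \<le> 1"
      using ennreal_le_iff[of 1] by fastforce
    then have Fn: "(\<Sum>a<N. (fs_norm (rkhs X l) (F a))\<^sup>2) \<le> 1"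
      by (simp add: tensor_norm_def F_def[abs_def])
    have "F a x = (\<Sum>r<N. \<Phi> x $$ (a, r) * g r x)" if "x \<in> E" "a < N" for x a
    proof -
      have "\<Phi> x \<in> carrier_mat N N" "x \<in> X" using \<Phi> that E by (auto simp: Mult_def)
      then show ?thesis unfolding F_def by (subst mult_op_component) (use that in \<open>auto simp: f_def intro!: sum.cong\<close>)
    qed
    then have "(\<Sum>a<N. \<Sum>x\<in>E. cnj (c (x, a)) * F a x) = (\<Sum>r<N. \<Sum>x\<in>E. cnj (d r x) * g r x)"
      unfolding d_def by (rule sum_pairing_swap)
    also have "\<dots> = (\<Sum>r<N. of_real \<tau> * herm_form E k (d r) (d r))"
    proof (rule sum.cong[OF refl])
      fix r
      have "(\<Sum>x\<in>E. cnj (d r x) * g r x) = (\<Sum>x\<in>E. cnj (d r x) * (\<Sum>y\<in>E. of_real \<tau> * d r y * k x y))"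
        using E by (intro sum.cong refl) (auto simp: g_def kernel_comb_def[OF rkhs_is_rkhs[OF k]] kernel_section_def intro!: sum.cong)
      also have "\<dots> = of_real \<tau> * herm_form E k (d r) (d r)"
        by (simp add: herm_form_def sum_distrib_left mult_ac)
      finally show "(\<Sum>x\<in>E. cnj (d r x) * g r x) = of_real \<tau> * herm_form E k (d r) (d r)" .
    qed
    also have "\<dots> = of_real (\<tau> * t)"
      using psd_form_real[OF k E] by (simp add: t_def sum_distrib_left)
    finally have eq: "(\<Sum>a<N. \<Sum>x\<in>E. cnj (c (x, a)) * F a x) = of_real (\<tau> * t)" .
    have "(\<tau> * t)\<^sup>2 \<le> (\<Sum>a<N. (fs_norm (rkhs X l) (F a))\<^sup>2) * s"
      using tensor_pairing_bound[OF l, of N F E "\<lambda>a x. c (x, a)", OF FE E] unfolding eq s_def[symmetric] norm_of_real power2_abs .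
    also have "\<dots> \<le> 1 * s" by (intro mult_right_mono Fn s0)
    finally show "t \<le> s" using tpos by (simp add: \<tau>_def power_divide power2_eq_square)
  qed
  then show "0 \<le> herm_form (E \<times> {..<N}) (pick_kernel k l N (\<lambda>x a b. \<Phi> x $$ (a, b))) c c"
    unfolding form by (simp add: less_eq_complex_def del: of_real_diff)
qed

text \<open>Positivity bounds the pairings of \<open>\<Phi> f\<close> with combinations of kernel sections by the norm of \<open>f\<close>. For each component this
  gives membership in the space; for the norm of all components together, the combination is the one that represents
  them on a finite set that is large enough for all of them.\<close>

theorem contractive_multiplier_of_psd:
  assumes car: "\<And>x. x \<in> X \<Longrightarrow> \<Phi> x \<in> carrier_mat N N"
    and psd: "psd (X \<times> {..<N}) (pick_kernel k l N (\<lambda>x a b. \<Phi> x $$ (a, b)))"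
  shows "\<Phi> \<in> Mult X k l N" "mult_norm X k l N \<Phi> \<le> 1"
proof -
  have main: "mult_op X N \<Phi> f \<in> tensor_elems (rkhs X l) N \<and>
      tensor_norm (rkhs X l) N (mult_op X N \<Phi> f) \<le> tensor_norm (rkhs X k) N f"
    if f: "f \<in> tensor_elems (rkhs X k) N" for f
  proof -
    define g where "g r z = vec_index (f z) r" for r z
    have gE: "g r \<in> elems (rkhs X k)" if "r < N" for r using f that by (auto simp: tensor_elems_def g_def[abs_def])
    define F where "F a z = vec_index (mult_op X N \<Phi> f z) a" for a z
    have F0: "F a z = 0" if "z \<notin> X" "a < N" for a z using that by (simp add: F_def mult_op_def)
    have FX: "F a x = (\<Sum>r<N. \<Phi> x $$ (a, r) * g r x)" if "x \<in> X" "a < N" for x a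
      unfolding F_def g_def by (rule mult_op_component) (use car f that in \<open>auto simp: tensor_elems_def\<close>)
    define n where "n = (\<Sum>r<N. (fs_norm (rkhs X k) (g r))\<^sup>2)"
    have n0: "0 \<le> n" unfolding n_def by (intro sum_nonneg) auto
    have pair: "(cmod (\<Sum>a<N. \<Sum>x\<in>E. cnj (c (x, a)) * F a x))\<^sup>2 \<le>
        n * (\<Sum>a<N. Re (herm_form E l (\<lambda>x. c (x, a)) (\<lambda>x. c (x, a))))" if E: "finite E" "E \<subseteq> X" for E c
    proof -
      define d where "d r x = (\<Sum>b<N. cnj (\<Phi> x $$ (b, r)) * c (x, b))" for r x
      have "(\<Sum>a<N. \<Sum>x\<in>E. cnj (c (x, a)) * F a x) = (\<Sum>r<N. \<Sum>x\<in>E. cnj (d r x) * g r x)"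
        unfolding d_def by (rule sum_pairing_swap) (use FX E in auto)
      moreover have "(cmod (\<Sum>r<N. \<Sum>x\<in>E. cnj (d r x) * g r x))\<^sup>2 \<le> n * (\<Sum>r<N. Re (herm_form E k (d r) (d r)))"
      proof -
        have "(cmod (\<Sum>r<N. \<Sum>x\<in>E. cnj (d r x) * g r x))\<^sup>2 \<le>
          (\<Sum>a<N. (fs_norm (rkhs X k) (g a))\<^sup>2) * (\<Sum>a<N. Re (herm_form E k (d a) (d a)))"
          by (rule tensor_pairing_bound[OF k gE E])
        then show ?thesis by (simp add: n_def)
      qed
      moreover have "(\<Sum>r<N. Re (herm_form E k (d r) (d r))) \<le> (\<Sum>a<N. Re (herm_form E l (\<lambda>x. c (x, a)) (\<lambda>x. c (x, a))))"
      proof -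
        have "0 \<le> herm_form (E \<times> {..<N}) (pick_kernel k l N (\<lambda>x a b. \<Phi> x $$ (a, b))) c c"
          by (rule psdD[OF psd]) (use E in auto)
        then show ?thesis unfolding herm_form_blocks[OF E(1)] d_def[symmetric] by (simp add: less_eq_complex_def)
      qed
      ultimately show ?thesis using n0 by (smt (verit) mult_left_mono)
    qed
    have FE: "F a \<in> elems (rkhs X l)" if a: "a < N" for a
    proof (rule rkhs_memberI(1)[OF l F0[OF _ a] _ n0])
      show "kernel_bounded X l n (F a)"
        unfolding kernel_bounded_def
      proof (intro allI impI)
        fix S and c :: "'a \<Rightarrow> complex" assume S: "finite S" "S \<subseteq> X"
        define c' where "c' p = (if snd p = a then c (fst p) else 0)" for p
        have 1: "(\<Sum>b<N. \<Sum>x\<in>S. cnj (c' (x, b)) * F b x) = (\<Sum>x\<in>S. cnj (c x) * F a x)"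
        proof -
          have "(\<Sum>b<N. \<Sum>x\<in>S. cnj (c' (x, b)) * F b x) = (\<Sum>b<N. if b = a then \<Sum>x\<in>S. cnj (c x) * F a x else 0)"
            by (intro sum.cong refl) (auto simp: c'_def)
          then show ?thesis using a by simp
        qed
        have 2: "(\<Sum>b<N. Re (herm_form S l (\<lambda>x. c' (x, b)) (\<lambda>x. c' (x, b)))) = Re (herm_form S l c c)"
        proof -
          have "(\<Sum>b<N. Re (herm_form S l (\<lambda>x. c' (x, b)) (\<lambda>x. c' (x, b)))) = (\<Sum>b<N. if b = a then Re (herm_form S l c c) else 0)"
            by (intro sum.cong refl) (auto simp: c'_def herm_form_def)
          then show ?thesis using a by simp
        qed
        show "(cmod (\<Sum>x\<in>S. cnj (c x) * F a x))\<^sup>2 \<le> n * Re (herm_form S l c c)"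
          using pair[OF S, of c'] unfolding 1 2 .
      qed
    qed auto
    have le: "(\<Sum>a<N. (fs_norm (rkhs X l) (F a))\<^sup>2) \<le> n"
    proof (rule field_le_epsilon)
      fix e :: real assume e: "e > 0"
      define e' where "e' = e / (real N + 1)"
      have e': "e' > 0" using e by (simp add: e'_def)
      have "\<exists>S. finite S \<and> S \<subseteq> X \<and> (\<forall>T. S \<subseteq> T \<longrightarrow> finite T \<longrightarrow> T \<subseteq> X \<longrightarrow>
          (fs_norm (rkhs X l) (F a))\<^sup>2 - e' < Re (finite_inner l T (F a) (F a)))" if "a < N" for a
        by (rule rkhs_norm_approx[OF l FE[OF that] e'])
      then obtain S where S: "\<And>a. a < N \<Longrightarrow> finite (S a)" "\<And>a. a < N \<Longrightarrow> S a \<subseteq> X"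
        "\<And>a T. a < N \<Longrightarrow> S a \<subseteq> T \<Longrightarrow> finite T \<Longrightarrow> T \<subseteq> X \<Longrightarrow>
          (fs_norm (rkhs X l) (F a))\<^sup>2 - e' < Re (finite_inner l T (F a) (F a))" by metis
      define T where "T = (\<Union>a<N. S a)"
      have T: "finite T" "T \<subseteq> X" using S(1,2) by (auto simp: T_def)
      define c where "c p = finite_coeffs l T (F (snd p)) (fst p)" for p
      define \<tau> where "\<tau> = (\<Sum>a<N. Re (finite_inner l T (F a) (F a)))"
      have fi: "finite_inner l T (F a) (F a) = of_real (Re (finite_inner l T (F a) (F a)))"
          "0 \<le> Re (finite_inner l T (F a) (F a))"
          "herm_form T l (finite_coeffs l T (F a)) (finite_coeffs l T (F a)) = finite_inner l T (F a) (F a)" if "a < N" for a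
        using finite_inner_self[OF l rkhs_bounded[OF l FE[OF that]] T] by (auto simp: complex_nonneg_iff)
      have "(\<Sum>a<N. \<Sum>x\<in>T. cnj (c (x, a)) * F a x) = (\<Sum>a<N. finite_inner l T (F a) (F a))"
        by (simp add: c_def finite_inner_def)
      also have "\<dots> = of_real \<tau>" using fi(1) by (simp add: \<tau>_def)
      finally have 1: "(\<Sum>a<N. \<Sum>x\<in>T. cnj (c (x, a)) * F a x) = of_real \<tau>" .
      have 2: "(\<Sum>a<N. Re (herm_form T l (\<lambda>x. c (x, a)) (\<lambda>x. c (x, a)))) = \<tau>"
        unfolding \<tau>_def c_def by (intro sum.cong refl) (simp add: fi(3))
      have "0 \<le> \<tau>" unfolding \<tau>_def using fi(2) by (intro sum_nonneg) auto
      moreover have "\<tau> * \<tau> \<le> n * \<tau>" using pair[OF T, of c] unfolding 1 2 by (simp add: power2_eq_square)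
      ultimately have "\<tau> \<le> n" using n0 by (cases "\<tau> = 0") auto
      have "(\<Sum>a<N. (fs_norm (rkhs X l) (F a))\<^sup>2) \<le> (\<Sum>a<N. Re (finite_inner l T (F a) (F a)) + e')"
      proof (rule sum_mono)
        fix a assume "a \<in> {..<N}"
        then have "(fs_norm (rkhs X l) (F a))\<^sup>2 - e' < Re (finite_inner l T (F a) (F a))"
          using S(3)[of a T] T by (auto simp: T_def)
        then show "(fs_norm (rkhs X l) (F a))\<^sup>2 \<le> Re (finite_inner l T (F a) (F a)) + e'" by simp
      qed
      also have "\<dots> = \<tau> + real N * e'" by (simp add: \<tau>_def sum.distrib)
      also have "real N * e' \<le> e" using e by (simp add: e'_def field_simps)
      finally show "(\<Sum>a<N. (fs_norm (rkhs X l) (F a))\<^sup>2) \<le> n + e" using \<open>\<tau> \<le> n\<close> by simp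
    qed
    have "mult_op X N \<Phi> f z \<in> carrier_vec N" for z
    proof (cases "z \<in> X")
      case True
      moreover have "f z \<in> carrier_vec N" using f by (auto simp: tensor_elems_def)
      ultimately show ?thesis using mult_mat_vec_carrier[OF car[OF True]] by (simp add: mult_op_def)
    qed (simp add: mult_op_def)
    then have "mult_op X N \<Phi> f \<in> tensor_elems (rkhs X l) N"
      using FE by (auto simp: tensor_elems_def F_def[abs_def])
    moreover have "tensor_norm (rkhs X l) N (mult_op X N \<Phi> f) \<le> tensor_norm (rkhs X k) N f"
      using le unfolding tensor_norm_def n_def F_def[abs_def] g_def[abs_def] by simp
    ultimately show ?thesis by blast
  qed
  show "\<Phi> \<in> Mult X k l N" using main car by (auto simp: Mult_def)
  show "mult_norm X k l N \<Phi> \<le> 1"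
    unfolding mult_norm_def
  proof (rule SUP_least)
    fix f assume "f \<in> {f \<in> tensor_elems (rkhs X k) N. tensor_norm (rkhs X k) N f \<le> 1}"
    then have "tensor_norm (rkhs X l) N (mult_op X N \<Phi> f) \<le> 1" using main[of f] by force
    then show "ennreal (tensor_norm (rkhs X l) N (mult_op X N \<Phi> f)) \<le> 1"
      using ennreal_leI[of _ 1] by simp
  qed
qed

end

section \<open>The complete Pick property in terms of positive semi-definite functions\<close>

lemma pos_semidef_iff_psd: "pos_semidef (Matrix.mat n n (\<lambda>(i, j). f i j)) \<longleftrightarrow> psd {..<n} f"
proof -
  have form: "(Matrix.mat n n (\<lambda>(i, j). f i j) *\<^sub>v v) \<bullet>c v = herm_form {..<n} f (vec_index v) (vec_index v)"
    if "v \<in> carrier_vec n" for v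
    using that by (auto simp: scalar_prod_def herm_form_def lessThan_atLeast0 sum_distrib_left mult_ac intro!: sum.cong)
  show ?thesis
  proof
    assume *: "pos_semidef (Matrix.mat n n (\<lambda>(i, j). f i j))"
    show "psd {..<n} f"
      unfolding psd_finite_iff[OF finite_lessThan]
    proof
      fix c
      have "0 \<le> (Matrix.mat n n (\<lambda>(i, j). f i j) *\<^sub>v Matrix.vec n c) \<bullet>c Matrix.vec n c"
        using * by (auto simp: pos_semidef_def)
      also have "\<dots> = herm_form {..<n} f c c"
        unfolding form[OF vec_carrier] by (rule herm_form_cong) auto
      finally show "0 \<le> herm_form {..<n} f c c" .
    qed
  next
    assume "psd {..<n} f"
    then show "pos_semidef (Matrix.mat n n (\<lambda>(i, j). f i j))"
      using psdD[of "{..<n}" f "{..<n}"] by (auto simp: pos_semidef_def form)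
  qed
qed

lemma psd_kernel_iff: "psd_kernel X k \<longleftrightarrow> X \<noteq> {} \<and> psd X k"
proof -
  have "psd X k" if *: "\<And>n (z :: nat \<Rightarrow> 'a). (\<forall>i<n. z i \<in> X) \<Longrightarrow> psd {..<n} (\<lambda>i j. k (z i) (z j))"
  proof (rule psdI)
    fix S c assume S: "finite S" "S \<subseteq> X"
    obtain z :: "nat \<Rightarrow> 'a" where z: "bij_betw z {..<card S} S"
      using ex_bij_betw_nat_finite[OF S(1)] by (auto simp: lessThan_atLeast0)
    have "psd {..<card S} (\<lambda>i j. k (z i) (z j))"
      by (rule *) (use bij_betwE[OF z] S in auto)
    then have "psd S (\<lambda>x y. k (z (inv_into {..<card S} z x)) (z (inv_into {..<card S} z y)))"
      by (rule psd_pullback) (use bij_betwE[OF bij_betw_inv_into[OF z]] in auto)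
    then have "psd S k"
      by (rule psd_cong[THEN iffD1, rotated]) (simp add: bij_betw_inv_into_right[OF z])
    then show "0 \<le> herm_form S k c c" using S by (auto intro: psdD)
  qed
  moreover have "psd {..<n} (\<lambda>i j. k (z i) (z j))" if "psd X k" "\<forall>i<n. z i \<in> X" for n and z :: "nat \<Rightarrow> 'a"
    using psd_pullback[OF that(1), of "{..<n}" z] that(2) by auto
  ultimately show ?thesis
    unfolding psd_kernel_def pos_semidef_iff_psd by blast
qed

lemma pick_matrix_psd_iff:
  assumes W: "\<And>i. i < n \<Longrightarrow> W i \<in> carrier_mat N N"
  shows "pos_semidef (pick_matrix k l n N z W) \<longleftrightarrow>
    psd ({..<n} \<times> {..<N}) (pick_kernel (\<lambda>i j. k (z i) (z j)) (\<lambda>i j. l (z i) (z j)) N (\<lambda>i a b. W i $$ (a, b)))"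
    (is "_ \<longleftrightarrow> psd ?I ?K")
proof -
  \<comment> \<open>The block and the position inside the block of a matrix index.\<close>
  define p where "p m = (m div N, m mod N)" for m
  have p: "p m \<in> ?I" if "m < n * N" for m
    using that by (cases "N = 0") (auto simp: p_def less_mult_imp_div_less)
  have pinv: "i * N + a < n * N \<and> p (i * N + a) = (i, a)" if "i < n" "a < N" for i a
  proof -
    have "i * N + a < Suc i * N" using that by simp
    also have "\<dots> \<le> n * N" using that by (intro mult_right_mono) auto
    finally show ?thesis using that by (simp add: p_def)
  qed
  have entry: "(let i = m div N; j = m' div N in
       (l (z i) (z j) \<cdot>\<^sub>m 1\<^sub>m N - k (z i) (z j) \<cdot>\<^sub>m (W i * mat_adjoint (W j))) $$ (m mod N, m' mod N)) = ?K (p m) (p m')"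
    if m: "m < n * N" "m' < n * N" for m m'
  proof -
    have *: "W (m div N) \<in> carrier_mat N N" "W (m' div N) \<in> carrier_mat N N" "m mod N < N" "m' mod N < N"
      using p[OF m(1)] p[OF m(2)] W by (auto simp: p_def)
    then have d: "dim_row (W (m div N)) = N" "dim_col (W (m div N)) = N" "dim_row (W (m' div N)) = N" "dim_col (W (m' div N)) = N" by auto
    show ?thesis
      using *(3,4) d
      by (simp add: Let_def p_def pick_kernel_def mat_adjoint_def scalar_prod_def mat_of_rows_def lessThan_atLeast0)
  qed
  have "pick_matrix k l n N z W = Matrix.mat (n * N) (n * N) (\<lambda>(m, m'). ?K (p m) (p m'))"
    unfolding pick_matrix_def by (rule eq_matI) (use entry in \<open>auto simp del: Let_def\<close>)
  then have "pos_semidef (pick_matrix k l n N z W) \<longleftrightarrow> psd {..<n * N} (\<lambda>m m'. ?K (p m) (p m'))"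
    by (simp add: pos_semidef_iff_psd)
  also have "\<dots> \<longleftrightarrow> psd ?I ?K"
  proof
    assume "psd ?I ?K"
    then show "psd {..<n * N} (\<lambda>m m'. ?K (p m) (p m'))" by (rule psd_pullback) (use p in auto)
  next
    assume "psd {..<n * N} (\<lambda>m m'. ?K (p m) (p m'))"
    then have "psd ?I (\<lambda>q q'. ?K (p (fst q * N + snd q)) (p (fst q' * N + snd q')))"
      by (rule psd_pullback) (use pinv in auto)
    then show "psd ?I ?K"
      by (rule psd_cong[THEN iffD1, rotated]) (use pinv in auto)
  qed
  finally show ?thesis .
qed

theorem complete_pick_pair_of_certificate:
  assumes X: "X \<noteq> {}" and k: "psd X k" and l: "psd X l" and cert: "extension_certificate X k l"
  shows "complete_pick_pair X k l"
  unfolding complete_pick_pair_def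
proof (intro conjI allI impI)
  show "psd_kernel X k" "psd_kernel X l" using X k l by (auto simp: psd_kernel_iff)
  fix n N z and W :: "nat \<Rightarrow> complex mat"
  assume n: "n \<ge> 1" "N \<ge> 1" and z: "\<forall>i<n. z i \<in> X" and W: "\<forall>i<n. W i \<in> carrier_mat N N"
    and P: "pos_semidef (pick_matrix k l n N z W)"
  define K where "K = pick_kernel (\<lambda>i j. k (z i) (z j)) (\<lambda>i j. l (z i) (z j)) N (\<lambda>i a b. W i $$ (a, b))"
  have K: "psd ({..<n} \<times> {..<N}) K"
    using P W by (subst (asm) pick_matrix_psd_iff) (auto simp: K_def)
  \<comment> \<open>Points may be repeated. Positivity then forces equal matrices: test the form on the difference of the two basis
    vectors, on which \<open>l\<close> contributes \<open>0\<close>.\<close>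
  have same: "W i $$ (a, b) = W j $$ (a, b)" if ij: "i < n" "j < n" "z i = z j" "a < N" "b < N" for i j a b
  proof (cases "i = j")
    case False
    define f where "f m c = W m $$ (a, c)" for m c
    define \<kappa> where "\<kappa> = k (z i) (z i)"
    have zi: "z i \<in> X" using z ij by auto
    obtain r where r: "\<kappa> = of_real r" "r > 0"
    proof -
      have "0 \<le> \<kappa>" "\<kappa> \<noteq> 0" using psd_diag[OF k zi] cert zi by (auto simp: extension_certificate_def \<kappa>_def)
      then show thesis using that[of "Re \<kappa>"] unfolding complex_nonneg_iff by (metis of_real_0 order_le_less)
    qed
    have "0 \<le> herm_form {(i, a), (j, a)} K (\<lambda>p. if fst p = i then 1 else - 1) (\<lambda>p. if fst p = i then 1 else - 1)"
      by (rule psdD[OF K]) (use ij in auto)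
    also have "\<dots> = K (i, a) (i, a) - K (i, a) (j, a) - (K (j, a) (i, a) - K (j, a) (j, a))"
      using False by (simp add: herm_form_def)
    also have "\<dots> = - \<kappa> * ((\<Sum>c<N. f i c * cnj (f i c)) - (\<Sum>c<N. f i c * cnj (f j c)) -
         ((\<Sum>c<N. f j c * cnj (f i c)) - (\<Sum>c<N. f j c * cnj (f j c))))"
      using ij(3) by (simp add: K_def pick_kernel_def f_def \<kappa>_def algebra_simps)
    also have "\<dots> = - \<kappa> * (\<Sum>c<N. (f i c - f j c) * cnj (f i c - f j c))"
      by (simp add: sum_subtractf algebra_simps)
    also have "\<dots> = of_real (- r * (\<Sum>c<N. (cmod (f i c - f j c))\<^sup>2))"
      by (simp only: r complex_norm_square[symmetric] of_real_mult of_real_sum of_real_minus)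
    finally have "r * (\<Sum>c<N. (cmod (f i c - f j c))\<^sup>2) \<le> 0"
      by (simp add: less_eq_complex_def del: of_real_mult of_real_sum of_real_power)
    then have "(\<Sum>c<N. (cmod (f i c - f j c))\<^sup>2) \<le> 0" using r by (simp add: mult_le_0_iff)
    then have "(\<Sum>c<N. (cmod (f i c - f j c))\<^sup>2) = 0" by (intro antisym sum_nonneg) auto
    then have "cmod (f i b - f j b) = 0" using ij by (subst (asm) sum_nonneg_eq_0_iff) auto
    then show ?thesis by (simp add: f_def)
  qed simp
  define D where "D = z ` {..<n}"
  define idx where "idx x = (SOME i. i < n \<and> z i = x)" for x
  have idx: "idx x < n" "z (idx x) = x" if "x \<in> D" for x
    using someI_ex[of "\<lambda>i. i < n \<and> z i = x"] that by (auto simp: D_def idx_def)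
  define \<Phi> where "\<Phi> x a b = W (idx x) $$ (a, b)" for x a b
  have "psd (D \<times> {..<N}) (\<lambda>p q. K (idx (fst p), snd p) (idx (fst q), snd q))"
    by (rule psd_pullback[OF K]) (use idx in auto)
  then have "psd (D \<times> {..<N}) (pick_kernel k l N \<Phi>)"
    by (rule psd_cong[THEN iffD1, rotated]) (auto simp: K_def pick_kernel_def \<Phi>_def idx)
  moreover have "finite D" "D \<subseteq> X" using z by (auto simp: D_def)
  ultimately obtain \<Psi> where \<Psi>: "psd (X \<times> {..<N}) (pick_kernel k l N \<Psi>)"
    "\<forall>x\<in>D. \<forall>a<N. \<forall>b<N. \<Psi> x a b = \<Phi> x a b"
    using global_extension[OF k l cert] by blast
  define M where "M x = Matrix.mat N N (\<lambda>(a, b). \<Psi> x a b)" for x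
  have "psd (X \<times> {..<N}) (pick_kernel k l N (\<lambda>x a b. M x $$ (a, b)))"
    by (rule psd_cong[THEN iffD1, OF _ \<Psi>(1)]) (auto simp: pick_kernel_def M_def)
  moreover have "M x \<in> carrier_mat N N" for x by (simp add: M_def)
  ultimately have "M \<in> Mult X k l N" "mult_norm X k l N M \<le> 1"
    using contractive_multiplier_of_psd[OF k l, of M N] by auto
  moreover have "M (z i) = W i" if i: "i < n" for i
  proof (rule eq_matI)
    fix a b assume "a < dim_row (W i)" "b < dim_col (W i)"
    then have ab: "a < N" "b < N" using W i by auto
    have zD: "z i \<in> D" using i by (auto simp: D_def)
    have "M (z i) $$ (a, b) = W (idx (z i)) $$ (a, b)" using \<Psi>(2) zD ab by (simp add: M_def \<Phi>_def)
    also have "\<dots> = W i $$ (a, b)" by (rule same) (use idx[OF zD] i ab in auto)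
    finally show "M (z i) $$ (a, b) = W i $$ (a, b)" .
  qed (use W i in \<open>auto simp: M_def\<close>)
  ultimately show "\<exists>\<Phi>\<in>Mult X k l N. mult_norm X k l N \<Phi> \<le> 1 \<and> (\<forall>i<n. \<Phi> (z i) = W i)" by blast
qed

text \<open>What the Pick property says about rows \<open>W\<close> with \<open>W W\<^sup>* = \<Xi>\<close>: the data extend to \<open>w\<close>, the kernel \<open>l - k\<^sup>w \<Xi>'\<close> of the
  extension is positive, and its row at \<open>w\<close> is that of \<open>l\<close>, because \<open>k\<^sup>w\<close> vanishes there. So its Schur complement at \<open>w\<close>
  involves the given data only.\<close>

theorem row_extension:
  assumes pick: "complete_pick_pair X k l" and S: "finite S" "S \<subseteq> X" and w: "w \<in> X"
    and \<Xi>: "psd S \<Xi>" and diff: "psd S (\<lambda>x y. l x y - k x y * \<Xi> x y)"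
  shows "psd S (\<lambda>x y. schur_compl l w x y - schur_compl k w x y * \<Xi> x y)"
proof (cases "S = {}")
  case True
  then show ?thesis by (auto simp: psd_def herm_form_def)
next
  case False
  have k: "psd X k" and l: "psd X l" using pick by (auto simp: complete_pick_pair_def psd_kernel_iff)
  obtain N0 and b :: "'a \<Rightarrow> nat \<Rightarrow> complex" where b: "\<forall>x\<in>S. \<forall>y\<in>S. \<Xi> x y = (\<Sum>r<N0. b x r * cnj (b y r))"
    using psd_Gram[OF S(1) \<Xi>] by blast
  define N where "N = Suc N0"
  define n where "n = card S"
  have n: "n \<ge> 1" using False S by (simp add: n_def Suc_leI card_gt_0_iff)
  obtain z :: "nat \<Rightarrow> 'a" where z: "bij_betw z {..<n} S"
    using ex_bij_betw_nat_finite[OF S(1)] by (auto simp: n_def lessThan_atLeast0)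
  have zS: "z i \<in> S" if "i < n" for i using bij_betwE[OF z] that by auto
  \<comment> \<open>A row is a square matrix whose other rows vanish; the size makes room for all columns and is positive.\<close>
  define w0 where "w0 x a r = (if a = 0 \<and> r < N0 then b x r else 0)" for x and a r :: nat
  define W where "W i = Matrix.mat N N (\<lambda>(a, r). w0 (z i) a r)" for i
  have ww: "(\<Sum>r<N. w0 x a r * cnj (w0 y a' r)) = (if a = 0 \<and> a' = 0 then \<Xi> x y else 0)" if "x \<in> S" "y \<in> S" for x y a a'
    using that b by (auto simp: w0_def N_def)
  have "psd (S \<times> {0::nat}) (\<lambda>p q. if snd p = 0 \<and> snd q = 0 then l (fst p) (fst q) - k (fst p) (fst q) * \<Xi> (fst p) (fst q) else 0)"
    by (rule psd_cong[THEN iffD1, OF _ psd_pullback[OF diff, where p = fst]]) auto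
  then have 1: "psd (S \<times> {..<N}) (\<lambda>p q. if snd p = 0 \<and> snd q = 0 then l (fst p) (fst q) - k (fst p) (fst q) * \<Xi> (fst p) (fst q) else 0)"
    by (rule psd_zero_extend) auto
  have lS: "psd S l" by (rule psd_subset[OF l S(2)])
  have 2: "psd (S \<times> {..<N}) (\<lambda>p q. (if snd p = snd q then l (fst p) (fst q) else 0) *
      ((if snd p = 0 then 0 else 1) * cnj (if snd q = 0 then 0 else 1)))"
    by (intro psd_mult psd_rank_one psd_diagonal_blocks[OF lS]) auto
  have "psd (S \<times> {..<N}) (pick_kernel k l N w0)"
    by (rule psd_cong[THEN iffD1, OF _ psd_add[OF 1 2]]) (auto simp: pick_kernel_def ww)
  then have "psd ({..<n} \<times> {..<N}) (\<lambda>p q. pick_kernel k l N w0 (z (fst p), snd p) (z (fst q), snd q))"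
    by (rule psd_pullback) (use zS in auto)
  then have "psd ({..<n} \<times> {..<N}) (pick_kernel (\<lambda>i j. k (z i) (z j)) (\<lambda>i j. l (z i) (z j)) N (\<lambda>i a b. W i $$ (a, b)))"
    by (rule psd_cong[THEN iffD1, rotated]) (auto simp: pick_kernel_def W_def)
  then have "pos_semidef (pick_matrix k l n N z W)"
    by (subst pick_matrix_psd_iff) (auto simp: W_def)
  moreover have "\<forall>i<n. z i \<in> X" "\<forall>i<n. W i \<in> carrier_mat N N" "N \<ge> 1" using zS S by (auto simp: W_def N_def)
  ultimately obtain \<Phi> where \<Phi>: "\<Phi> \<in> Mult X k l N" "mult_norm X k l N \<Phi> \<le> 1" "\<forall>i<n. \<Phi> (z i) = W i"
    using pick n unfolding complete_pick_pair_def by blast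
  define \<Xi>' where "\<Xi>' x y = (\<Sum>r<N. \<Phi> x $$ (0, r) * cnj (\<Phi> y $$ (0, r)))" for x y
  have \<Xi>': "psd X \<Xi>'" unfolding \<Xi>'_def by (rule psd_Gram_kernel)
  have eq: "\<Xi>' x y = \<Xi> x y" if xy: "x \<in> S" "y \<in> S" for x y
  proof -
    have "\<Phi> x $$ (0, r) = w0 x 0 r" if r: "r < N" and x: "x \<in> S" for r x
    proof -
      obtain i where "i < n" "z i = x" using z x by (auto simp: bij_betw_def)
      then show ?thesis using \<Phi>(3) r by (auto simp: W_def N_def)
    qed
    then have "\<Xi>' x y = (\<Sum>r<N. w0 x 0 r * cnj (w0 y 0 r))" using xy by (simp add: \<Xi>'_def)
    then show ?thesis using ww[OF xy] by simp
  qed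
  have "psd X (\<lambda>x y. pick_kernel k l N (\<lambda>x a b. \<Phi> x $$ (a, b)) (x, 0) (y, 0))"
    by (rule psd_pullback[OF psd_of_contractive_multiplier[OF k l \<Phi>(1,2)]]) (auto simp: N_def)
  then have lk: "psd X (\<lambda>x y. l x y - k x y * \<Xi>' x y)" by (simp add: pick_kernel_def \<Xi>'_def)
  define A where "A x y = l x y - schur_compl k w x y * \<Xi>' x y" for x y
  have "psd X (\<lambda>x y. l x y - k x y * \<Xi>' x y + k x w * k w y / k w w * \<Xi>' x y)"
    by (intro psd_add lk psd_mult \<Xi>' psd_pivot_rank_one[OF k w])
  then have A: "psd X A" unfolding A_def schur_compl_def by (simp add: algebra_simps)
  have Aw: "A x w = l x w" "A w x = l w x" if "x \<in> X" for x
    using schur_compl_pivot[OF k w that] by (auto simp: A_def)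
  have "psd S (schur_compl A w)" by (rule psd_subset[OF psd_schur_compl[OF A w] S(2)])
  then show ?thesis
  proof (rule psd_cong[THEN iffD1, rotated])
    fix x y assume xy: "x \<in> S" "y \<in> S"
    then have "x \<in> X" "y \<in> X" using S by auto
    then show "schur_compl A w x y = schur_compl l w x y - schur_compl k w x y * \<Xi> x y"
      unfolding schur_compl_def[of A] schur_compl_def[of l] by (simp add: Aw w) (simp add: A_def eq xy)
  qed
qed

section \<open>Complete Pick kernels\<close>

text \<open>If \<open>s x y = 0\<close>, then the data \<open>1\<close> at \<open>x\<close> and \<open>- 1\<close> at \<open>y\<close> are admissible for \<open>s\<close>. Extending them to \<open>p\<close> would make
  them admissible for \<open>s\<^sup>p\<close>, but \<open>s\<^sup>p\<close> does not vanish at \<open>(x, y)\<close>.\<close>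

lemma complete_pick_kernel_nonzero:
  assumes s: "complete_pick_kernel X s" and p: "p \<in> X" and nz: "\<And>x. x \<in> X \<Longrightarrow> s x p \<noteq> 0"
    and xy: "x \<in> X" "y \<in> X"
  shows "s x y \<noteq> 0"
proof
  assume 0: "s x y = 0"
  have pick: "complete_pick_pair X s s" using s by (simp add: complete_pick_kernel_def)
  have psd: "psd X s" using pick by (auto simp: complete_pick_pair_def psd_kernel_iff)
  have "s x x \<noteq> 0" using psd_zero_row[OF psd xy(1) p] nz[OF xy(1)] by auto
  then have ne: "x \<noteq> y" using 0 by auto
  have s0: "s y x = 0" using psd_hermitian[OF psd xy] 0 by simp
  define f :: "'a \<Rightarrow> complex" where "f z = (if z = x then 1 else - 1)" for z
  have "psd {x, y} (\<lambda>u v. schur_compl s p u v - schur_compl s p u v * (f u * cnj (f v)))"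
  proof (rule row_extension[OF pick _ _ p psd_rank_one])
    show "psd {x, y} (\<lambda>u v. s u v - s u v * (f u * cnj (f v)))"
      by (rule psd_cong[THEN iffD1, OF _ psd_zero]) (auto simp: f_def 0 s0)
  qed (use xy in auto)
  from psd_zero_row(1)[OF this, of x y] have "schur_compl s p x y = 0"
    using ne by (auto simp: f_def)
  then show False
    using nz[OF xy(1)] nz[OF xy(2)] nz[OF p] psd_hermitian[OF psd xy(2) p] 0 by (simp add: schur_compl_def)
qed

text \<open>The theorem of McCullough and Quiggin, for all base points \<open>w\<close> at once. In the induction step, the
  kernel \<open>\<Xi>\<close> for the base point \<open>v\<close> is positive on the other points, and also with \<open>v\<close> added, where it vanishes.
  It gives row data with \<open>s - s \<Xi> = s\<^sub>v s\<^sub>v\<^sup>* / s(v, v)\<close>. Extending these to \<open>w\<close> shows that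
  \<open>s\<^sup>w (1 - \<Xi>)\<close> is positive, and this is \<open>s\<^sup>w / s\<close> up to conjugation by \<open>s\<^sub>v\<close> and scaling.\<close>

theorem complete_pick_kernel_certificate:
  assumes s: "complete_pick_kernel X s" and nz: "\<And>x y. x \<in> X \<Longrightarrow> y \<in> X \<Longrightarrow> s x y \<noteq> 0" and w: "w \<in> X"
  shows "psd X (\<lambda>x y. 1 - s x w * s w y / (s w w * s x y))"
proof -
  have pick: "complete_pick_pair X s s" using s by (simp add: complete_pick_kernel_def)
  have psd: "psd X s" using pick by (auto simp: complete_pick_pair_def psd_kernel_iff)
  have "psd S (\<lambda>x y. 1 - s x w * s w y / (s w w * s x y))" if "finite S" "S \<subseteq> X" "w \<in> X" for S w
    using that
  proof (induction S arbitrary: w rule: finite_induct)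
    case empty
    show ?case by (auto simp: psd_def herm_form_def)
  next
    case (insert v S)
    let ?T = "insert v S"
    have v: "v \<in> X" and T: "finite ?T" "?T \<subseteq> X" using insert by auto
    define \<Xi> where "\<Xi> x y = 1 - s x v * s v y / (s v v * s x y)" for x y
    have "psd S \<Xi>" unfolding \<Xi>_def[abs_def] using insert v by auto
    then have \<Xi>: "psd ?T \<Xi>"
      by (rule psd_zero_extend) (use nz T v in \<open>auto simp: \<Xi>_def\<close>)
    have \<Xi>s: "s x y - s x y * \<Xi> x y = s x v * s v y / s v v" if "x \<in> X" "y \<in> X" for x y
      using nz[OF that] by (simp add: \<Xi>_def field_simps)
    have "psd ?T (\<lambda>x y. schur_compl s w x y - schur_compl s w x y * \<Xi> x y)"
    proof (rule row_extension[OF pick T insert.prems(2) \<Xi>])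
      show "psd ?T (\<lambda>x y. s x y - s x y * \<Xi> x y)"
        by (rule psd_cong[THEN iffD1, OF _ psd_subset[OF psd_pivot_rank_one[OF psd v] T(2)]])
           (use \<Xi>s T in \<open>auto simp: subset_iff\<close>)
    qed
    then have "psd ?T (\<lambda>x y. s v v / s x v * (schur_compl s w x y - schur_compl s w x y * \<Xi> x y) * cnj (s v v / s y v))"
      by (rule psd_conj_scale)
    then have 1: "psd ?T (\<lambda>x y. 1 / s v v * (s v v / s x v * (schur_compl s w x y - schur_compl s w x y * \<Xi> x y) * cnj (s v v / s y v)))"
      by (rule psd_scale) (use psd_diag[OF psd v] in \<open>auto simp: less_eq_complex_def Re_divide Im_divide\<close>)
    show ?case
    proof (rule psd_cong[THEN iffD1, OF _ 1])
      fix x y assume "x \<in> ?T" "y \<in> ?T"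
      then have xy: "x \<in> X" "y \<in> X" using T by auto
      note nn = nz[OF xy] nz[OF xy(1) v] nz[OF v xy(2)] nz[OF v v]
      have c: "cnj (s v v / s y v) = s v v / s v y"
        using psd_hermitian[OF psd xy(2) v] psd_hermitian[OF psd v v] by simp
      have "schur_compl s w x y - schur_compl s w x y * \<Xi> x y = schur_compl s w x y / s x y * (s x y - s x y * \<Xi> x y)"
        using nn by (simp add: field_simps)
      also have "\<dots> = schur_compl s w x y / s x y * (s x v * s v y / s v v)"
        unfolding \<Xi>s[OF xy] ..
      finally have e: "schur_compl s w x y - schur_compl s w x y * \<Xi> x y = schur_compl s w x y / s x y * (s x v * s v y / s v v)" .
      have "1 / s v v * (s v v / s x v * (schur_compl s w x y - schur_compl s w x y * \<Xi> x y) * cnj (s v v / s y v)) =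
          schur_compl s w x y / s x y"
        unfolding e c using nn by (simp add: field_simps)
      also have "\<dots> = 1 - s x w * s w y / (s w w * s x y)"
        using nn by (simp add: schur_compl_def diff_divide_distrib)
      finally show "1 / s v v * (s v v / s x v * (schur_compl s w x y - schur_compl s w x y * \<Xi> x y) * cnj (s v v / s y v)) =
          1 - s x w * s w y / (s w w * s x y)" .
    qed
  qed
  then show ?thesis using w by (intro psdI) (meson psdD order_refl)
qed

text \<open>With \<open>r = h(w, w) > 0\<close>, this is \<open>h\<^sup>w\<close> plus \<open>h\<^sub>w h\<^sub>w\<^sup>* / r + (1 - h\<^sub>w) (1 - h\<^sub>w)\<^sup>* / (1 - r) - 1\<close>, and the latter is
  the rank-one kernel \<open>(h\<^sub>w - r) (h\<^sub>w - r)\<^sup>* / (r (1 - r))\<close>.\<close>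

lemma psd_pivot_complement:
  assumes h: "psd X h" and w: "w \<in> X" and lt: "Re (h w w) < 1"
  shows "psd X (\<lambda>x y. h x y - 1 + (1 - h x w) * (1 - h w y) / (1 - h w w))"
proof -
  define r where "r = Re (h w w)"
  have r: "h w w = of_real r" "0 \<le> r" "r < 1" using psd_diag[OF h w] lt by (auto simp: r_def complex_nonneg_iff)
  show ?thesis
  proof (cases "r = 0")
    case True
    show ?thesis
      by (rule psd_cong[THEN iffD1, OF _ h]) (use True r psd_zero_row[OF h w] in auto)
  next
    case False
    have "psd X (\<lambda>x y. of_real (1 / (r * (1 - r))) * ((h x w - of_real r) * cnj (h y w - of_real r)))"
      by (intro psd_scale psd_rank_one) (use r False in \<open>simp add: less_eq_complex_def\<close>)
    from psd_add[OF psd_schur_compl[OF h w] this]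
    show ?thesis
    proof (rule psd_cong[THEN iffD1, rotated])
      fix x y assume "x \<in> X" "y \<in> X"
      then have c: "cnj (h y w - of_real r) = h w y - of_real r" using psd_hermitian[OF h _ w, of y] by simp
      have nr: "complex_of_real r \<noteq> 0" "1 - complex_of_real r \<noteq> 0"
        using False r(3) by (auto simp: complex_eq_iff)
      have "u * v / R + (1 - u) * (1 - v) / (1 - R) - 1 = 1 / (R * (1 - R)) * ((u - R) * (v - R))"
        if "R \<noteq> 0" "1 - R \<noteq> 0" for u v R :: complex
      proof -
        have dist: "(a + b - 1) * D = a * D + b * D - D" for a b D :: complex by (simp add: algebra_simps)
        have "u * v / R * (R * (1 - R)) = u * v * (1 - R)"
          "(1 - u) * (1 - v) / (1 - R) * (R * (1 - R)) = (1 - u) * (1 - v) * R"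
          using that by simp_all
        then have "(u * v / R + (1 - u) * (1 - v) / (1 - R) - 1) * (R * (1 - R)) = (u - R) * (v - R)"
          unfolding dist by (simp only:) (simp add: algebra_simps)
        moreover have "R * (1 - R) \<noteq> 0" using that by simp
        ultimately have "u * v / R + (1 - u) * (1 - v) / (1 - R) - 1 = (u - R) * (v - R) / (R * (1 - R))"
          using nonzero_eq_divide_eq by blast
        then show ?thesis by simp
      qed
      from this[OF nr, of "h x w" "h w y"]
      show "schur_compl h w x y + complex_of_real (1 / (r * (1 - r))) * ((h x w - complex_of_real r) * cnj (h y w - complex_of_real r)) =
         h x y - 1 + (1 - h x w) * (1 - h w y) / (1 - h w w)"
        unfolding c by (simp add: schur_compl_def r(1) algebra_simps)
    qed
  qed
qed

text \<open>With \<open>P = s\<^sub>w s\<^sub>w\<^sup>* / s(w, w)\<close> and \<open>F = 1 - P / s\<close>, the two differences factor as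
  \<open>l\<^sup>w - F l = P g\<^sup>w\<close> and \<open>F k - k\<^sup>w = P (h - 1 + (1 - h\<^sub>w) (1 - h\<^sub>w)\<^sup>* / (1 - h(w, w)))\<close>.\<close>

theorem extension_certificate_of_factorization:
  assumes k: "psd X k" and l: "psd X l" and h: "psd X h" and g: "psd X g" and s: "psd X s"
    and kw: "\<And>w. w \<in> X \<Longrightarrow> k w w \<noteq> 0" and lw: "\<And>w. w \<in> X \<Longrightarrow> l w w \<noteq> 0"
    and nz: "\<And>x y. x \<in> X \<Longrightarrow> y \<in> X \<Longrightarrow> s x y \<noteq> 0"
    and F: "\<And>w. w \<in> X \<Longrightarrow> psd X (\<lambda>x y. 1 - s x w * s w y / (s w w * s x y))"
    and keq: "\<And>x y. x \<in> X \<Longrightarrow> y \<in> X \<Longrightarrow> k x y = (1 - h x y) * s x y"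
    and leq: "\<And>x y. x \<in> X \<Longrightarrow> y \<in> X \<Longrightarrow> l x y = s x y * g x y"
  shows "extension_certificate X k l"
  unfolding extension_certificate_def
proof (intro ballI conjI exI)
  fix w assume w: "w \<in> X"
  show "k w w \<noteq> 0" "l w w \<noteq> 0" using kw lw w by auto
  show "psd X (\<lambda>x y. 1 - s x w * s w y / (s w w * s x y))" by (rule F[OF w])
  have gw: "g w w \<noteq> 0" and hw: "1 - h w w \<noteq> 0" using kw[OF w] lw[OF w] keq[OF w w] leq[OF w w] by auto
  note pivot = psd_pivot_rank_one[OF s w]
  show "psd X (\<lambda>x y. schur_compl l w x y - (1 - s x w * s w y / (s w w * s x y)) * l x y)"
    by (rule psd_cong[THEN iffD1, OF _ psd_mult[OF pivot psd_schur_compl[OF g w]]])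
       (use nz w gw in \<open>simp add: schur_compl_def leq field_simps\<close>)
  have "Re (h w w) < 1"
  proof -
    obtain a b c where abc: "k w w = of_real a" "s w w = of_real b" "h w w = of_real c" "0 \<le> a" "0 \<le> b"
      using psd_diag[OF k w] psd_diag[OF s w] psd_diag[OF h w] unfolding complex_nonneg_iff by metis
    have "a = (1 - c) * b" using keq[OF w w] unfolding abc by (metis of_real_1 of_real_diff of_real_eq_iff of_real_mult)
    moreover have "a \<noteq> 0" using kw[OF w] abc by auto
    ultimately show ?thesis using abc by (auto simp: zero_less_mult_iff order_le_less)
  qed
  note pc = psd_pivot_complement[OF h w this]
  show "psd X (\<lambda>x y. (1 - s x w * s w y / (s w w * s x y)) * k x y - schur_compl k w x y)"
  proof (rule psd_cong[THEN iffD1, OF _ psd_mult[OF pivot pc]])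
    fix x y assume xy: "x \<in> X" "y \<in> X"
    have "S1 * S2 / S0 * (H - 1 + (1 - H1) * (1 - H2) / (1 - H0)) =
        (1 - S1 * S2 / (S0 * S)) * ((1 - H) * S) - ((1 - H) * S - (1 - H1) * S1 * ((1 - H2) * S2) / ((1 - H0) * S0))"
      if "S \<noteq> 0" "S0 \<noteq> 0" "1 - H0 \<noteq> 0" for S S0 S1 S2 H H0 H1 H2 :: complex
    proof -
      have 1: "(1 - S1 * S2 / (S0 * S)) * ((1 - H) * S) = (1 - H) * S - S1 * S2 / S0 * (1 - H)"
        using that by (simp add: field_simps)
      have 2: "(1 - H1) * S1 * ((1 - H2) * S2) / ((1 - H0) * S0) = S1 * S2 / S0 * ((1 - H1) * (1 - H2) / (1 - H0))"
        by (simp add: mult_ac)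
      have gen: "P * (H - 1 + Q) = (Y - P * (1 - H)) - (Y - P * Q)" for P Q Y :: complex
        by (simp add: algebra_simps)
      show ?thesis unfolding 1 2 by (rule gen)
    qed
    from this[OF nz[OF xy] nz[OF w w] hw]
    show "s x w * s w y / s w w * (h x y - 1 + (1 - h x w) * (1 - h w y) / (1 - h w w)) =
        (1 - s x w * s w y / (s w w * s x y)) * k x y - schur_compl k w x y"
      unfolding schur_compl_def keq[OF xy] keq[OF xy(1) w] keq[OF w xy(2)] keq[OF w w] .
  qed
qed

theorem complete_pick_pair_of_strong_certificate:
  assumes k: "psd_kernel X k" and l: "psd_kernel X l" and s: "strong_shimorin_certificate X k l s"
    and p: "p \<in> X" and kp: "\<And>x. x \<in> X \<Longrightarrow> k x p \<noteq> 0" and lw: "\<And>w. w \<in> X \<Longrightarrow> l w w \<noteq> 0"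
  shows "complete_pick_pair X k l"
proof -
  have X: "X \<noteq> {}" and k: "psd X k" and l: "psd X l" using k l by (auto simp: psd_kernel_iff)
  obtain h g where sp: "complete_pick_kernel X s" and h: "psd X h" and g: "psd X g"
    and keq: "\<And>x y. x \<in> X \<Longrightarrow> y \<in> X \<Longrightarrow> k x y = (1 - h x y) * s x y"
    and leq: "\<And>x y. x \<in> X \<Longrightarrow> y \<in> X \<Longrightarrow> l x y = s x y * g x y"
    using s unfolding strong_shimorin_certificate_def psd_kernel_iff by blast
  have psd: "psd X s" using sp by (auto simp: complete_pick_kernel_def complete_pick_pair_def psd_kernel_iff)
  have sp0: "s x p \<noteq> 0" if "x \<in> X" for x using kp[OF that] keq[OF that p] by auto
  have nz: "s x y \<noteq> 0" if "x \<in> X" "y \<in> X" for x y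
    by (rule complete_pick_kernel_nonzero[OF sp p sp0 that])
  have kw: "k w w \<noteq> 0" if "w \<in> X" for w using psd_zero_row[OF k that p] kp[OF that] by auto
  have "extension_certificate X k l"
    by (rule extension_certificate_of_factorization[OF k l h g psd kw lw nz complete_pick_kernel_certificate[OF sp nz] keq leq])
  then show ?thesis by (rule complete_pick_pair_of_certificate[OF X k l])
qed

text \<open>For \<open>s = t / (1 - F)\<close> the kernel \<open>1 - s\<^sub>w s\<^sub>w\<^sup>* / (s(w, w) s)\<close> is the one of \<open>psd_pivot_complement\<close> for \<open>F\<close>, conjugated by \<open>1 / (1 - F\<^sub>w)\<close>
  and scaled. The pair \<open>(s, s)\<close> has the factorization with \<open>h = 0\<close> and \<open>g = 1\<close>.\<close>

theorem complete_pick_kernel_of_ball_kernel: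
  assumes X: "X \<noteq> {}" and F: "psd X F" and lt: "\<And>x. x \<in> X \<Longrightarrow> Re (F x x) < 1" and t: "t > 0"
  shows "complete_pick_kernel X (\<lambda>x y. of_real t / (1 - F x y))"
proof -
  define s where "s x y = of_real t / (1 - F x y)" for x y
  have F1: "1 - F x y \<noteq> 0" if "x \<in> X" "y \<in> X" for x y
    using psd_geometric(1)[OF F lt that] by auto
  have "psd X (\<lambda>x y. of_real t * (1 / (1 - F x y)))"
    by (rule psd_scale[OF psd_geometric(2)[OF F lt]]) (use t in \<open>auto simp: less_eq_complex_def\<close>)
  then have s: "psd X s" by (simp add: s_def[abs_def])
  have nz: "s x y \<noteq> 0" if "x \<in> X" "y \<in> X" for x y using F1[OF that] t by (simp add: s_def)
  have "psd X (\<lambda>x y. 1 - s x w * s w y / (s w w * s x y))" if w: "w \<in> X" for w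
  proof -
    have pos: "0 \<le> 1 - F w w" using psd_diag[OF F w] lt[OF w] by (simp add: less_eq_complex_def)
    note pc = psd_scale[OF psd_conj_scale[OF psd_pivot_complement[OF F w lt[OF w]], of "\<lambda>x. 1 / (1 - F x w)"] pos]
    show ?thesis
    proof (rule psd_cong[THEN iffD1, OF _ pc])
      fix x y assume xy: "x \<in> X" "y \<in> X"
      have c: "cnj (1 / (1 - F y w)) = 1 / (1 - F w y)" using psd_hermitian[OF F xy(2) w] by simp
      have "D0 * (1 / D1 * (D1 * D2 / D0 - D) * (1 / D2)) = 1 - T / D1 * (T / D2) / (T / D0 * (T / D))"
        if "D0 \<noteq> 0" "D1 \<noteq> 0" "D2 \<noteq> 0" "D \<noteq> 0" "T \<noteq> 0" for D0 D1 D2 D T :: complex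
        using that by (simp add: field_simps)
      from this[OF F1[OF w w] F1[OF xy(1) w] F1[OF w xy(2)] F1[OF xy], of "of_real t"]
      show "(1 - F w w) * (1 / (1 - F x w) * (F x y - 1 + (1 - F x w) * (1 - F w y) / (1 - F w w)) * cnj (1 / (1 - F y w))) =
          1 - s x w * s w y / (s w w * s x y)"
        unfolding c s_def using t by (simp add: algebra_simps)
    qed
  qed
  then have "extension_certificate X s s"
    by (intro extension_certificate_of_factorization[OF s s psd_zero psd_const s]) (use nz in auto)
  then have "complete_pick_pair X s s" by (rule complete_pick_pair_of_certificate[OF X s s])
  then show ?thesis by (simp add: complete_pick_kernel_def s_def[abs_def])
qed

section \<open>Weights on multi-indices\<close>

text \<open>Distinct primes, one per coordinate.  On the points \<open>(p\<^sub>1\<^sup>-\<^sup>t, \<dots>, p\<^sub>d\<^sup>-\<^sup>t)\<close> the monomial of exponent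
  \<open>a\<close> takes the value \<open>n\<^sup>-\<^sup>t\<close> with \<open>n = p\<^sub>1\<^sup>a\<^sup>1 \<dots> p\<^sub>d\<^sup>a\<^sup>d\<close>, so that a power series
  in several variables becomes a Dirichlet series whose frequencies are ordered and, by unique factorization, distinct.\<close>

definition coord_prime :: "'d::finite \<Rightarrow> nat" where
  "coord_prime = (SOME p. inj p \<and> (\<forall>i. prime (p i)))"

lemma coord_prime: "inj (coord_prime :: 'd::finite \<Rightarrow> nat)" "prime (coord_prime (i::'d))"
proof -
  obtain B where B: "finite B" "card B = CARD('d)" "B \<subseteq> {p::nat. prime p}"
    using infinite_arbitrarily_large[OF primes_infinite, of "CARD('d)"] by auto
  then obtain h where h: "bij_betw h (UNIV :: 'd set) B"
    using finite_same_card_bij[of "UNIV :: 'd set" B] by auto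
  then have "inj h \<and> (\<forall>i. prime (h i))" using B(3) by (auto simp: bij_betw_def)
  then have "inj (coord_prime :: 'd \<Rightarrow> nat) \<and> (\<forall>i::'d. prime (coord_prime i))"
    unfolding coord_prime_def by (rule someI[of "\<lambda>p. inj p \<and> (\<forall>i. prime (p i))" h])
  then show "inj (coord_prime :: 'd \<Rightarrow> nat)" "prime (coord_prime (i::'d))" by auto
qed

definition weight :: "nat ^ 'd::finite \<Rightarrow> nat" where
  "weight a = (\<Prod>i\<in>UNIV. coord_prime i ^ (a $ i))"

lemma weight_0 [simp]: "weight 0 = 1" by (simp add: weight_def)

lemma weight_add: "weight (a + b) = weight a * weight b"
  by (simp add: weight_def power_add prod.distrib)

lemma weight_pos [simp]: "0 < weight a"
  by (auto simp: weight_def intro!: prod_pos prime_gt_0_nat coord_prime(2))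

lemma weight_nonzero [simp]: "weight a \<noteq> 0"
  using weight_pos[of a] by linarith

lemma weight_inj: "inj (weight :: nat ^ 'd::finite \<Rightarrow> nat)"
proof (rule injI)
  fix a b :: "nat ^ 'd" assume eq: "weight a = weight b"
  have m: "multiplicity (coord_prime j) (weight c) = c $ j" for j and c :: "nat ^ 'd"
  proof -
    have "weight c = (\<Prod>p\<in>range (coord_prime :: 'd \<Rightarrow> nat). p ^ (c $ (inv_into UNIV coord_prime p)))"
      by (simp add: weight_def prod.reindex[OF coord_prime(1)] inv_f_f[OF coord_prime(1)])
    moreover have "multiplicity (coord_prime j) (\<Prod>p\<in>range (coord_prime :: 'd \<Rightarrow> nat). p ^ (c $ (inv_into UNIV coord_prime p))) =
        (if coord_prime j \<in> range (coord_prime :: 'd \<Rightarrow> nat) then c $ (inv_into UNIV coord_prime (coord_prime j)) else 0)"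
      by (rule multiplicity_prod_prime_powers) (auto simp: coord_prime)
    ultimately have "multiplicity (coord_prime j) (weight c) = c $ (inv_into UNIV coord_prime (coord_prime j))" by simp
    then show ?thesis by (simp add: inv_f_f[OF coord_prime(1)])
  qed
  show "a = b" unfolding Finite_Cartesian_Product.vec_eq_iff using m[of _ a] m[of _ b] eq by metis
qed

lemma weight_eq_iff [simp]: "weight a = weight b \<longleftrightarrow> a = b"
  by (auto dest: injD[OF weight_inj])

lemma weight_less_add: assumes "b \<noteq> 0" shows "weight a < weight (a + b)"
proof -
  have "weight b \<noteq> 1" using assms weight_eq_iff[of b 0] unfolding weight_0 by blast
  then have "1 < weight b" using weight_pos[of b] by linarith
  then show ?thesis by (simp add: weight_add)
qed

lemma weight_finite: "finite {a. weight a \<le> n}"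
proof -
  have "finite (weight -` {..n})" using weight_inj by (intro finite_vimageI) auto
  then show ?thesis by (simp add: vimage_def)
qed

text \<open>All primes are at least \<open>2\<close>; this is how powers of a number are compared with weights.\<close>

lemma weight_ge_2_power: "2 ^ (\<Sum>i\<in>UNIV. a $ i) \<le> weight a"
  unfolding weight_def power_sum
  by (intro prod_mono power_mono conjI) (auto simp: prime_ge_2_nat[OF coord_prime(2)])

definition weight_pt :: "nat \<Rightarrow> complex ^ 'd::finite" where
  "weight_pt t = (\<chi> i. of_real ((1 / real (coord_prime i)) ^ t))"

lemma vec_monom_weight_pt: "vec_monom (weight_pt t) a = of_real ((1 / real (weight a)) ^ t)"
  by (simp add: vec_monom_def weight_pt_def weight_def power_one_over prod_dividef flip: of_real_power of_real_prod power_mult)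
     (simp add: mult.commute prod_power_distrib flip: power_mult)

lemma norm_weight_pt_coord: "norm (weight_pt t $ i) \<le> (1 / 2) ^ t"
proof -
  have "1 / real (coord_prime i) \<le> 1 / 2" using prime_ge_2_nat[OF coord_prime(2)[of i]] by (intro divide_left_mono) auto
  then show ?thesis by (simp add: weight_pt_def norm_power norm_divide power_mono del: of_real_power)
qed

lemma weight_pt_small: "e > 0 \<Longrightarrow> \<exists>t0. \<forall>t\<ge>t0. weight_pt t \<in> ball (0 :: complex ^ 'd::finite) e"
proof -
  assume e: "e > 0"
  obtain t0 where t0: "(1 / 2 :: real) ^ t0 < e / real CARD('d)"
    using real_arch_pow_inv[of "e / real CARD('d)" "1/2"] e by auto
  have "weight_pt t \<in> ball (0 :: complex ^ 'd) e" if "t \<ge> t0" for t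
  proof -
    have "norm (weight_pt t :: complex ^ 'd) \<le> (\<Sum>i\<in>(UNIV :: 'd set). norm ((weight_pt t :: complex ^ 'd) $ i))"
      by (simp add: norm_vec_def L2_set_le_sum)
    also have "\<dots> \<le> (\<Sum>i\<in>(UNIV :: 'd set). (1 / 2) ^ t)" by (intro sum_mono norm_weight_pt_coord)
    also have "\<dots> = real CARD('d) * (1 / 2) ^ t" by simp
    also have "\<dots> \<le> real CARD('d) * (1 / 2) ^ t0" using that by (intro mult_left_mono power_decreasing) auto
    also have "\<dots> < e" using t0 by (simp add: field_simps)
    finally show ?thesis by simp
  qed
  then show ?thesis by blast
qed

section \<open>Limits of weighted sums\<close>

lemma summable_comparison:
  fixes f :: "'i \<Rightarrow> 'b::banach"
  assumes "g summable_on A" "\<And>x. x \<in> A \<Longrightarrow> norm (f x) \<le> g x"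
  shows "f summable_on A"
  by (rule abs_summable_summable[OF Infinite_Sum.abs_summable_on_comparison_test'[OF assms]])

text \<open>When \<open>t\<close> increases by \<open>1\<close>, every summand is multiplied by at most \<open>\<mu> / (\<mu> + 1)\<close>.\<close>

lemma weighted_tail:
  fixes \<nu> :: "'i \<Rightarrow> nat" and u :: "'i \<Rightarrow> real"
  assumes u: "(\<lambda>b. u b / real (\<nu> b) ^ M) summable_on UNIV" and u0: "\<And>b. 0 \<le> u b" and mu: "1 \<le> \<mu>"
  shows "t \<ge> M \<Longrightarrow> (\<lambda>b. u b * (real \<mu> / real (\<nu> b)) ^ t) summable_on {b. \<mu> < \<nu> b}"
    and "(\<lambda>t. \<Sum>\<^sub>\<infinity>b\<in>{b. \<mu> < \<nu> b}. u b * (real \<mu> / real (\<nu> b)) ^ t) \<longlonglongrightarrow> 0"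
proof -
  define \<theta> where "\<theta> = real \<mu> / (real \<mu> + 1)"
  have \<theta>: "0 \<le> \<theta>" "\<theta> < 1" by (auto simp: \<theta>_def)
  define K where "K = real \<mu> ^ M"
  let ?B = "{b. \<mu> < \<nu> b}"
  have uB: "(\<lambda>b. u b / real (\<nu> b) ^ M) summable_on ?B" using u by (rule summable_on_subset) auto
  have le: "u b * (real \<mu> / real (\<nu> b)) ^ t \<le> \<theta> ^ (t - M) * K * (u b / real (\<nu> b) ^ M)" if "b \<in> ?B" "t \<ge> M" for b t
  proof -
    have b: "real \<mu> + 1 \<le> real (\<nu> b)" using that by auto
    have "(real \<mu> / real (\<nu> b)) ^ t = (real \<mu> / real (\<nu> b)) ^ (t - M) * (real \<mu> / real (\<nu> b)) ^ M"
      using that by (simp flip: power_add)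
    also have "\<dots> \<le> \<theta> ^ (t - M) * (real \<mu> / real (\<nu> b)) ^ M"
      unfolding \<theta>_def using b mu by (intro mult_right_mono power_mono divide_left_mono) auto
    finally have "u b * (real \<mu> / real (\<nu> b)) ^ t \<le> u b * (\<theta> ^ (t - M) * (real \<mu> / real (\<nu> b)) ^ M)"
      using u0 by (intro mult_left_mono)
    then show ?thesis by (simp add: K_def power_divide mult_ac)
  qed
  have nn: "0 \<le> u b * (real \<mu> / real (\<nu> b)) ^ t" for b t using u0 by simp
  have sm: "(\<lambda>b. \<theta> ^ (t - M) * K * (u b / real (\<nu> b) ^ M)) summable_on ?B" for t
    by (intro summable_on_cmult_right uB)
  show sum: "(\<lambda>b. u b * (real \<mu> / real (\<nu> b)) ^ t) summable_on ?B" if "t \<ge> M" for t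
    by (rule summable_comparison[OF sm]) (use le[OF _ that] nn in \<open>auto simp: u0\<close>)
  show "(\<lambda>t. \<Sum>\<^sub>\<infinity>b\<in>?B. u b * (real \<mu> / real (\<nu> b)) ^ t) \<longlonglongrightarrow> 0"
  proof (rule Lim_null_comparison)
    have "norm (\<Sum>\<^sub>\<infinity>b\<in>?B. u b * (real \<mu> / real (\<nu> b)) ^ t) \<le> \<theta> ^ (t - M) * (K * (\<Sum>\<^sub>\<infinity>b\<in>?B. u b / real (\<nu> b) ^ M))"
      if "t \<ge> M" for t
    proof -
      have "(\<Sum>\<^sub>\<infinity>b\<in>?B. u b * (real \<mu> / real (\<nu> b)) ^ t) \<le> (\<Sum>\<^sub>\<infinity>b\<in>?B. \<theta> ^ (t - M) * K * (u b / real (\<nu> b) ^ M))"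
        by (intro infsum_mono sum sm le that) auto
      also have "\<dots> = \<theta> ^ (t - M) * K * (\<Sum>\<^sub>\<infinity>b\<in>?B. u b / real (\<nu> b) ^ M)" by (rule infsum_cmult_right')
      moreover have "0 \<le> (\<Sum>\<^sub>\<infinity>b\<in>?B. u b * (real \<mu> / real (\<nu> b)) ^ t)" by (rule infsum_nonneg) (rule nn)
      ultimately show ?thesis by (simp add: mult_ac)
    qed
    then show "\<forall>\<^sub>F t in sequentially. norm (\<Sum>\<^sub>\<infinity>b\<in>?B. u b * (real \<mu> / real (\<nu> b)) ^ t) \<le>
        \<theta> ^ (t - M) * (K * (\<Sum>\<^sub>\<infinity>b\<in>?B. u b / real (\<nu> b) ^ M))"
      by (rule eventually_sequentiallyI)
    have "(\<lambda>t. \<theta> ^ t * (K * (\<Sum>\<^sub>\<infinity>b\<in>?B. u b / real (\<nu> b) ^ M))) \<longlonglongrightarrow> 0 * (K * (\<Sum>\<^sub>\<infinity>b\<in>?B. u b / real (\<nu> b) ^ M))"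
      using \<theta> by (intro tendsto_intros LIMSEQ_realpow_zero)
    then have "(\<lambda>t. \<theta> ^ (t + M - M) * (K * (\<Sum>\<^sub>\<infinity>b\<in>?B. u b / real (\<nu> b) ^ M))) \<longlonglongrightarrow> 0" by simp
    then show "(\<lambda>t. \<theta> ^ (t - M) * (K * (\<Sum>\<^sub>\<infinity>b\<in>?B. u b / real (\<nu> b) ^ M))) \<longlonglongrightarrow> 0"
      by (rule LIMSEQ_offset)
  qed
qed

text \<open>What remains of a Dirichlet series that is normalized at the frequency \<open>\<mu>\<close>: the part beyond \<open>\<mu>\<close> tends to \<open>0\<close>.\<close>

lemma weighted_limit:
  fixes \<nu> :: "'i \<Rightarrow> nat" and u :: "'i \<Rightarrow> real" and g :: "nat \<Rightarrow> 'i \<Rightarrow> complex"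
  assumes u: "(\<lambda>b. u b / real (\<nu> b) ^ M) summable_on UNIV" and u0: "\<And>b. 0 \<le> u b" and mu: "1 \<le> \<mu>"
    and fin: "finite {a. \<nu> a \<le> \<mu>}"
    and low: "\<And>t a. t \<ge> t0 \<Longrightarrow> \<nu> a \<le> \<mu> \<Longrightarrow> g t a = \<gamma> a"
    and high: "\<And>t b. t \<ge> t0 \<Longrightarrow> \<mu> < \<nu> b \<Longrightarrow> cmod (g t b) \<le> u b * (real \<mu> / real (\<nu> b)) ^ t"
  shows "(\<lambda>t. \<Sum>\<^sub>\<infinity>b. g t b) \<longlonglongrightarrow> (\<Sum>a\<in>{a. \<nu> a \<le> \<mu>}. \<gamma> a)"
proof -
  let ?B = "{b. \<mu> < \<nu> b}" and ?L = "{a. \<nu> a \<le> \<mu>}"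
  note tail = weighted_tail[OF u u0 mu]
  define T where "T = max t0 M"
  have s: "(\<lambda>b. cmod (g t b)) summable_on ?B" "g t summable_on ?B"
    "cmod (infsum (g t) ?B) \<le> (\<Sum>\<^sub>\<infinity>b\<in>?B. u b * (real \<mu> / real (\<nu> b)) ^ t)" if "t \<ge> T" for t
  proof -
    have t: "t \<ge> t0" "t \<ge> M" using that by (auto simp: T_def)
    show 1: "(\<lambda>b. cmod (g t b)) summable_on ?B"
      by (rule Infinite_Sum.abs_summable_on_comparison_test'[OF tail(1)[OF t(2)]]) (use high[OF t(1)] in auto)
    show "g t summable_on ?B" by (rule abs_summable_summable[OF 1])
    have "cmod (infsum (g t) ?B) \<le> (\<Sum>\<^sub>\<infinity>b\<in>?B. cmod (g t b))" by (rule norm_infsum_bound[OF 1])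
    also have "\<dots> \<le> (\<Sum>\<^sub>\<infinity>b\<in>?B. u b * (real \<mu> / real (\<nu> b)) ^ t)"
      by (rule infsum_mono[OF 1 tail(1)[OF t(2)]]) (use high[OF t(1)] in auto)
    finally show "cmod (infsum (g t) ?B) \<le> (\<Sum>\<^sub>\<infinity>b\<in>?B. u b * (real \<mu> / real (\<nu> b)) ^ t)" .
  qed
  have "(\<lambda>t. infsum (g t) ?B) \<longlonglongrightarrow> 0"
    by (rule Lim_null_comparison[OF _ tail(2)]) (use s(3) in \<open>auto intro: eventually_sequentiallyI\<close>)
  from tendsto_add[OF tendsto_const this]
  have "(\<lambda>t. (\<Sum>a\<in>?L. \<gamma> a) + infsum (g t) ?B) \<longlonglongrightarrow> (\<Sum>a\<in>?L. \<gamma> a)" by simp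
  then show ?thesis
  proof (rule Lim_transform_eventually)
    show "\<forall>\<^sub>F t in sequentially. (\<Sum>a\<in>?L. \<gamma> a) + infsum (g t) ?B = (\<Sum>\<^sub>\<infinity>b. g t b)"
    proof (rule eventually_sequentiallyI)
      fix t assume t: "T \<le> t"
      have "(\<Sum>\<^sub>\<infinity>b\<in>?L \<union> ?B. g t b) = infsum (g t) ?L + infsum (g t) ?B"
        by (rule infsum_Un_disjoint) (use fin s(2)[OF t] in auto)
      also have "infsum (g t) ?L = (\<Sum>a\<in>?L. \<gamma> a)"
        using fin low t by (auto simp: T_def intro!: sum.cong)
      also have "?L \<union> ?B = UNIV" by auto
      finally show "(\<Sum>a\<in>?L. \<gamma> a) + infsum (g t) ?B = (\<Sum>\<^sub>\<infinity>b. g t b)" by simp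
    qed
  qed
qed

section \<open>Polynomial interpolation\<close>

text \<open>Polynomials are evaluated at weights and given by their coefficients, since these are also the coefficients of
  combinations of point evaluations.\<close>

definition poly_val :: "nat \<Rightarrow> (nat \<Rightarrow> complex) \<Rightarrow> nat \<Rightarrow> complex" where
  "poly_val n q x = (\<Sum>i<n. q i * of_nat x ^ i)"

lemma poly_val_poly:
  assumes "degree p < n" shows "poly p (of_nat x) = poly_val n (poly.coeff p) x"
proof -
  have "poly p (of_nat x) = (\<Sum>i\<le>degree p. poly.coeff p i * of_nat x ^ i)" by (rule poly_altdef)
  also have "\<dots> = (\<Sum>i<n. poly.coeff p i * of_nat x ^ i)"
    using assms by (intro sum.mono_neutral_left) (auto simp: coeff_eq_0)
  finally show ?thesis by (simp add: poly_val_def)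
qed

definition lagrange :: "nat set \<Rightarrow> nat \<Rightarrow> complex poly" where
  "lagrange A y = (\<Prod>x\<in>A - {y}. Polynomial.smult (1 / (of_nat y - of_nat x)) [:- of_nat x, 1:])"

lemma lagrange:
  assumes "finite A" "y \<in> A"
  shows "x \<in> A \<Longrightarrow> poly (lagrange A y) (of_nat x) = (if x = y then 1 else 0)"
    and "degree (lagrange A y) < card A"
proof -
  show "poly (lagrange A y) (of_nat x) = (if x = y then 1 else 0)" if "x \<in> A"
  proof -
    have "poly (lagrange A y) (of_nat x) = (\<Prod>x'\<in>A - {y}. (of_nat x - of_nat x') / (of_nat y - of_nat x'))"
      by (simp add: lagrange_def poly_prod diff_divide_distrib)
    then show ?thesis using assms that by auto
  qed
  have "degree (lagrange A y) \<le> (\<Sum>x\<in>A - {y}. degree (Polynomial.smult (1 / (of_nat y - of_nat x :: complex)) [:- of_nat x, 1:]))"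
    unfolding lagrange_def by (rule order_trans[OF degree_prod_sum_le]) (use assms in \<open>simp_all add: o_def\<close>)
  also have "\<dots> \<le> (\<Sum>x\<in>A - {y}. 1)" by (intro sum_mono) auto
  also have "\<dots> = card A - 1" using assms by simp
  also have "\<dots> < card A" using assms by (metis card_gt_0_iff diff_less empty_iff less_numeral_extra(1))
  finally show "degree (lagrange A y) < card A" .
qed

lemma poly_val_lagrange:
  assumes "finite A"
  shows "poly_val (card A) q x = (\<Sum>y\<in>A. poly_val (card A) q y * poly (lagrange A y) (of_nat x))"
proof (cases "A = {}")
  case True
  then show ?thesis by (simp add: poly_val_def)
next
  case False
  define n where "n = card A"
  have n: "n > 0" using False assms by (simp add: n_def card_gt_0_iff)
  define P where "P = (\<Sum>i<n. Polynomial.monom (q i) i)"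
  define R where "R = (\<Sum>y\<in>A. Polynomial.smult (poly_val n q y) (lagrange A y))"
  have P: "poly P (of_nat x) = poly_val n q x" for x by (simp add: P_def poly_sum poly_monom poly_val_def)
  have R: "poly R z = (\<Sum>y\<in>A. poly_val n q y * poly (lagrange A y) z)" for z :: complex by (simp add: R_def poly_sum)
  have "P = R"
  proof (rule poly_eqI_degree)
    fix z :: complex assume "z \<in> of_nat ` A"
    then obtain x where x: "x \<in> A" "z = of_nat x" by auto
    have "poly R z = (\<Sum>y\<in>A. if y = x then poly_val n q x else 0)"
      unfolding R x(2) using lagrange(1)[OF assms _ x(1)] by (intro sum.cong) auto
    then show "poly P z = poly R z" using x assms by (simp add: P)
  next
    have card: "card (of_nat ` A :: complex set) = n" unfolding n_def by (intro card_image) (auto simp: inj_on_def)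
    have "degree P \<le> n - 1" unfolding P_def
      by (intro degree_sum_le order_trans[OF degree_monom_le]) auto
    then show "card (of_nat ` A :: complex set) > degree P" using card n by linarith
    have "degree R \<le> n - 1" unfolding R_def
    proof (intro degree_sum_le order_trans[OF degree_smult_le])
      fix y assume "y \<in> A"
      then show "degree (lagrange A y) \<le> n - 1" using lagrange(2)[OF assms, of y] unfolding n_def by linarith
    qed (use assms in auto)
    then show "card (of_nat ` A :: complex set) > degree R" using card n by linarith
  qed
  then show ?thesis using P R by (simp flip: n_def)
qed

lemma interpolation:
  assumes "finite A"
  shows "\<exists>q. \<forall>x\<in>A. poly_val (card A) q x = v x"
proof -
  define q where "q i = (\<Sum>y\<in>A. v y * poly.coeff (lagrange A y) i)" for i
  have "poly_val (card A) q x = v x" if x: "x \<in> A" for x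
  proof -
    have "poly_val (card A) q x = (\<Sum>y\<in>A. v y * poly_val (card A) (poly.coeff (lagrange A y)) x)"
      by (simp add: poly_val_def q_def sum_distrib_left sum_distrib_right mult.assoc) (rule sum.swap)
    also have "\<dots> = (\<Sum>y\<in>A. v y * poly (lagrange A y) (of_nat x))"
      by (intro sum.cong refl) (auto simp: poly_val_poly[OF lagrange(2)[OF assms]])
    also have "\<dots> = (\<Sum>y\<in>A. if y = x then v x else 0)"
      using lagrange(1)[OF assms _ x] by (intro sum.cong) auto
    finally show ?thesis using x assms by simp
  qed
  then show ?thesis by blast
qed

text \<open>Lagrange's formula expresses the polynomial by its values on \<open>A\<close>.\<close>

lemma interpolation_growth:
  assumes "finite A"
  shows "\<exists>C\<ge>0. \<forall>q x. 1 \<le> x \<longrightarrow>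
    cmod (poly_val (card A) q x) \<le> C * real x ^ card A * (\<Sum>y\<in>A. cmod (poly_val (card A) q y))"
proof -
  define C where "C = (\<Sum>y\<in>A. \<Sum>i<card A. cmod (poly.coeff (lagrange A y) i))"
  have l: "cmod (poly (lagrange A y) (of_nat x)) \<le> C * real x ^ card A" if "y \<in> A" "1 \<le> x" for x y
  proof -
    have "cmod (poly (lagrange A y) (of_nat x)) \<le> (\<Sum>i<card A. cmod (poly.coeff (lagrange A y) i * of_nat x ^ i))"
      unfolding poly_val_poly[OF lagrange(2)[OF assms that(1)]] poly_val_def by (rule norm_sum)
    also have "\<dots> \<le> (\<Sum>i<card A. cmod (poly.coeff (lagrange A y) i) * real x ^ card A)"
      using that(2) by (intro sum_mono) (auto simp: norm_mult norm_power intro!: mult_left_mono power_increasing)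
    also have "\<dots> \<le> C * real x ^ card A"
      unfolding sum_distrib_right[symmetric] C_def using that(1) assms
      by (intro mult_right_mono member_le_sum) (auto intro: sum_nonneg)
    finally show ?thesis .
  qed
  have "cmod (poly_val (card A) q x) \<le> C * real x ^ card A * (\<Sum>y\<in>A. cmod (poly_val (card A) q y))" if "1 \<le> x" for q x
  proof -
    have "cmod (poly_val (card A) q x) \<le> (\<Sum>y\<in>A. cmod (poly_val (card A) q y * poly (lagrange A y) (of_nat x)))"
      by (subst poly_val_lagrange[OF assms]) (rule norm_sum)
    also have "\<dots> \<le> (\<Sum>y\<in>A. cmod (poly_val (card A) q y) * (C * real x ^ card A))"
      using l[OF _ that] by (intro sum_mono) (auto simp: norm_mult intro: mult_left_mono)
    finally show ?thesis by (simp add: sum_distrib_right[symmetric] mult.commute)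
  qed
  moreover have "C \<ge> 0" unfolding C_def by (intro sum_nonneg) auto
  ultimately show ?thesis by blast
qed

lemma has_sum_sum_finite:
  fixes f :: "'i \<Rightarrow> 'j \<Rightarrow> 'b::topological_comm_monoid_add"
  assumes "finite I" "\<And>i. i \<in> I \<Longrightarrow> (f i has_sum s i) A"
  shows "((\<lambda>x. \<Sum>i\<in>I. f i x) has_sum (\<Sum>i\<in>I. s i)) A"
  using assms by (induction I rule: finite_induct) (auto intro!: has_sum_add)

text \<open>At the points with parameters \<open>t, t - 1, \<dots>, t - n + 1\<close>, the monomial of weight \<open>n\<^sub>b\<close> has the values
  \<open>n\<^sub>b\<^sup>-\<^sup>t n\<^sub>b\<^sup>i\<close>. So a combination of the evaluations at these points acts on monomials as a polynomial of
  degree less than \<open>n\<close> in the weight.\<close>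

lemma weight_form:
  assumes K: "\<And>i j. i < n \<Longrightarrow> j < n \<Longrightarrow>
      ((\<lambda>b. \<kappa> b * (1 / of_nat (weight b)) ^ (t - i) * (1 / of_nat (weight b)) ^ (t - j)) has_sum k i j) UNIV"
    and n: "n \<le> t"
  shows "((\<lambda>b. \<kappa> b * (1 / of_nat (weight b)) ^ (2 * t) * of_real ((cmod (poly_val n q (weight b)))\<^sup>2))
     has_sum herm_form {..<n} k q q) UNIV"
proof -
  have "((\<lambda>b. \<Sum>i<n. \<Sum>j<n. cnj (q i) * (\<kappa> b * (1 / of_nat (weight b)) ^ (t - i) * (1 / of_nat (weight b)) ^ (t - j)) * q j)
      has_sum herm_form {..<n} k q q) UNIV"
    unfolding herm_form_def
    by (intro has_sum_sum_finite has_sum_cmult_left has_sum_cmult_right K) auto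
  then show ?thesis
  proof (rule has_sum_cong[THEN iffD1, rotated])
    fix b :: "nat ^ 'a"
    define y where "y = complex_of_nat (weight b)"
    have y: "y \<noteq> 0" by (simp add: y_def)
    have sq: "(1 / y) ^ (2 * t) = (1 / y) ^ t * (1 / y) ^ t" by (simp only: mult_2 power_add)
    have p: "(1 / y) ^ (t - i) = (1 / y) ^ t * y ^ i" if "i < n" for i
      using that n y by (simp add: power_diff power_one_over field_simps)
    have "(\<Sum>i<n. \<Sum>j<n. cnj (q i) * (\<kappa> b * (1 / y) ^ (t - i) * (1 / y) ^ (t - j)) * q j) =
        (\<Sum>i<n. \<Sum>j<n. \<kappa> b * (1 / y) ^ (2 * t) * ((q j * y ^ j) * (cnj (q i) * y ^ i)))"
      unfolding sq by (intro sum.cong refl) (simp only: p lessThan_iff mult_ac)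
    also have "\<dots> = \<kappa> b * (1 / y) ^ (2 * t) * (\<Sum>i<n. \<Sum>j<n. (q j * y ^ j) * (cnj (q i) * y ^ i))"
      by (simp add: sum_distrib_left)
    also have "(\<Sum>i<n. \<Sum>j<n. (q j * y ^ j) * (cnj (q i) * y ^ i)) = (\<Sum>j<n. q j * y ^ j) * cnj (\<Sum>i<n. q i * y ^ i)"
      by (simp add: sum_product y_def) (rule sum.swap)
    also have "\<dots> = of_real ((cmod (poly_val n q (weight b)))\<^sup>2)"
      by (simp only: complex_norm_square poly_val_def y_def)
    finally show "(\<Sum>i<n. \<Sum>j<n. cnj (q i) * (\<kappa> b * (1 / of_nat (weight b)) ^ (t - i) * (1 / of_nat (weight b)) ^ (t - j)) * q j) =
        \<kappa> b * (1 / of_nat (weight b)) ^ (2 * t) * of_real ((cmod (poly_val n q (weight b)))\<^sup>2)"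
      unfolding y_def .
  qed
qed

text \<open>Positivity at \<open>n\<close> points tending to \<open>0\<close> passes to the coefficients with indices in \<open>I\<close>, for kernels of the form
  \<open>\<Sum> \<kappa>\<^sub>b z\<^sup>b w\<^sup>b\<^sup>* - u u\<^sup>*\<close>: given values \<open>v\<close> on \<open>I\<close>, the polynomial that takes the value \<open>v\<^sub>a n\<^sub>a\<^sup>t\<close> at the weight
  \<open>n\<^sub>a\<close> undoes the decay \<open>n\<^sub>a\<^sup>-\<^sup>t\<close> of the monomials in \<open>I\<close>, and the contribution of the
  larger weights tends to \<open>0\<close>, as these monomials decay faster.\<close>

lemma coefficient_form_nonneg:
  fixes \<kappa> :: "nat ^ 'd::finite \<Rightarrow> real" and u :: "nat ^ 'd \<Rightarrow> complex"
  assumes mu: "1 \<le> \<mu>" and I: "I \<subseteq> {a. weight a \<le> \<mu>}" and n: "n = card I"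
    and supp: "\<And>a. weight a \<le> \<mu> \<Longrightarrow> a \<notin> I \<Longrightarrow> \<kappa> a = 0 \<and> u a = 0"
    and M\<kappa>: "(\<lambda>b. \<bar>\<kappa> b\<bar> / real (weight b) ^ M) summable_on UNIV" and Mu: "(\<lambda>b. cmod (u b) / real (weight b) ^ M) summable_on UNIV"
    and pos: "\<And>t q. t \<ge> T \<Longrightarrow> (cmod (\<Sum>\<^sub>\<infinity>b. u b * (1 / of_nat (weight b)) ^ t * poly_val n q (weight b)))\<^sup>2 \<le>
      Re (\<Sum>\<^sub>\<infinity>b. of_real (\<kappa> b) * (1 / of_nat (weight b)) ^ (2 * t) * of_real ((cmod (poly_val n q (weight b)))\<^sup>2))"
  shows "(cmod (\<Sum>a\<in>I. u a * v a))\<^sup>2 \<le> (\<Sum>a\<in>I. \<kappa> a * (cmod (v a))\<^sup>2)"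
proof -
  have fin: "finite {a :: nat ^ 'd. weight a \<le> \<mu>}" by (rule weight_finite)
  have fI: "finite I" using I fin by (rule finite_subset)
  define A where "A = weight ` I"
  have A: "finite A" "card A = n"
    unfolding A_def n by (auto intro!: finite_imageI fI card_image inj_on_subset[OF weight_inj])
  obtain C where C: "C \<ge> 0" "\<And>q x. 1 \<le> x \<Longrightarrow> cmod (poly_val n q x) \<le> C * real x ^ n * (\<Sum>y\<in>A. cmod (poly_val n q y))"
    using interpolation_growth[OF A(1)] unfolding A(2) by blast
  have "\<exists>q. \<forall>a\<in>I. poly_val n q (weight a) = v a * of_nat (weight a) ^ t" for t
  proof -
    obtain q where "\<forall>x\<in>A. poly_val n q x = v (inv_into UNIV weight x) * of_nat x ^ t"
      using interpolation[OF A(1), of "\<lambda>x. v (inv_into UNIV weight x) * of_nat x ^ t"] unfolding A(2) by auto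
    then show ?thesis by (intro exI[of _ q]) (auto simp: A_def inv_f_f[OF weight_inj])
  qed
  then obtain q where q: "\<And>t a. a \<in> I \<Longrightarrow> poly_val n (q t) (weight a) = v a * of_nat (weight a) ^ t" by metis
  define E where "E = C * (\<Sum>a\<in>I. cmod (v a))"
  have E: "0 \<le> E" unfolding E_def using C(1) by (intro mult_nonneg_nonneg sum_nonneg) auto
  have growth: "cmod (poly_val n (q t) (weight b)) \<le> E * real (weight b) ^ n * real \<mu> ^ t" for t b
  proof -
    have "(\<Sum>y\<in>A. cmod (poly_val n (q t) y)) = (\<Sum>a\<in>I. cmod (poly_val n (q t) (weight a)))"
      unfolding A_def by (subst sum.reindex) (auto intro: inj_on_subset[OF weight_inj])
    also have "\<dots> = (\<Sum>a\<in>I. cmod (v a) * real (weight a) ^ t)"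
      by (intro sum.cong refl) (simp add: q norm_mult norm_power)
    also have "\<dots> \<le> (\<Sum>a\<in>I. cmod (v a) * real \<mu> ^ t)"
      using I by (intro sum_mono mult_left_mono power_mono) auto
    finally have "(\<Sum>y\<in>A. cmod (poly_val n (q t) y)) \<le> (\<Sum>a\<in>I. cmod (v a)) * real \<mu> ^ t"
      by (simp add: sum_distrib_right)
    moreover have "1 \<le> weight b" using weight_pos[of b] by linarith
    ultimately have "cmod (poly_val n (q t) (weight b)) \<le> C * real (weight b) ^ n * ((\<Sum>a\<in>I. cmod (v a)) * real \<mu> ^ t)"
      using C(1) by (intro order_trans[OF C(2)] mult_left_mono) auto
    then show ?thesis by (simp add: E_def mult_ac)
  qed
  define gN where "gN t b = u b * (1 / of_nat (weight b)) ^ t * poly_val n (q t) (weight b)" for t b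
  define gD where "gD t b = of_real (\<kappa> b) * (1 / of_nat (weight b)) ^ (2 * t) * complex_of_real ((cmod (poly_val n (q t) (weight b)))\<^sup>2)" for t b
  have low: "(\<Sum>a\<in>{a. weight a \<le> \<mu>}. if a \<in> I then F a else 0) = (\<Sum>a\<in>I. F a)" for F :: "nat ^ 'd \<Rightarrow> complex"
    using I fin by (simp add: sum.inter_restrict[symmetric] Int_absorb1)
  have "(\<lambda>t. \<Sum>\<^sub>\<infinity>b. gN t b) \<longlonglongrightarrow> (\<Sum>a\<in>{a. weight a \<le> \<mu>}. if a \<in> I then u a * v a else 0)"
  proof (rule weighted_limit[where u = "\<lambda>b. cmod (u b) * (E * real (weight b) ^ n)" and M = "M + n" and ?t0.0 = 0])
    have "(\<lambda>b. E * (cmod (u b) / real (weight b) ^ M)) summable_on UNIV" by (rule summable_on_cmult_right[OF Mu])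
    then show "(\<lambda>b. cmod (u b) * (E * real (weight b) ^ n) / real (weight b) ^ (M + n)) summable_on UNIV"
      by (rule summable_on_cong[THEN iffD1, rotated]) (simp add: power_add)
    show "gN t a = (if a \<in> I then u a * v a else 0)" if "weight a \<le> \<mu>" for t a
      using supp[OF that] q[of a t] by (simp add: gN_def power_one_over)
    show "cmod (gN t b) \<le> cmod (u b) * (E * real (weight b) ^ n) * (real \<mu> / real (weight b)) ^ t" for t b
    proof -
      have "cmod (gN t b) = cmod (u b) * (1 / real (weight b)) ^ t * cmod (poly_val n (q t) (weight b))"
        by (simp add: gN_def norm_mult norm_power norm_divide)
      also have "\<dots> \<le> cmod (u b) * (1 / real (weight b)) ^ t * (E * real (weight b) ^ n * real \<mu> ^ t)"
        by (intro mult_left_mono growth) simp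
      finally show ?thesis by (simp add: power_divide mult_ac)
    qed
  qed (use mu fin E in auto)
  then have limN: "(\<lambda>t. \<Sum>\<^sub>\<infinity>b. gN t b) \<longlonglongrightarrow> (\<Sum>a\<in>I. u a * v a)" unfolding low .
  have "(\<lambda>t. \<Sum>\<^sub>\<infinity>b. gD t b) \<longlonglongrightarrow> (\<Sum>a\<in>{a. weight a \<le> \<mu>}. if a \<in> I then of_real (\<kappa> a * (cmod (v a))\<^sup>2) else 0)"
  proof (rule weighted_limit[where u = "\<lambda>b. \<bar>\<kappa> b\<bar> * (E * real (weight b) ^ n)\<^sup>2" and M = "M + 2 * n" and ?t0.0 = 0])
    have "(\<lambda>b. E\<^sup>2 * (\<bar>\<kappa> b\<bar> / real (weight b) ^ M)) summable_on UNIV" by (rule summable_on_cmult_right[OF M\<kappa>])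
    moreover have "E\<^sup>2 * (\<bar>\<kappa> b\<bar> / real (weight b) ^ M) = \<bar>\<kappa> b\<bar> * (E * real (weight b) ^ n)\<^sup>2 / real (weight b) ^ (M + 2 * n)" for b
      by (simp add: power_add power_mult_distrib power_even_eq)
    ultimately show "(\<lambda>b. \<bar>\<kappa> b\<bar> * (E * real (weight b) ^ n)\<^sup>2 / real (weight b) ^ (M + 2 * n)) summable_on UNIV" by simp
    show "gD t a = (if a \<in> I then of_real (\<kappa> a * (cmod (v a))\<^sup>2) else 0)" if "weight a \<le> \<mu>" for t a
    proof (cases "a \<in> I")
      case True
      have "(cmod (poly_val n (q t) (weight a)))\<^sup>2 = (cmod (v a))\<^sup>2 * real (weight a) ^ (2 * t)"
        by (simp add: q[OF True] norm_mult norm_power power_mult_distrib power_even_eq)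
      then show ?thesis using True by (simp add: gD_def power_one_over)
    qed (use supp[OF that] in \<open>simp add: gD_def\<close>)
    show "cmod (gD t b) \<le> \<bar>\<kappa> b\<bar> * (E * real (weight b) ^ n)\<^sup>2 * (real \<mu> / real (weight b)) ^ t" if b: "\<mu> < weight b" for t b
    proof -
      have "cmod (gD t b) = \<bar>\<kappa> b\<bar> * (1 / real (weight b)) ^ (2 * t) * (cmod (poly_val n (q t) (weight b)))\<^sup>2"
        by (simp add: gD_def norm_mult norm_power norm_divide)
      also have "\<dots> \<le> \<bar>\<kappa> b\<bar> * (1 / real (weight b)) ^ (2 * t) * (E * real (weight b) ^ n * real \<mu> ^ t)\<^sup>2"
        by (intro mult_left_mono power_mono growth) auto
      also have "\<dots> = \<bar>\<kappa> b\<bar> * (E * real (weight b) ^ n)\<^sup>2 * (real \<mu> / real (weight b)) ^ (2 * t)"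
        by (simp add: power_divide power_mult_distrib mult_ac flip: power_mult)
      also have "\<dots> \<le> \<bar>\<kappa> b\<bar> * (E * real (weight b) ^ n)\<^sup>2 * (real \<mu> / real (weight b)) ^ t"
        using b by (intro mult_left_mono power_decreasing) auto
      finally show ?thesis .
    qed
  qed (use mu fin in auto)
  then have limD: "(\<lambda>t. \<Sum>\<^sub>\<infinity>b. gD t b) \<longlonglongrightarrow> (\<Sum>a\<in>I. of_real (\<kappa> a * (cmod (v a))\<^sup>2))" unfolding low .
  have "(cmod (\<Sum>a\<in>I. u a * v a))\<^sup>2 \<le> Re (\<Sum>a\<in>I. of_real (\<kappa> a * (cmod (v a))\<^sup>2))"
  proof (rule tendsto_le)
    show "(\<lambda>t. (cmod (\<Sum>\<^sub>\<infinity>b. gN t b))\<^sup>2) \<longlonglongrightarrow> (cmod (\<Sum>a\<in>I. u a * v a))\<^sup>2" by (intro tendsto_intros limN)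
    show "(\<lambda>t. Re (\<Sum>\<^sub>\<infinity>b. gD t b)) \<longlonglongrightarrow> Re (\<Sum>a\<in>I. of_real (\<kappa> a * (cmod (v a))\<^sup>2))" by (intro tendsto_intros limD)
    show "\<forall>\<^sub>F t in sequentially. (cmod (\<Sum>\<^sub>\<infinity>b. gN t b))\<^sup>2 \<le> Re (\<Sum>\<^sub>\<infinity>b. gD t b)"
      unfolding gN_def gD_def using pos by (rule eventually_sequentiallyI)
  qed simp
  then show ?thesis by simp
qed

section \<open>Holomorphic functions of several variables along lines\<close>

text \<open>Holomorphy on complex lines is all that the identity theorem needs.\<close>

definition line_holomorphic :: "(complex ^ 'd) set \<Rightarrow> (complex ^ 'd \<Rightarrow> complex) \<Rightarrow> bool" where
  "line_holomorphic U f \<longleftrightarrow> (\<forall>z v. (\<lambda>x. f (z + x *s v)) holomorphic_on {x. z + x *s v \<in> U})"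

lemma bounded_linear_scalar_mult: "bounded_linear (\<lambda>x. x *s (v :: complex ^ 'd::finite))"
  unfolding linear_conv_bounded_linear[symmetric]
  by (rule linearI) (simp_all add: Finite_Cartesian_Product.vec_eq_iff algebra_simps)

lemma continuous_on_line: "continuous_on S (\<lambda>x. (z :: complex ^ 'd::finite) + x *s v)"
  by (intro continuous_on_add continuous_on_const bounded_linear.continuous_on[OF bounded_linear_scalar_mult] continuous_on_id)

lemma open_line_preimage: "open U \<Longrightarrow> open {x. (z :: complex ^ 'd::finite) + x *s v \<in> U}"
  using open_vimage[OF _ continuous_on_line[of UNIV z v]] by (simp add: vimage_def)

lemma holomorphic_several_line:
  fixes f :: "complex ^ 'd::finite \<Rightarrow> complex"
  assumes "holomorphic_several U f" shows "line_holomorphic U f"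
  unfolding line_holomorphic_def holomorphic_on_def
proof (intro allI ballI)
  fix z v :: "complex ^ 'd" and x assume "x \<in> {x. z + x *s v \<in> U}"
  then obtain D where D: "(f has_derivative D) (at (z + x *s v))" "\<And>c v. D (c *s v) = c * D v"
    using assms unfolding holomorphic_several_def by blast
  have "((\<lambda>x. z + x *s v) has_derivative (\<lambda>h. 0 + h *s v)) (at x)"
    by (intro has_derivative_add has_derivative_const bounded_linear_imp_has_derivative bounded_linear_scalar_mult)
  then have "((\<lambda>x. z + x *s v) has_derivative (\<lambda>h. h *s v)) (at x)" by simp
  from has_derivative_compose[OF this D(1)]
  have "((\<lambda>x. f (z + x *s v)) has_derivative (\<lambda>h. D v * h)) (at x)" by (simp add: D(2) mult.commute)
  then have "((\<lambda>x. f (z + x *s v)) has_field_derivative D v) (at x)" by (simp add: has_field_derivative_def)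
  then show "(\<lambda>x. f (z + x *s v)) field_differentiable at x within {x. z + x *s v \<in> U}"
    using field_differentiable_def field_differentiable_at_within by blast
qed

lemma line_holomorphic_diff:
  "line_holomorphic U f \<Longrightarrow> line_holomorphic U g \<Longrightarrow> line_holomorphic U (\<lambda>z. f z - g z)"
  unfolding line_holomorphic_def by (auto intro: holomorphic_on_diff)

lemma line_holomorphic_subset: "line_holomorphic U f \<Longrightarrow> V \<subseteq> U \<Longrightarrow> line_holomorphic V f"
  unfolding line_holomorphic_def by (blast intro: holomorphic_on_subset)

text \<open>The set of points near which \<open>h\<close> vanishes is closed in \<open>U\<close>: a ball around a limit point contains such a point \<open>a\<close>, and
  each other point of the ball is on a complex line through \<open>a\<close>.\<close>

lemma line_holomorphic_identity:
  fixes h :: "complex ^ 'd::finite \<Rightarrow> complex"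
  assumes U: "open U" "connected U" and h: "line_holomorphic U h" and z0: "z0 \<in> U" and \<delta>: "\<delta> > 0"
    and zero: "\<And>y. y \<in> ball z0 \<delta> \<Longrightarrow> y \<in> U \<Longrightarrow> h y = 0" and z: "z \<in> U"
  shows "h z = 0"
proof -
  define A where "A = {z\<in>U. \<exists>e>0. \<forall>y\<in>ball z e. h y = 0}"
  have "openin (top_of_set U) A"
    unfolding openin_open_eq[OF U(1)]
  proof
    show "open A"
      unfolding open_contains_ball
    proof
      fix a assume "a \<in> A"
      then obtain e where e: "a \<in> U" "e > 0" "\<And>y. y \<in> ball a e \<Longrightarrow> h y = 0" by (auto simp: A_def)
      obtain e' where e': "e' > 0" "ball a e' \<subseteq> U" using U(1) e(1) open_contains_ball by blast
      have "b \<in> A" if b: "b \<in> ball a (min (e / 2) e')" for b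
      proof -
        have "h y = 0" if "y \<in> ball b (e / 2)" for y
        proof (rule e(3))
          show "y \<in> ball a e" using dist_triangle[of a y b] that b by (simp add: dist_commute)
        qed
        moreover have "b \<in> U" using b e' by auto
        ultimately show ?thesis unfolding A_def using e(2) by (auto intro!: exI[of _ "e / 2"])
      qed
      then show "\<exists>e>0. ball a e \<subseteq> A" using e(2) e'(1) by (intro exI[of _ "min (e / 2) e'"]) auto
    qed
  qed (auto simp: A_def)
  moreover have "closedin (top_of_set U) A"
    unfolding closedin_limpt
  proof (intro conjI allI impI)
    show "A \<subseteq> U" by (auto simp: A_def)
    fix x assume x: "x islimpt A \<and> x \<in> U"
    obtain e where e: "e > 0" "ball x e \<subseteq> U" using U(1) x open_contains_ball by blast
    obtain a where a: "a \<in> A" "a \<in> ball x e"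
      using x e(1) unfolding islimpt_approachable by (auto simp: dist_commute)
    obtain d where d: "d > 0" "\<And>y. y \<in> ball a d \<Longrightarrow> h y = 0" using a(1) by (auto simp: A_def)
    have "h y = 0" if y: "y \<in> ball x e" for y
    proof -
      define L where "L = (\<lambda>t. a + t *s (y - a))"
      define S where "S = {t. L t \<in> ball x e}"
      have S: "open S" unfolding S_def L_def by (rule open_line_preimage) simp
      have "convex S"
      proof -
        have L: "L ((1 - u) *\<^sub>R s + u *\<^sub>R t) = (1 - u) *\<^sub>R L s + u *\<^sub>R L t" for s t and u :: real
          by (simp add: L_def Finite_Cartesian_Product.vec_eq_iff scaleR_conv_of_real[where 'a = complex] algebra_simps)
        show ?thesis
          unfolding convex_alt S_def
        proof (intro ballI allI impI)
          fix s t and u :: real assume "s \<in> {t. L t \<in> ball x e}" "t \<in> {t. L t \<in> ball x e}" "0 \<le> u \<and> u \<le> 1"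
          then show "(1 - u) *\<^sub>R s + u *\<^sub>R t \<in> {t. L t \<in> ball x e}"
            using convex_ball[of x e] unfolding convex_alt by (simp only: mem_Collect_eq L)
        qed
      qed
      then have Sc: "connected S" by (rule convex_connected)
      define V where "V = S \<inter> {t. L t \<in> ball a d}"
      have V: "open V" unfolding V_def using S open_line_preimage[of "ball a d" a "y - a"] by (auto simp: L_def)
      have L01: "L 0 = a" "L 1 = y" by (simp_all add: L_def Finite_Cartesian_Product.vec_eq_iff)
      have 0: "0 \<in> V" "0 \<in> S" "1 \<in> S" using a(2) y d(1) by (auto simp: V_def S_def L01)
      have "(\<lambda>t. h (L t)) holomorphic_on S"
        using h e(2) unfolding line_holomorphic_def L_def S_def by (blast intro: holomorphic_on_subset)
      then have "h (L 1) = 0"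
      proof (rule analytic_continuation[where U = V and \<xi> = 0])
        show "(0::complex) islimpt V" using V 0(1) by (rule interior_limit_point[OF subsetD[OF interior_maximal[OF order_refl]]])
      qed (use S Sc 0 d in \<open>auto simp: V_def\<close>)
      then show ?thesis by (simp add: L01)
    qed
    then show "x \<in> A" using x e(1) by (auto simp: A_def)
  qed
  moreover have "z0 \<in> A"
  proof -
    obtain e where e: "e > 0" "ball z0 e \<subseteq> U" using U(1) z0 open_contains_ball by blast
    have "h y = 0" if "y \<in> ball z0 (min \<delta> e)" for y using zero[of y] e(2) that by auto
    then show ?thesis using z0 \<delta> e(1) by (auto simp: A_def intro!: exI[of _ "min \<delta> e"])
  qed
  ultimately have "A = U" using U(2) unfolding connected_clopen by blast
  then have "z \<in> A" using z by simp
  then show ?thesis by (auto simp: A_def)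
qed

lemma norm_vec_monom_le:
  assumes "\<And>i. norm (z $ i) \<le> R i"
  shows "norm (vec_monom z b) \<le> (\<Prod>i\<in>UNIV. R i ^ (b $ i))"
  unfolding vec_monom_def prod_norm[symmetric] norm_power
  using assms by (intro prod_mono conjI power_mono) auto

text \<open>Absolute convergence at the corner \<open>R\<close> of a polydisc is uniform convergence on the polydisc.\<close>

lemma series_line_holomorphic:
  fixes C :: "nat ^ 'd::finite \<Rightarrow> complex"
  assumes dom: "\<And>z. z \<in> U \<Longrightarrow> \<exists>R. (\<forall>i. norm (z $ i) < R i) \<and>
     (\<lambda>b. cmod (C b) * (\<Prod>i\<in>UNIV. R i ^ (b $ i))) summable_on UNIV"
  shows "line_holomorphic U (\<lambda>z. \<Sum>\<^sub>\<infinity>b. C b * vec_monom z b)"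
  unfolding line_holomorphic_def holomorphic_on_def
proof (intro allI ballI)
  fix z v :: "complex ^ 'd" and x0 assume "x0 \<in> {x. z + x *s v \<in> U}"
  then obtain R where R: "\<And>i. norm ((z + x0 *s v) $ i) < R i"
    and sm: "(\<lambda>b. cmod (C b) * (\<Prod>i\<in>UNIV. R i ^ (b $ i))) summable_on UNIV"
    using dom by blast
  define W where "W = (\<Inter>i\<in>UNIV. {x. norm ((z + x *s v) $ i) < R i})"
  have "open W" unfolding W_def
    by (intro open_INT ballI open_Collect_less continuous_on_norm continuous_on_component continuous_on_line continuous_on_const) auto
  moreover have "x0 \<in> W" unfolding W_def using R by blast
  ultimately obtain \<rho> where \<rho>: "\<rho> > 0" "cball x0 \<rho> \<subseteq> W"
    unfolding open_contains_cball by blast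
  have "uniform_limit (cball x0 \<rho>) (\<lambda>X x. \<Sum>b\<in>X. C b * vec_monom (z + x *s v) b)
     (\<lambda>x. \<Sum>\<^sub>\<infinity>b\<in>UNIV. C b * vec_monom (z + x *s v) b) (finite_subsets_at_top UNIV)"
  proof (rule Weierstrass_m_test_general[OF _ sm])
    fix b x assume "x \<in> cball x0 \<rho>"
    then have "x \<in> W" using \<rho>(2) by blast
    then have "norm ((z + x *s v) $ i) \<le> R i" for i unfolding W_def by (blast intro: less_imp_le)
    then show "norm (C b * vec_monom (z + x *s v) b) \<le> cmod (C b) * (\<Prod>i\<in>UNIV. R i ^ (b $ i))"
      unfolding norm_mult by (intro mult_left_mono norm_vec_monom_le) auto
  qed
  moreover have hol: "(\<lambda>x. \<Sum>b\<in>X. C b * vec_monom (z + x *s v) b) holomorphic_on S" for X and S :: "complex set"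
    unfolding vec_monom_def by (auto intro!: holomorphic_intros)
  then have "\<forall>\<^sub>F X in finite_subsets_at_top UNIV.
      continuous_on (cball x0 \<rho>) (\<lambda>x. \<Sum>b\<in>X. C b * vec_monom (z + x *s v) b) \<and>
      (\<lambda>x. \<Sum>b\<in>X. C b * vec_monom (z + x *s v) b) holomorphic_on ball x0 \<rho>"
    using holomorphic_on_imp_continuous_on[OF hol] hol by (intro always_eventually allI conjI)
  ultimately have "(\<lambda>x. \<Sum>\<^sub>\<infinity>b\<in>UNIV. C b * vec_monom (z + x *s v) b) holomorphic_on ball x0 \<rho>"
    by (elim holomorphic_uniform_limit[rotated]) auto
  then have "(\<lambda>x. \<Sum>\<^sub>\<infinity>b\<in>UNIV. C b * vec_monom (z + x *s v) b) field_differentiable at x0"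
    using \<rho>(1) holomorphic_on_imp_differentiable_at[of _ "ball x0 \<rho>"] by auto
  then show "(\<lambda>x. \<Sum>\<^sub>\<infinity>b\<in>UNIV. C b * vec_monom (z + x *s v) b) field_differentiable at x0 within {x. z + x *s v \<in> U}"
    by (rule field_differentiable_at_within)
qed

section \<open>The power series of a diagonal holomorphic kernel\<close>

lemma prod_two_power:
  fixes b :: "nat ^ 'd::finite"
  shows "(\<Prod>i\<in>UNIV. (2 ^ e :: real) ^ (b $ i)) = real (2 ^ (\<Sum>i\<in>UNIV. b $ i)) ^ e"
proof -
  have "(\<Prod>i\<in>UNIV. (2 ^ e :: real) ^ (b $ i)) = (\<Prod>i\<in>UNIV. (2 ^ (b $ i)) ^ e)"
    by (simp add: mult.commute flip: power_mult)
  also have "\<dots> = (\<Prod>i\<in>UNIV. 2 ^ (b $ i)) ^ e" by (rule prod_power_distrib[symmetric])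
  finally show ?thesis by (simp add: power_sum)
qed

text \<open>Monomials grow at most like a power of the weight, so that powers of weights control all convergence below.\<close>

lemma norm_vec_monom_weight:
  "\<exists>e. \<forall>b. norm (vec_monom (z :: complex ^ 'd::finite) b) \<le> real (weight b) ^ e"
proof -
  obtain e :: nat where e: "norm z < 2 ^ e" using real_arch_pow[of 2 "norm z"] by auto
  have "norm (vec_monom z b) \<le> real (weight b) ^ e" for b
  proof -
    have "norm (vec_monom z b) \<le> (\<Prod>i\<in>UNIV. (2 ^ e) ^ (b $ i))"
      by (rule norm_vec_monom_le) (use e Finite_Cartesian_Product.norm_nth_le[of z] in \<open>auto intro: order_trans less_imp_le\<close>)
    also have "\<dots> = real (2 ^ (\<Sum>i\<in>UNIV. b $ i)) ^ e" by (rule prod_two_power)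
    also have "\<dots> \<le> real (weight b) ^ e" using weight_ge_2_power[of b] by (intro power_mono) (auto simp flip: of_nat_le_iff)
    finally show ?thesis .
  qed
  then show ?thesis by blast
qed

context
  fixes \<Omega> :: "(complex ^ 'd::finite) set" and f :: "complex ^ 'd \<Rightarrow> complex ^ 'd \<Rightarrow> complex"
    and c :: "nat ^ 'd \<Rightarrow> real" and r :: real
  assumes \<Omega>: "open \<Omega>" "connected \<Omega>" "0 \<in> \<Omega>" and psd: "psd \<Omega> f"
    and hol: "\<And>w. w \<in> \<Omega> \<Longrightarrow> holomorphic_several \<Omega> (\<lambda>z. f z w)"
    and c: "\<And>a. 0 < c a" and r: "0 < r" "ball 0 r \<subseteq> \<Omega>"
    and local: "\<And>z w. z \<in> ball 0 r \<Longrightarrow> w \<in> ball 0 r \<Longrightarrow>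
      ((\<lambda>a. of_real (c a) * vec_monom z a * cnj (vec_monom w a)) has_sum f z w) UNIV"
begin

text \<open>Evaluate the series at a point of the curve.\<close>

lemma coeff_growth: "\<exists>M. (\<lambda>a. c a / real (weight a) ^ M) summable_on UNIV"
proof -
  obtain t where t: "weight_pt t \<in> ball (0 :: complex ^ 'd) r" using weight_pt_small[OF r(1)] by blast
  have "((\<lambda>a. of_real (c a / real (weight a) ^ (2 * t))) has_sum f (weight_pt t) (weight_pt t)) UNIV"
    by (rule has_sum_cong[THEN iffD1, OF _ local[OF t t]])
       (unfold vec_monom_weight_pt complex_cnj_complex_of_real of_real_mult[symmetric],
        simp add: power_one_over mult_2 power_add)
  from has_sum_Re[OF this] show ?thesis by (auto intro: has_sum_imp_summable)
qed

text \<open>For a fixed point \<open>z\<close> and small \<open>w\<close> the power series represents \<open>f(z, w)\<close>: a path from \<open>0\<close> to \<open>z\<close>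
  is bounded, and the series converges on a polydisc containing it when \<open>w\<close> is small enough.\<close>

lemma series_far_near:
  assumes z: "z \<in> \<Omega>"
  shows "\<exists>\<rho>>0. \<forall>w\<in>ball 0 \<rho>. w \<in> \<Omega> \<and>
     ((\<lambda>a. of_real (c a) * vec_monom z a * cnj (vec_monom w a)) has_sum f z w) UNIV"
proof -
  obtain M where M: "(\<lambda>a. c a / real (weight a) ^ M) summable_on UNIV" using coeff_growth by blast
  have "path_connected \<Omega>" using connected_open_path_connected[OF \<Omega>(1,2)] .
  then obtain \<gamma> where \<gamma>: "path \<gamma>" "path_image \<gamma> \<subseteq> \<Omega>" "pathstart \<gamma> = 0" "pathfinish \<gamma> = z"
    using \<Omega>(3) z unfolding path_connected_def by blast
  obtain B where B: "\<And>y. y \<in> path_image \<gamma> \<Longrightarrow> norm y \<le> B"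
    using compact_imp_bounded[OF compact_path_image[OF \<gamma>(1)]] by (auto simp: bounded_iff)
  obtain e :: nat where e: "B < 2 ^ e" using real_arch_pow[of 2 B] by auto
  define U where "U = \<Omega> \<inter> (\<Inter>i\<in>UNIV. {y. norm (y $ i) < 2 ^ e})"
  define V where "V = connected_component_set U 0"
  have U: "open U" unfolding U_def
    by (intro open_Int \<Omega>(1) open_INT ballI open_Collect_less continuous_intros) auto
  have V: "open V" "connected V" "V \<subseteq> U" unfolding V_def
    using open_connected_component[OF U] connected_connected_component connected_component_subset by auto
  have im: "path_image \<gamma> \<subseteq> U"
    using \<gamma>(2) B e by (auto simp: U_def intro: le_less_trans[OF Finite_Cartesian_Product.norm_nth_le] le_less_trans)
  have ends: "0 \<in> path_image \<gamma>" "z \<in> path_image \<gamma>"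
    using pathstart_in_path_image[of \<gamma>] pathfinish_in_path_image[of \<gamma>] \<gamma>(3,4) by auto
  then have "path_image \<gamma> \<subseteq> V" unfolding V_def
    by (intro connected_component_maximal im connected_path_image \<gamma>(1))
  then have V0: "0 \<in> V" "z \<in> V" using ends by auto
  define P where "P = (\<Sum>i\<in>(UNIV :: 'd set). coord_prime i)"
  have P: "coord_prime (i :: 'd) \<le> P" for i unfolding P_def by (rule member_le_sum) auto
  define \<rho> where "\<rho> = min r ((1 / real P) ^ (M + e))"
  have P0: "0 < P" using P[of undefined] prime_gt_0_nat[OF coord_prime(2)[of "undefined :: 'd"]] by linarith
  have "\<rho> > 0" using r P0 by (auto simp: \<rho>_def)
  have *: "((\<lambda>a. of_real (c a) * vec_monom z a * cnj (vec_monom w a)) has_sum f z w) UNIV"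
    if w: "w \<in> ball 0 \<rho>" for w
  proof -
    have wr: "w \<in> ball 0 r" using w by (auto simp: \<rho>_def)
    have wi: "norm (w $ i) \<le> (1 / real (coord_prime i)) ^ (M + e)" for i
    proof -
      have "norm (w $ i) \<le> norm w" by (rule Finite_Cartesian_Product.norm_nth_le)
      also have "\<dots> \<le> (1 / real P) ^ (M + e)" using w by (auto simp: \<rho>_def)
      also have "\<dots> \<le> (1 / real (coord_prime i)) ^ (M + e)"
        using P[of i] prime_gt_0_nat[OF coord_prime(2)[of i]] P0 by (intro power_mono divide_left_mono) auto
      finally show ?thesis .
    qed
    have wb: "norm (vec_monom w b) \<le> 1 / real (weight b) ^ (M + e)" for b
    proof -
      have "norm (vec_monom w b) \<le> (\<Prod>i\<in>UNIV. ((1 / real (coord_prime i)) ^ (M + e)) ^ (b $ i))"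
        by (rule norm_vec_monom_le[OF wi])
      also have "\<dots> = (\<Prod>i\<in>UNIV. (1 / real (coord_prime i)) ^ (b $ i)) ^ (M + e)"
        by (simp add: prod_power_distrib mult.commute flip: power_mult)
      also have "\<dots> = 1 / real (weight b) ^ (M + e)"
        by (simp add: weight_def power_one_over prod_dividef power_divide)
      finally show ?thesis .
    qed
    define C where "C b = of_real (c b) * cnj (vec_monom w b)" for b
    have Cb: "cmod (C b) * (\<Prod>i\<in>UNIV. (2 ^ e) ^ (b $ i)) \<le> c b / real (weight b) ^ M" for b
    proof -
      have "(\<Prod>i\<in>UNIV. (2 ^ e :: real) ^ (b $ i)) = real (2 ^ (\<Sum>i\<in>UNIV. b $ i)) ^ e"
        by (rule prod_two_power)
      also have "\<dots> \<le> real (weight b) ^ e"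
        using weight_ge_2_power[of b] by (intro power_mono) (auto simp flip: of_nat_le_iff)
      finally have pe: "(\<Prod>i\<in>UNIV. (2 ^ e :: real) ^ (b $ i)) \<le> real (weight b) ^ e" .
      have "cmod (C b) * (\<Prod>i\<in>UNIV. (2 ^ e) ^ (b $ i)) \<le> (c b * (1 / real (weight b) ^ (M + e))) * real (weight b) ^ e"
      proof (intro mult_mono)
        have "cmod (C b) = c b * norm (vec_monom w b)" using c[of b] by (simp add: C_def norm_mult)
        also have "\<dots> \<le> c b * (1 / real (weight b) ^ (M + e))" using c[of b] by (intro mult_left_mono wb) simp
        finally show "cmod (C b) \<le> c b * (1 / real (weight b) ^ (M + e))" .
      qed (use c[of b] pe in \<open>auto intro: prod_nonneg\<close>)
      also have "\<dots> = c b / real (weight b) ^ M" by (simp add: power_add)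
      finally show ?thesis .
    qed
    have dom: "(\<lambda>b. cmod (C b) * (\<Prod>i\<in>UNIV. (2 ^ e) ^ (b $ i))) summable_on UNIV"
      by (rule summable_comparison[OF M]) (use Cb in \<open>auto simp: prod_nonneg\<close>)
    define h where "h y = f y w - (\<Sum>\<^sub>\<infinity>b. C b * vec_monom y b)" for y
    have "line_holomorphic V h"
      unfolding h_def
    proof (rule line_holomorphic_diff)
      have "line_holomorphic \<Omega> (\<lambda>y. f y w)" using holomorphic_several_line[OF hol] wr r by auto
      then show "line_holomorphic V (\<lambda>y. f y w)" by (rule line_holomorphic_subset) (use V in \<open>auto simp: U_def\<close>)
      show "line_holomorphic V (\<lambda>y. \<Sum>\<^sub>\<infinity>b. C b * vec_monom y b)"
        by (rule series_line_holomorphic, rule exI[of _ "\<lambda>_. 2 ^ e"]) (use V(3) dom in \<open>auto simp: U_def\<close>)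
    qed
    moreover have "h y = 0" if "y \<in> ball 0 r" for y
    proof -
      have "((\<lambda>b. C b * vec_monom y b) has_sum f y w) UNIV"
        by (rule has_sum_cong[THEN iffD1, OF _ local[OF that wr]]) (simp add: C_def)
      then show ?thesis by (simp add: h_def infsumI)
    qed
    ultimately have "h z = 0" using line_holomorphic_identity[OF V(1,2) _ V0(1) r(1) _ V0(2)] by blast
    moreover have "(\<lambda>b. C b * vec_monom z b) summable_on UNIV"
    proof (rule summable_comparison[OF dom])
      fix b
      have "z \<in> U" using V0(2) V(3) by blast
      then have "norm (z $ i) < 2 ^ e" for i by (auto simp: U_def)
      then have "norm (z $ i) \<le> 2 ^ e" for i by (rule less_imp_le)
      then show "norm (C b * vec_monom z b) \<le> cmod (C b) * (\<Prod>i\<in>UNIV. (2 ^ e) ^ (b $ i))"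
        unfolding norm_mult by (intro mult_left_mono norm_vec_monom_le) auto
    qed
    ultimately have "((\<lambda>b. C b * vec_monom z b) has_sum f z w) UNIV"
      unfolding h_def using has_sum_infsum by fastforce
    then show ?thesis by (rule has_sum_cong[THEN iffD1, rotated]) (simp add: C_def)
  qed
  have "ball 0 \<rho> \<subseteq> \<Omega>" using r by (auto simp: \<rho>_def)
  then show ?thesis using * \<open>\<rho> > 0\<close> by blast
qed

text \<open>Bessel's inequality for the monomials in the Hilbert space of \<open>f\<close>, where the coefficient functionals are
  approximated by combinations of evaluations at points tending to \<open>0\<close>. Positivity of \<open>f\<close> at \<open>z\<close> and at these points says that
  \<open>f(z, z) f - f\<^sub>z f\<^sub>z\<^sup>*\<close> is positive at the latter, hence on coefficients.\<close>

lemma series_Bessel: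
  assumes z: "z \<in> \<Omega>" and mu: "1 \<le> \<mu>"
  shows "(\<Sum>a\<in>{a. weight a \<le> \<mu>}. c a * (norm (vec_monom z a))\<^sup>2) \<le> Re (f z z)"
proof -
  define L where "L = {a :: nat ^ 'd. weight a \<le> \<mu>}"
  define n where "n = card L"
  define S where "S = (\<Sum>a\<in>L. c a * (norm (vec_monom z a))\<^sup>2)"
  obtain M where M: "(\<lambda>a. c a / real (weight a) ^ M) summable_on UNIV" using coeff_growth by blast
  obtain e where e: "\<And>b. norm (vec_monom z b) \<le> real (weight b) ^ e" using norm_vec_monom_weight by blast
  obtain \<rho> where \<rho>: "\<rho> > 0" "\<And>w. w \<in> ball 0 \<rho> \<Longrightarrow>
     ((\<lambda>a. of_real (c a) * vec_monom z a * cnj (vec_monom w a)) has_sum f z w) UNIV"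
    using series_far_near[OF z] by blast
  obtain t1 where t1: "\<And>t. t \<ge> t1 \<Longrightarrow> weight_pt t \<in> ball (0 :: complex ^ 'd) (min r \<rho>)"
    using weight_pt_small[of "min r \<rho>"] r(1) \<rho>(1) by auto
  have fz: "0 \<le> Re (f z z)" using psd_diag[OF psd z] by (simp add: less_eq_complex_def)
  have "(cmod (\<Sum>a\<in>L. of_real (c a) * vec_monom z a * cnj (vec_monom z a)))\<^sup>2 \<le>
      (\<Sum>a\<in>L. Re (f z z) * c a * (cmod (cnj (vec_monom z a)))\<^sup>2)"
  proof (rule coefficient_form_nonneg[OF mu _ n_def])
    show "L \<subseteq> {a. weight a \<le> \<mu>}" by (simp add: L_def)
    have "(\<lambda>b. c b / real (weight b) ^ (M + e)) summable_on UNIV"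
    proof (rule summable_comparison[OF M])
      show "norm (c b / real (weight b) ^ (M + e)) \<le> c b / real (weight b) ^ M" for b
        using c[of b] weight_pos[of b] by (auto simp: Suc_le_eq abs_of_pos intro!: divide_left_mono power_increasing)
    qed
    then have "(\<lambda>b. Re (f z z) * (c b / real (weight b) ^ (M + e))) summable_on UNIV" by (rule summable_on_cmult_right)
    then show "(\<lambda>b. \<bar>Re (f z z) * c b\<bar> / real (weight b) ^ (M + e)) summable_on UNIV"
      using fz less_imp_le[OF c] by (simp add: abs_mult)
    show "(\<lambda>b. cmod (of_real (c b) * vec_monom z b) / real (weight b) ^ (M + e)) summable_on UNIV"
    proof (rule summable_comparison[OF M])
      fix b
      have "c b * norm (vec_monom z b) / real (weight b) ^ (M + e) \<le> c b * real (weight b) ^ e / real (weight b) ^ (M + e)"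
        using c[of b] e[of b] by (intro divide_right_mono mult_left_mono) auto
      also have "\<dots> = c b / real (weight b) ^ M" by (simp add: power_add)
      finally show "norm (cmod (of_real (c b) * vec_monom z b) / real (weight b) ^ (M + e)) \<le> c b / real (weight b) ^ M"
        using c[of b] by (simp add: norm_mult)
    qed
    fix t and q :: "nat \<Rightarrow> complex" assume t: "t \<ge> t1 + n"
    define w where "w j = (weight_pt (t - j) :: complex ^ 'd)" for j
    have w: "w j \<in> ball 0 r" "w j \<in> ball 0 \<rho>" if "j < n" for j using t1[of "t - j"] t that by (auto simp: w_def)
    \<comment> \<open>The points \<open>w 0, \<dots>, w (n - 1)\<close> of the curve, followed by \<open>z\<close>.\<close>
    define p where "p j = (if j < n then w j else z)" for j
    define d where "d j = (if j < n then q j else 0)" for j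
    have P: "psd {..n} (\<lambda>i j. f (p i) (p j))"
      by (rule psd_pullback[OF psd]) (use w r z in \<open>auto simp: p_def\<close>)
    have ee: "herm_form {..n} (\<lambda>i j. f (p i) (p j)) (\<lambda>j. if j = n then 1 else 0) (\<lambda>j. if j = n then 1 else 0) = f z z"
      by (subst herm_form_indicator_left) (auto simp: p_def if_distrib cong: if_cong)
    have "((\<lambda>b. \<Sum>j<n. of_real (c b) * vec_monom z b * cnj (vec_monom (w j) b) * q j) has_sum (\<Sum>j<n. f z (w j) * q j)) UNIV"
      by (intro has_sum_sum_finite has_sum_cmult_left \<rho>(2) w) auto
    then have "((\<lambda>b. of_real (c b) * vec_monom z b * (1 / of_nat (weight b)) ^ t * poly_val n q (weight b)) has_sum (\<Sum>j<n. f z (w j) * q j)) UNIV"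
    proof (rule has_sum_cong[THEN iffD1, rotated])
      fix b :: "nat ^ 'd"
      have pw: "(1 / real (weight b)) ^ (t - j) = (1 / real (weight b)) ^ t * real (weight b) ^ j" if "j < n" for j
        using that t by (simp add: power_diff power_one_over field_simps)
      have "(\<Sum>j<n. of_real (c b) * vec_monom z b * cnj (vec_monom (w j) b) * q j) =
         (\<Sum>j<n. of_real (c b) * vec_monom z b * (1 / of_nat (weight b)) ^ t * (q j * of_nat (weight b) ^ j))"
        by (intro sum.cong refl) (simp add: w_def vec_monom_weight_pt pw)
      then show "(\<Sum>j<n. of_real (c b) * vec_monom z b * cnj (vec_monom (w j) b) * q j) =
          of_real (c b) * vec_monom z b * (1 / of_nat (weight b)) ^ t * poly_val n q (weight b)"
        by (simp add: poly_val_def sum_distrib_left)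
    qed
    then have N: "(\<Sum>\<^sub>\<infinity>b. of_real (c b) * vec_monom z b * (1 / of_nat (weight b)) ^ t * poly_val n q (weight b)) = (\<Sum>j<n. f z (w j) * q j)"
      by (rule infsumI)
    have "herm_form {..n} (\<lambda>i j. f (p i) (p j)) (\<lambda>j. if j = n then 1 else 0) d = (\<Sum>j\<in>{..n}. f z (p j) * d j)"
      by (subst herm_form_indicator_left) (auto simp: p_def)
    also have "\<dots> = (\<Sum>j<n. f z (w j) * q j)"
      by (rule sum.mono_neutral_cong_right) (auto simp: p_def d_def)
    finally have ed: "herm_form {..n} (\<lambda>i j. f (p i) (p j)) (\<lambda>j. if j = n then 1 else 0) d = (\<Sum>j<n. f z (w j) * q j)" .
    let ?D = "\<lambda>b. complex_of_real (c b) * (1 / of_nat (weight b)) ^ (2 * t) * of_real ((cmod (poly_val n q (weight b)))\<^sup>2)"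
    have "(?D has_sum herm_form {..<n} (\<lambda>i j. f (w i) (w j)) q q) UNIV"
    proof (rule weight_form)
      fix i j assume "i < n" "j < n"
      from local[OF w(1)[OF this(1)] w(1)[OF this(2)]]
      show "((\<lambda>b. of_real (c b) * (1 / of_nat (weight b)) ^ (t - i) * (1 / of_nat (weight b)) ^ (t - j)) has_sum f (w i) (w j)) UNIV"
        by (rule has_sum_cong[THEN iffD1, rotated]) (simp add: w_def vec_monom_weight_pt)
    qed (use t in auto)
    then have "infsum ?D UNIV = herm_form {..<n} (\<lambda>i j. f (w i) (w j)) q q" by (rule infsumI)
    also have "\<dots> = herm_form {..<n} (\<lambda>i j. f (p i) (p j)) d d" by (rule herm_form_cong) (auto simp: p_def d_def)
    also have "\<dots> = herm_form {..n} (\<lambda>i j. f (p i) (p j)) d d" by (rule herm_form_restrict[symmetric]) (auto simp: d_def)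
    finally have dd: "herm_form {..n} (\<lambda>i j. f (p i) (p j)) d d = infsum ?D UNIV" by simp
    have "infsum (\<lambda>b. of_real (Re (f z z)) * ?D b) UNIV = of_real (Re (f z z)) * infsum ?D UNIV" by (rule infsum_cmult_right')
    then have "Re (infsum (\<lambda>b. of_real (Re (f z z)) * ?D b) UNIV) = Re (f z z) * Re (infsum ?D UNIV)" by simp
    then show "(cmod (\<Sum>\<^sub>\<infinity>b. of_real (c b) * vec_monom z b * (1 / of_nat (weight b)) ^ t * poly_val n q (weight b)))\<^sup>2 \<le>
        Re (\<Sum>\<^sub>\<infinity>b. of_real (Re (f z z) * c b) * (1 / of_nat (weight b)) ^ (2 * t) * of_real ((cmod (poly_val n q (weight b)))\<^sup>2))"
      using psd_Cauchy_Schwarz[OF P finite_atMost order_refl, of "\<lambda>j. if j = n then 1 else 0" d]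
      unfolding ee ed dd N by (simp add: mult.assoc)
  qed (simp add: L_def)
  moreover have "(\<Sum>a\<in>L. of_real (c a) * vec_monom z a * cnj (vec_monom z a)) = of_real S"
    unfolding S_def of_real_sum of_real_mult complex_norm_square by (simp only: mult.assoc)
  moreover have "(\<Sum>a\<in>L. Re (f z z) * c a * (cmod (cnj (vec_monom z a)))\<^sup>2) = Re (f z z) * S"
    by (simp add: S_def sum_distrib_left mult.assoc)
  ultimately have "(cmod (of_real S))\<^sup>2 \<le> Re (f z z) * S" by (simp only:)
  then have "S * S \<le> Re (f z z) * S" by (simp add: power2_eq_square)
  moreover have "0 \<le> S" unfolding S_def using c by (intro sum_nonneg) (auto simp: less_imp_le)
  ultimately have "S \<le> Re (f z z)" using fz by (cases "S = 0") auto
  then show ?thesis by (simp add: S_def L_def)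
qed

lemma series_diagonal_summable:
  assumes z: "z \<in> \<Omega>" shows "(\<lambda>a. c a * (norm (vec_monom z a))\<^sup>2) summable_on UNIV"
proof (rule nonneg_bdd_above_summable_on)
  show "0 \<le> c a * (norm (vec_monom z a))\<^sup>2" for a using c[of a] by simp
  show "bdd_above (sum (\<lambda>a. c a * (norm (vec_monom z a))\<^sup>2) ` {F. F \<subseteq> UNIV \<and> finite F})"
  proof (rule bdd_aboveI[of _ "Re (f z z)"])
    fix s assume "s \<in> sum (\<lambda>a. c a * (norm (vec_monom z a))\<^sup>2) ` {F. F \<subseteq> UNIV \<and> finite F}"
    then obtain F where F: "finite F" "s = (\<Sum>a\<in>F. c a * (norm (vec_monom z a))\<^sup>2)" by auto
    define \<mu> where "\<mu> = 1 + (\<Sum>a\<in>F. weight a)"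
    have "weight a \<le> \<mu>" if "a \<in> F" for a using member_le_sum[OF that, of weight] F(1) by (simp add: \<mu>_def)
    then have "s \<le> (\<Sum>a\<in>{a. weight a \<le> \<mu>}. c a * (norm (vec_monom z a))\<^sup>2)"
      unfolding F(2) using c weight_finite by (intro sum_mono2) (auto simp: less_imp_le)
    also have "\<dots> \<le> Re (f z z)" by (rule series_Bessel[OF z]) (simp add: \<mu>_def)
    finally show "s \<le> Re (f z z)" .
  qed
qed

lemma series_mixed_summable:
  assumes "z \<in> \<Omega>" "w \<in> \<Omega>"
  shows "(\<lambda>a. c a * norm (vec_monom z a) * norm (vec_monom w a)) summable_on UNIV"
proof (rule summable_comparison)
  show "(\<lambda>a. c a * (norm (vec_monom z a))\<^sup>2 + c a * (norm (vec_monom w a))\<^sup>2) summable_on UNIV"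
    by (intro summable_on_add series_diagonal_summable assms)
  fix a
  have "norm (vec_monom z a) * norm (vec_monom w a) \<le> (norm (vec_monom z a))\<^sup>2 + (norm (vec_monom w a))\<^sup>2"
    using sum_squares_bound[of "norm (vec_monom z a)" "norm (vec_monom w a)"]
      mult_nonneg_nonneg[OF norm_ge_zero[of "vec_monom z a"] norm_ge_zero[of "vec_monom w a"]]
    unfolding mult.assoc by linarith
  from mult_left_mono[OF this, of "c a"] c[of a]
  show "norm (c a * norm (vec_monom z a) * norm (vec_monom w a)) \<le> c a * (norm (vec_monom z a))\<^sup>2 + c a * (norm (vec_monom w a))\<^sup>2"
    by (simp add: algebra_simps norm_mult)
qed

text \<open>Now that the series converges absolutely on \<open>\<Omega>\<close>, it is holomorphic in \<open>z\<close>, and for fixed \<open>w\<close> it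
  represents \<open>f\<close> for \<open>z\<close> near \<open>0\<close>, by symmetry.\<close>

lemma series_global:
  assumes z: "z \<in> \<Omega>" and w: "w \<in> \<Omega>"
  shows "((\<lambda>a. of_real (c a) * vec_monom z a * cnj (vec_monom w a)) has_sum f z w) UNIV"
proof -
  define C where "C b = of_real (c b) * cnj (vec_monom w b)" for b
  define h where "h y = f y w - (\<Sum>\<^sub>\<infinity>b. C b * vec_monom y b)" for y
  obtain \<rho> where \<rho>: "\<rho> > 0" "\<And>y. y \<in> ball 0 \<rho> \<Longrightarrow> y \<in> \<Omega>" "\<And>y. y \<in> ball 0 \<rho> \<Longrightarrow>
     ((\<lambda>a. of_real (c a) * vec_monom w a * cnj (vec_monom y a)) has_sum f w y) UNIV"
    using series_far_near[OF w] by blast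
  have "line_holomorphic \<Omega> h"
    unfolding h_def
  proof (rule line_holomorphic_diff[OF holomorphic_several_line[OF hol[OF w]]], rule series_line_holomorphic)
    fix y assume y: "y \<in> \<Omega>"
    obtain e where e: "e > 0" "ball y e \<subseteq> \<Omega>" using \<Omega>(1) y open_contains_ball by blast
    define d where "d = e / (2 * real CARD('d))"
    have d: "d > 0" using e(1) by (simp add: d_def)
    \<comment> \<open>A point of \<open>\<Omega>\<close> all of whose coordinates have larger modulus than those of \<open>y\<close>.\<close>
    define v :: "complex ^ 'd" where "v = (\<chi> i. y $ i + of_real d * (if y $ i = 0 then 1 else sgn (y $ i)))"
    have vi: "norm (v $ i) = norm (y $ i) + d" for i
    proof (cases "y $ i = 0")
      case False
      then have "v $ i = sgn (y $ i) * of_real (norm (y $ i) + d)"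
        by (simp add: v_def sgn_div_norm scaleR_conv_of_real field_simps)
      then show ?thesis using False d by (simp add: norm_mult norm_sgn del: of_real_add)
    qed (use d in \<open>simp add: v_def\<close>)
    have "norm (v - y) \<le> (\<Sum>i\<in>UNIV. norm ((v - y) $ i))" by (simp add: norm_vec_def L2_set_le_sum)
    also have "\<dots> \<le> (\<Sum>i\<in>(UNIV :: 'd set). d)"
      using d by (intro sum_mono) (auto simp: v_def norm_mult norm_sgn)
    also have "\<dots> < e" using e(1) by (simp add: d_def)
    finally have "v \<in> ball y e" by (simp add: dist_norm norm_minus_commute)
    then have "v \<in> \<Omega>" using e(2) by auto
    from series_mixed_summable[OF w this]
    have "(\<lambda>b. cmod (C b) * (\<Prod>i\<in>UNIV. norm (v $ i) ^ (b $ i))) summable_on UNIV"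
      using c by (simp add: C_def norm_mult vec_monom_def norm_power abs_of_pos flip: prod_norm)
    moreover have "norm (y $ i) < norm (v $ i)" for i using vi[of i] d by simp
    ultimately show "\<exists>R. (\<forall>i. norm (y $ i) < R i) \<and> (\<lambda>b. cmod (C b) * (\<Prod>i\<in>UNIV. R i ^ (b $ i))) summable_on UNIV"
      by (intro exI[of _ "\<lambda>i. norm (v $ i)"]) auto
  qed
  moreover have "h y = 0" if y: "y \<in> ball 0 \<rho>" for y
  proof -
    have "((\<lambda>a. cnj (of_real (c a) * vec_monom w a * cnj (vec_monom y a))) has_sum cnj (f w y)) UNIV"
      unfolding has_sum_cnj_iff by (rule \<rho>(3)[OF y])
    then have "((\<lambda>b. C b * vec_monom y b) has_sum f y w) UNIV"
      using psd_hermitian[OF psd w \<rho>(2)[OF y]] by (simp add: C_def)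
    then show ?thesis by (simp add: h_def infsumI)
  qed
  ultimately have "h z = 0" using line_holomorphic_identity[OF \<Omega>(1,2) _ \<Omega>(3) \<rho>(1) _ z] by blast
  moreover have "(\<lambda>b. C b * vec_monom z b) summable_on UNIV"
    by (rule summable_comparison[OF series_mixed_summable[OF z w]]) (use c in \<open>auto simp: C_def norm_mult abs_of_pos\<close>)
  ultimately have "((\<lambda>b. C b * vec_monom z b) has_sum f z w) UNIV"
    unfolding h_def using has_sum_infsum by fastforce
  then show ?thesis by (rule has_sum_cong[THEN iffD1, rotated]) (simp add: C_def)
qed

end

text \<open>The sum of the norms is recorded because products of series are formed with it.\<close>

definition diag_series :: "(complex ^ 'd::finite) set \<Rightarrow> (nat ^ 'd \<Rightarrow> real) \<Rightarrow> (complex ^ 'd \<Rightarrow> complex ^ 'd \<Rightarrow> complex) \<Rightarrow> bool" where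
  "diag_series \<Omega> c f \<longleftrightarrow> (\<forall>z\<in>\<Omega>. \<forall>w\<in>\<Omega>.
     (\<lambda>a. norm (of_real (c a) * (vec_monom z a * cnj (vec_monom w a)))) summable_on UNIV \<and>
     ((\<lambda>a. of_real (c a) * (vec_monom z a * cnj (vec_monom w a))) has_sum f z w) UNIV)"

theorem diagonal_kernel_series:
  fixes \<Omega> :: "(complex ^ 'd::finite) set"
  assumes \<Omega>: "open \<Omega>" "connected \<Omega>" "0 \<in> \<Omega>" and f: "diagonal_holomorphic_kernel \<Omega> f"
  obtains c M where "\<And>a. 0 < c a" "diag_series \<Omega> c f" "(\<lambda>a. c a / real (weight a) ^ M) summable_on UNIV"
proof -
  have psd: "psd \<Omega> f" and hol: "\<And>w. w \<in> \<Omega> \<Longrightarrow> holomorphic_several \<Omega> (\<lambda>z. f z w)"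
    using f by (auto simp: diagonal_holomorphic_kernel_def psd_kernel_iff)
  obtain c r where c: "\<And>a. 0 < c a" and r: "0 < r" "ball 0 r \<subseteq> \<Omega>"
    and local: "\<And>z w. z \<in> ball 0 r \<Longrightarrow> w \<in> ball 0 r \<Longrightarrow>
      ((\<lambda>a. of_real (c a) * vec_monom z a * cnj (vec_monom w a)) has_sum f z w) UNIV"
    using f unfolding diagonal_holomorphic_kernel_def by blast
  note args = \<Omega> psd hol c r local
  have "diag_series \<Omega> c f"
    using series_global[OF args] series_mixed_summable[OF args] less_imp_le[OF c]
    by (auto simp: diag_series_def norm_mult mult.assoc)
  with c coeff_growth[OF args] that show thesis by blast
qed

section \<open>Products of diagonal power series\<close>

definition splits :: "nat ^ 'd::finite \<Rightarrow> ((nat ^ 'd) \<times> (nat ^ 'd)) set" where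
  "splits c = {(a, b). a + b = c}"

lemma finite_splits [simp]: "finite (splits (c :: nat ^ 'd::finite))"
proof (rule finite_subset)
  show "splits c \<subseteq> {a. weight a \<le> weight c} \<times> {b. weight b \<le> weight c}"
    by (auto simp: splits_def weight_add Suc_leI)
qed (intro finite_cartesian_product weight_finite)

definition conv :: "(nat ^ 'd::finite \<Rightarrow> real) \<Rightarrow> (nat ^ 'd \<Rightarrow> real) \<Rightarrow> nat ^ 'd \<Rightarrow> real" where
  "conv f g c = (\<Sum>(a, b)\<in>splits c. f a * g b)"

lemma conv_nonneg: "(\<And>a. 0 \<le> f a) \<Longrightarrow> (\<And>a. 0 \<le> g a) \<Longrightarrow> 0 \<le> conv f g c"
  by (auto simp: conv_def intro!: sum_nonneg)

lemma conv_cong: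
  "(\<And>a b. a + b = c \<Longrightarrow> f a * g b = f' a * g' b) \<Longrightarrow> conv f g c = conv f' g' c"
  unfolding conv_def by (intro sum.cong) (auto simp: splits_def)

lemma conv_scale: "conv (\<lambda>a. t * f a) g c = t * conv f g c"
  by (simp add: conv_def sum_distrib_left split_def mult.assoc)

lemma conv_0: "conv f g 0 = f 0 * g (0 :: nat ^ 'd::finite)"
proof -
  have "splits 0 = {(0, 0 :: nat ^ 'd)}" by (auto simp: splits_def Finite_Cartesian_Product.vec_eq_iff)
  then show ?thesis by (simp add: conv_def)
qed

lemma conv_split: "conv f g c = f c * g 0 + conv f (g(0 := 0)) c"
proof -
  have c: "splits c = insert (c, 0) (splits c - {(c, 0)})" by (auto simp: splits_def)
  have "conv f h c = f c * h 0 + (\<Sum>(a, b)\<in>splits c - {(c, 0)}. f a * h b)" for h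
    unfolding conv_def by (subst c, subst sum.insert) auto
  moreover have "(\<Sum>(a, b)\<in>splits c - {(c, 0)}. f a * g b) = (\<Sum>(a, b)\<in>splits c - {(c, 0)}. f a * (g(0 := 0)) b)"
    by (intro sum.cong) (auto simp: splits_def split: if_splits)
  ultimately show ?thesis by simp
qed

lemma conv_left_commute: "conv f (conv g h) m = conv g (conv f h) m"
proof -
  have expand: "conv f (conv g h) m = (\<Sum>(p, q)\<in>Sigma (splits m) (\<lambda>p. splits (snd p)). f (fst p) * (g (fst q) * h (snd q)))"
    for f g h :: "nat ^ 'a \<Rightarrow> real"
    by (simp add: conv_def sum_distrib_left split_def sum.Sigma)
  show ?thesis
    unfolding expand
    by (rule sum.reindex_bij_witness[where
          i = "\<lambda>(p, q). ((fst q, fst p + snd q), (fst p, snd q))" and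
          j = "\<lambda>(p, q). ((fst q, fst p + snd q), (fst p, snd q))"])
       (auto simp: splits_def add_ac mult_ac)
qed

text \<open>The Cauchy product. Monomials in \<open>z\<close> and \<open>w\<close> at given points are instances of \<open>m\<close>, and so are their norms and the powers of the
  weight.\<close>

lemma conv_has_sum:
  fixes m :: "nat ^ 'd::finite \<Rightarrow> 'b::{real_normed_field, banach}"
  assumes m: "\<And>a b. m (a + b) = m a * m b"
    and F: "(\<lambda>a. norm (of_real (f a) * m a)) summable_on UNIV" and G: "(\<lambda>a. norm (of_real (g a) * m a)) summable_on UNIV"
    and S: "((\<lambda>a. of_real (f a) * m a) has_sum S) UNIV" and T: "((\<lambda>a. of_real (g a) * m a) has_sum T) UNIV"
  shows "((\<lambda>c. of_real (conv f g c) * m c) has_sum S * T) UNIV"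
proof -
  define P where "P p = (of_real (f (fst p)) * m (fst p)) * (of_real (g (snd p)) * m (snd p))" for p
  have "(\<lambda>p. norm (P p)) summable_on UNIV \<times> UNIV"
  proof (rule summable_on_SigmaI)
    show "((\<lambda>b. norm (P (a, b))) has_sum norm (of_real (f a) * m a) * (\<Sum>\<^sub>\<infinity>b. norm (of_real (g b) * m b))) UNIV" for a
      unfolding P_def fst_conv snd_conv norm_mult[of "_ * m a"]
      by (rule has_sum_cmult_right[OF has_sum_infsum[OF G]])
    show "(\<lambda>a. norm (of_real (f a) * m a) * (\<Sum>\<^sub>\<infinity>b. norm (of_real (g b) * m b))) summable_on UNIV"
      by (rule summable_on_cmult_left[OF F])
  qed auto
  then have sm: "P summable_on UNIV \<times> UNIV" by (rule abs_summable_summable)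
  have "(P has_sum S * T) (UNIV \<times> UNIV)"
  proof (rule has_sum_SigmaI)
    show "((\<lambda>b. P (a, b)) has_sum of_real (f a) * m a * T) UNIV" for a
      unfolding P_def fst_conv snd_conv by (rule has_sum_cmult_right[OF T])
    show "((\<lambda>a. of_real (f a) * m a * T) has_sum S * T) UNIV" by (rule has_sum_cmult_left[OF S])
  qed (rule sm)
  moreover have "((\<lambda>q. P (snd q)) has_sum S * T) (Sigma UNIV splits) \<longleftrightarrow> (P has_sum S * T) (UNIV \<times> UNIV)"
    by (rule has_sum_reindex_bij_witness[where i = "\<lambda>p. (fst p + snd p, p)" and j = snd]) (auto simp: splits_def)
  ultimately have "((\<lambda>q. P (snd q)) has_sum S * T) (Sigma UNIV splits)" by blast
  then show ?thesis
  proof (rule has_sum_SigmaD)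
    fix c
    have "(\<Sum>p\<in>splits c. P p) = of_real (conv f g c) * m c"
      unfolding conv_def of_real_sum sum_distrib_right
      by (intro sum.cong refl) (auto simp: P_def splits_def m)
    then show "((\<lambda>p. P (snd (c, p))) has_sum of_real (conv f g c) * m c) (splits c)"
      by (metis (no_types, lifting) finite_splits has_sum_cong has_sum_finite snd_conv)
  qed
qed

lemma conv_summable:
  fixes f g m :: "nat ^ 'd::finite \<Rightarrow> real"
  assumes m: "\<And>a b. m (a + b) = m a * m b" "\<And>a. 0 \<le> m a" and nn: "\<And>a. 0 \<le> f a" "\<And>a. 0 \<le> g a"
    and s: "(\<lambda>a. f a * m a) summable_on UNIV" "(\<lambda>a. g a * m a) summable_on UNIV"
  shows "(\<lambda>a. conv f g a * m a) summable_on UNIV"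
  using conv_has_sum[OF m(1), of f g "\<Sum>\<^sub>\<infinity>a. f a * m a" "\<Sum>\<^sub>\<infinity>a. g a * m a"] s m(2) nn
  by (auto dest: has_sum_imp_summable)

section \<open>Testing a complete Pick pair on coefficients\<close>

lemma vec_monom_0: "vec_monom 0 a = (if a = 0 then 1 else 0)"
proof (cases "a = 0")
  case True
  then show ?thesis by (simp add: vec_monom_def)
next
  case False
  then obtain i where "a $ i \<noteq> 0" by (auto simp: Finite_Cartesian_Product.vec_eq_iff)
  then show ?thesis using False by (auto simp: vec_monom_def intro!: bexI[of _ i])
qed

lemma vec_monom_add: "vec_monom z (a + b) = vec_monom z a * vec_monom z b"
  by (simp add: vec_monom_def power_add prod.distrib)

lemma diag_series_zero:
  assumes f: "diag_series \<Omega> c f" and "z \<in> \<Omega>" "0 \<in> \<Omega>"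
  shows "f z 0 = of_real (c 0)" "f 0 z = of_real (c 0)"
proof -
  have 1: "((\<lambda>a. of_real (c a) * (vec_monom z a * cnj (vec_monom 0 a))) has_sum of_real (c 0)) UNIV"
    by (rule has_sum_finite_neutralI[of "{0}"]) (auto simp: vec_monom_0 vec_monom_def[of z])
  have 2: "((\<lambda>a. of_real (c a) * (vec_monom 0 a * cnj (vec_monom z a))) has_sum of_real (c 0)) UNIV"
    by (rule has_sum_finite_neutralI[of "{0}"]) (auto simp: vec_monom_0 vec_monom_def[of z])
  show "f z 0 = of_real (c 0)" "f 0 z = of_real (c 0)"
    using f assms(2,3) has_sum_unique[OF _ 1] has_sum_unique[OF _ 2] unfolding diag_series_def by blast+
qed

lemma diag_series_conv:
  assumes c: "diag_series \<Omega> c f" "diag_series \<Omega> c' g" and nn: "\<And>a. 0 \<le> c a" "\<And>a. 0 \<le> c' a"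
  shows "diag_series \<Omega> (conv c c') (\<lambda>z w. f z w * g z w)"
  unfolding diag_series_def
proof (intro ballI conjI)
  fix z w assume zw: "z \<in> \<Omega>" "w \<in> \<Omega>"
  let ?m = "\<lambda>a. vec_monom z a * cnj (vec_monom w a)"
  show "((\<lambda>a. of_real (conv c c' a) * ?m a) has_sum f z w * g z w) UNIV"
    by (rule conv_has_sum) (use c zw in \<open>auto simp: diag_series_def vec_monom_add\<close>)
  have "(\<lambda>a. conv c c' a * norm (?m a)) summable_on UNIV"
    by (rule conv_summable) (use c nn zw in \<open>auto simp: diag_series_def vec_monom_add norm_mult\<close>)
  then show "(\<lambda>a. norm (of_real (conv c c' a) * ?m a)) summable_on UNIV"
    using conv_nonneg[of c c'] nn by (simp add: norm_mult)
qed

lemma diag_series_finite: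
  assumes "finite L" "\<And>a. a \<notin> L \<Longrightarrow> x a = 0"
  shows "diag_series \<Omega> x (\<lambda>z w. \<Sum>a\<in>L. of_real (x a) * (vec_monom z a * cnj (vec_monom w a)))"
  unfolding diag_series_def
proof (intro ballI conjI)
  fix z w
  show "(\<lambda>a. norm (of_real (x a) * (vec_monom z a * cnj (vec_monom w a)))) summable_on UNIV"
    by (rule summable_on_cong_neutral[THEN iffD1, OF _ _ _ summable_on_finite[OF assms(1)]]) (use assms(2) in auto)
  show "((\<lambda>a. of_real (x a) * (vec_monom z a * cnj (vec_monom w a))) has_sum
      (\<Sum>a\<in>L. of_real (x a) * (vec_monom z a * cnj (vec_monom w a)))) UNIV"
    by (rule has_sum_finite_neutralI[OF assms(1)]) (use assms(2) in auto)
qed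

lemma diag_series_diff:
  assumes "diag_series \<Omega> c f" "diag_series \<Omega> c' g"
  shows "diag_series \<Omega> (\<lambda>a. c a - c' a) (\<lambda>z w. f z w - g z w)"
  unfolding diag_series_def
proof (intro ballI conjI)
  fix z w assume zw: "z \<in> \<Omega>" "w \<in> \<Omega>"
  let ?m = "\<lambda>a. vec_monom z a * cnj (vec_monom w a)"
  have "((\<lambda>a. of_real (c a) * ?m a + - (of_real (c' a) * ?m a)) has_sum f z w + - g z w) UNIV"
    using assms zw by (intro has_sum_add has_sum_uminusI) (auto simp: diag_series_def)
  then show "((\<lambda>a. of_real (c a - c' a) * ?m a) has_sum f z w - g z w) UNIV"
    by (simp add: left_diff_distrib)
  have "(\<lambda>a. norm (of_real (c a) * ?m a) + norm (of_real (c' a) * ?m a)) summable_on UNIV"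
    using assms zw by (intro summable_on_add) (auto simp: diag_series_def)
  then show "(\<lambda>a. norm (of_real (c a - c' a) * ?m a)) summable_on UNIV"
    by (rule Infinite_Sum.abs_summable_on_comparison_test') (simp add: left_diff_distrib norm_triangle_ineq4)
qed

lemma diag_series_scale:
  assumes "diag_series \<Omega> c f"
  shows "diag_series \<Omega> (\<lambda>a. t * c a) (\<lambda>z w. of_real t * f z w)"
  unfolding diag_series_def
proof (intro ballI conjI)
  fix z w assume zw: "z \<in> \<Omega>" "w \<in> \<Omega>"
  let ?m = "\<lambda>a. vec_monom z a * cnj (vec_monom w a)"
  show "((\<lambda>a. of_real (t * c a) * ?m a) has_sum of_real t * f z w) UNIV"
    unfolding of_real_mult mult.assoc using assms zw by (intro has_sum_cmult_right) (auto simp: diag_series_def)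
  show "(\<lambda>a. norm (of_real (t * c a) * ?m a)) summable_on UNIV"
    unfolding of_real_mult mult.assoc norm_mult[of "of_real t"]
    using assms zw by (intro summable_on_cmult_right) (auto simp: diag_series_def)
qed

lemma diag_series_add:
  assumes "diag_series \<Omega> c f" "diag_series \<Omega> c' g"
  shows "diag_series \<Omega> (\<lambda>a. c a + c' a) (\<lambda>z w. f z w + g z w)"
  using diag_series_diff[OF assms(1) diag_series_scale[OF assms(2), of "-1"]] by simp

lemma diag_series_const: "diag_series \<Omega> (\<lambda>a. if a = 0 then t else 0) (\<lambda>z w. of_real t)"
  using diag_series_finite[of "{0}" "\<lambda>a. if a = 0 then t else 0" \<Omega>] by (simp add: vec_monom_def)

text \<open>A diagonal form with positive coefficients up to the weight \<open>\<mu>\<close> is positive semi-definite on as many points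
  of the curve as there are such coefficients, once the points are close enough to \<open>0\<close>: the values of the polynomial at
  the weights up to \<open>\<mu>\<close> control those at larger ones, where the monomials are much smaller.\<close>

lemma weight_form_eventually_nonneg:
  fixes \<kappa> :: "nat ^ 'd::finite \<Rightarrow> real"
  assumes mu: "1 \<le> \<mu>" and M: "(\<lambda>b. \<bar>\<kappa> b\<bar> / real (weight b) ^ M) summable_on UNIV"
    and pos: "\<And>a. weight a \<le> \<mu> \<Longrightarrow> 0 < \<kappa> a"
  shows "\<exists>T. \<forall>t\<ge>T. \<forall>q S.
     ((\<lambda>b. of_real (\<kappa> b) * (1 / of_nat (weight b)) ^ (2 * t) *
        complex_of_real ((cmod (poly_val (card {a :: nat ^ 'd. weight a \<le> \<mu>}) q (weight b)))\<^sup>2)) has_sum S) UNIV \<longrightarrow> 0 \<le> S"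
proof -
  define L where "L = {a :: nat ^ 'd. weight a \<le> \<mu>}"
  have L: "finite L" unfolding L_def by (rule weight_finite)
  have L0: "0 \<in> L" using mu by (simp add: L_def)
  define A where "A = weight ` L"
  define n where "n = card L"
  have nA: "card A = n" unfolding A_def n_def by (intro card_image inj_on_subset[OF weight_inj]) auto
  have n0: "0 < n" using L L0 by (auto simp: n_def card_gt_0_iff)
  obtain C where C: "C \<ge> 0" "\<And>q x. 1 \<le> x \<Longrightarrow> cmod (poly_val n q x) \<le> C * real x ^ n * (\<Sum>y\<in>A. cmod (poly_val n q y))"
    using interpolation_growth[of A] L unfolding nA by (auto simp: A_def)
  define k0 where "k0 = Min (\<kappa> ` L)"
  have "k0 \<in> \<kappa> ` L" unfolding k0_def by (rule Min_in) (use L L0 in auto)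
  then have k0: "0 < k0" "\<And>a. a \<in> L \<Longrightarrow> k0 \<le> \<kappa> a"
    using L pos by (auto simp: k0_def L_def)
  define u where "u b = \<bar>\<kappa> b\<bar> * real (weight b) ^ (2 * n)" for b
  have us: "(\<lambda>b. u b / real (weight b) ^ (M + 2 * n)) summable_on UNIV"
    by (rule summable_on_cong[THEN iffD1, OF _ M]) (simp add: u_def power_add)
  have u0: "0 \<le> u b" for b by (simp add: u_def)
  let ?B = "{b :: nat ^ 'd. \<mu> < weight b}"
  note tail = weighted_tail[OF us u0 mu]
  have "\<forall>\<^sub>F t in sequentially. (\<Sum>\<^sub>\<infinity>b\<in>?B. u b * (real \<mu> / real (weight b)) ^ t) < k0 / (real n * (C\<^sup>2 + 1))"
    by (rule order_tendstoD(2)[OF tail(2)]) (use k0 n0 in \<open>auto intro!: divide_pos_pos mult_pos_pos add_nonneg_pos\<close>)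
  then obtain T0 where T0: "\<And>t. t \<ge> T0 \<Longrightarrow> (\<Sum>\<^sub>\<infinity>b\<in>?B. u b * (real \<mu> / real (weight b)) ^ t) < k0 / (real n * (C\<^sup>2 + 1))"
    by (auto simp: eventually_sequentially)
  have "0 \<le> S" if t: "t \<ge> max T0 (M + 2 * n)"
    and S: "((\<lambda>b. \<kappa> b * (1 / real (weight b)) ^ (2 * t) * (cmod (poly_val n q (weight b)))\<^sup>2) has_sum S) UNIV" for t q S
  proof -
    define R where "R b = \<kappa> b * (1 / real (weight b)) ^ (2 * t) * (cmod (poly_val n q (weight b)))\<^sup>2" for b
    define s where "s = (\<Sum>a\<in>L. cmod (poly_val n q (weight a)))"
    have sA: "(\<Sum>y\<in>A. cmod (poly_val n q y)) = s"
      unfolding A_def s_def by (subst sum.reindex) (auto intro: inj_on_subset[OF weight_inj])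
    define \<epsilon> where "\<epsilon> = (1 / real \<mu>) ^ (2 * t)"
    have \<epsilon>: "0 < \<epsilon>" using mu by (simp add: \<epsilon>_def)
    have RS: "(R has_sum S) UNIV" using S by (simp add: R_def[abs_def])
    have RB: "R summable_on ?B" by (rule summable_on_subset[OF has_sum_imp_summable[OF RS]]) auto
    have "S = (\<Sum>a\<in>L. R a) + infsum R ?B"
    proof -
      have "infsum R (L \<union> ?B) = infsum R L + infsum R ?B"
        by (rule infsum_Un_disjoint) (use L RB in \<open>auto simp: L_def\<close>)
      moreover have "L \<union> ?B = UNIV" by (auto simp: L_def)
      ultimately show ?thesis using infsumI[OF RS] L by simp
    qed
    moreover have "k0 * \<epsilon> * (s\<^sup>2 / real n) \<le> (\<Sum>a\<in>L. R a)"
    proof -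
      have "s\<^sup>2 \<le> (\<Sum>a\<in>L. (cmod (poly_val n q (weight a)))\<^sup>2) * real n"
        unfolding s_def n_def by (rule sum_squared_le_sum_of_squares)
      then have "k0 * \<epsilon> * (s\<^sup>2 / real n) \<le> k0 * \<epsilon> * (\<Sum>a\<in>L. (cmod (poly_val n q (weight a)))\<^sup>2)"
        using n0 k0 \<epsilon> by (intro mult_left_mono) (auto simp: divide_le_eq)
      also have "\<dots> \<le> (\<Sum>a\<in>L. R a)"
        unfolding sum_distrib_left R_def
      proof (intro sum_mono mult_right_mono mult_mono)
        fix a assume a: "a \<in> L"
        show "k0 \<le> \<kappa> a" by (rule k0(2)[OF a])
        show "0 \<le> \<kappa> a" using k0(1) k0(2)[OF a] by linarith
        show "\<epsilon> \<le> (1 / real (weight a)) ^ (2 * t)"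
          unfolding \<epsilon>_def using a mu by (intro power_mono divide_left_mono mult_pos_pos) (auto simp: L_def)
      qed (use \<epsilon> in auto)
      finally show ?thesis .
    qed
    moreover have "\<bar>infsum R ?B\<bar> \<le> k0 * \<epsilon> * (s\<^sup>2 / real n)"
    proof -
      have bound: "\<bar>R b\<bar> \<le> (C\<^sup>2 * s\<^sup>2 * \<epsilon>) * (u b * (real \<mu> / real (weight b)) ^ t)" if b: "b \<in> ?B" for b
      proof -
        have "cmod (poly_val n q (weight b)) \<le> C * real (weight b) ^ n * s"
          using C(2)[of "weight b" q] weight_pos[of b] by (simp add: sA Suc_leI)
        then have "(cmod (poly_val n q (weight b)))\<^sup>2 \<le> (C * real (weight b) ^ n * s)\<^sup>2" by (intro power_mono) auto
        then have "\<bar>R b\<bar> \<le> \<bar>\<kappa> b\<bar> * (1 / real (weight b)) ^ (2 * t) * (C * real (weight b) ^ n * s)\<^sup>2"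
          unfolding R_def abs_mult by (intro mult_mono) auto
        also have "\<dots> = (C\<^sup>2 * s\<^sup>2 * \<epsilon>) * (u b * (real \<mu> / real (weight b)) ^ (2 * t))"
          using mu by (simp add: u_def \<epsilon>_def power_divide power_mult_distrib mult_ac flip: power_mult)
        also have "\<dots> \<le> (C\<^sup>2 * s\<^sup>2 * \<epsilon>) * (u b * (real \<mu> / real (weight b)) ^ t)"
          using b u0 \<epsilon> by (intro mult_left_mono power_decreasing) auto
        finally show ?thesis .
      qed
      have sm: "(\<lambda>b. (C\<^sup>2 * s\<^sup>2 * \<epsilon>) * (u b * (real \<mu> / real (weight b)) ^ t)) summable_on ?B"
        by (intro summable_on_cmult_right tail(1)) (use t in auto)
      have "\<bar>infsum R ?B\<bar> \<le> (\<Sum>\<^sub>\<infinity>b\<in>?B. \<bar>R b\<bar>)"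
        using norm_infsum_bound[of R ?B] Infinite_Sum.abs_summable_on_comparison_test'[OF sm, of R] bound by simp
      also have "\<dots> \<le> (\<Sum>\<^sub>\<infinity>b\<in>?B. (C\<^sup>2 * s\<^sup>2 * \<epsilon>) * (u b * (real \<mu> / real (weight b)) ^ t))"
        using Infinite_Sum.abs_summable_on_comparison_test'[OF sm, of R] bound by (intro infsum_mono sm) auto
      also have "\<dots> = C\<^sup>2 * s\<^sup>2 * \<epsilon> * (\<Sum>\<^sub>\<infinity>b\<in>?B. u b * (real \<mu> / real (weight b)) ^ t)" by (rule infsum_cmult_right')
      also have "\<dots> \<le> C\<^sup>2 * s\<^sup>2 * \<epsilon> * (k0 / (real n * (C\<^sup>2 + 1)))"
        using T0[of t] t \<epsilon> by (intro mult_left_mono) auto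
      also have "\<dots> = (s\<^sup>2 * \<epsilon> * (k0 / real n)) * (C\<^sup>2 / (C\<^sup>2 + 1))" by simp
      also have "\<dots> \<le> (s\<^sup>2 * \<epsilon> * (k0 / real n)) * 1"
        using k0 \<epsilon> n0 by (intro mult_left_mono) (auto simp: divide_le_eq add_nonneg_pos)
      finally show ?thesis by (simp add: mult_ac)
    qed
    ultimately show ?thesis by linarith
  qed
  then have real: "0 \<le> S" if "t \<ge> max T0 (M + 2 * n)"
    "((\<lambda>b. \<kappa> b * (1 / real (weight b)) ^ (2 * t) * (cmod (poly_val n q (weight b)))\<^sup>2) has_sum S) UNIV" for t q S
    using that by blast
  have "0 \<le> S" if t: "t \<ge> max T0 (M + 2 * n)"
    and S: "((\<lambda>b. of_real (\<kappa> b) * (1 / of_nat (weight b)) ^ (2 * t) * complex_of_real ((cmod (poly_val n q (weight b)))\<^sup>2)) has_sum S) UNIV" for t q S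
  proof -
    have S': "((\<lambda>b. complex_of_real (\<kappa> b * (1 / real (weight b)) ^ (2 * t) * (cmod (poly_val n q (weight b)))\<^sup>2)) has_sum S) UNIV"
      using S by simp
    have "((\<lambda>b :: nat ^ 'd. 0 :: real) has_sum Im S) UNIV" using has_sum_Im[OF S'] unfolding Im_complex_of_real .
    then have "Im S = 0" by (rule has_sum_unique[OF _ has_sum_0]) simp
    moreover have "0 \<le> Re S" using has_sum_Re[OF S'] unfolding Re_complex_of_real by (rule real[OF t])
    ultimately show ?thesis by (simp add: less_eq_complex_def)
  qed
  then show ?thesis unfolding n_def L_def by blast
qed

text \<open>There are \<open>n\<close> indices of weight less than that of \<open>m\<close>, and by assumption the coefficients of \<open>l - \<Xi> k\<close> are positive at all
  of these. So this kernel is positive semi-definite on \<open>n\<close> points of the curve near \<open>0\<close>. Extending the row data to the base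
  point \<open>0\<close> shows that \<open>l\<^sup>0 - k\<^sup>0 \<Xi>\<close> is positive there as well. As its constant term is \<open>0\<close>, only \<open>n - 1\<close> coefficients
  come before that of \<open>m\<close>, so that \<open>n\<close> points suffice to single out the latter; and it is that of \<open>l - \<Xi> k\<close>, since \<open>x\<close>
  vanishes at \<open>m\<close>.\<close>

lemma coefficient_test_strict:
  fixes \<Omega> :: "(complex ^ 'd::finite) set"
  assumes pick: "complete_pick_pair \<Omega> k l" and r: "0 < r" "ball 0 r \<subseteq> \<Omega>" and pos: "\<And>a. 0 < ck a" "\<And>a. 0 < cl a"
    and k: "diag_series \<Omega> ck k" and l: "diag_series \<Omega> cl l"
    and Mk: "(\<lambda>b. ck b / real (weight b) ^ M) summable_on UNIV" and Ml: "(\<lambda>b. cl b / real (weight b) ^ M) summable_on UNIV"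
    and m: "m \<noteq> 0" and x0: "\<And>a. 0 \<le> x a" and x: "\<And>a. weight m \<le> weight a \<Longrightarrow> x a = 0"
    and lt: "\<And>a. weight a < weight m \<Longrightarrow> conv x ck a < cl a"
  shows "conv x ck m \<le> cl m"
proof -
  define \<mu> where "\<mu> = weight m - 1"
  have m1: "1 < weight m"
    using m weight_eq_iff[of m 0] weight_pos[of m] by (metis Suc_lessI One_nat_def weight_0)
  then have mu: "1 \<le> \<mu>" "Suc \<mu> = weight m" by (auto simp: \<mu>_def)
  have le_iff: "weight a \<le> \<mu> \<longleftrightarrow> weight a < weight m" for a :: "nat ^ 'd" using mu(2) by linarith
  define L where "L = {a :: nat ^ 'd. weight a \<le> \<mu>}"
  have L: "finite L" unfolding L_def by (rule weight_finite)
  have mL: "m \<notin> L" "0 \<in> L" using mu by (auto simp: L_def)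
  define n where "n = card L"
  define \<Xi> where "\<Xi> z w = (\<Sum>a\<in>L. of_real (x a) * (vec_monom z a * cnj (vec_monom w a)))" for z w :: "complex ^ 'd"
  have \<Xi>: "psd X \<Xi>" for X
    unfolding \<Xi>_def by (intro psd_sum psd_scale psd_rank_one) (use x0 in \<open>auto simp: less_eq_complex_def\<close>)
  have x\<Xi>: "diag_series \<Omega> x \<Xi>"
    unfolding \<Xi>_def by (rule diag_series_finite[OF L]) (use x le_iff in \<open>auto simp: L_def not_less\<close>)
  have ck\<Xi>: "diag_series \<Omega> (conv x ck) (\<lambda>z w. \<Xi> z w * k z w)" 
    by (rule diag_series_conv[OF x\<Xi> k]) (use x0 pos in \<open>auto intro: less_imp_le\<close>)
  have ck0: "0 < ck 0" and cl0: "0 < cl 0" by (rule pos)+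
  have Mc: "(\<lambda>b. conv x ck b / real (weight b) ^ M) summable_on UNIV"
  proof -
    have "(\<lambda>b. x b * (1 / real (weight b) ^ M)) summable_on UNIV"
      by (rule has_sum_imp_summable[OF has_sum_finite_neutralI[OF L _ _ refl]]) (use x in \<open>auto simp: L_def le_iff\<close>)
    then have "(\<lambda>b. conv x ck b * (1 / real (weight b) ^ M)) summable_on UNIV"
      by (rule conv_summable[rotated 4]) (use Mk x0 pos in \<open>auto simp: weight_add power_mult_distrib intro: less_imp_le\<close>)
    then show ?thesis by simp
  qed
  have O: "0 \<in> \<Omega>" using r by auto
  have val: "((\<lambda>b. of_real (c b) * (1 / of_nat (weight b)) ^ s * (1 / of_nat (weight b)) ^ s') has_sum f (weight_pt s) (weight_pt s')) UNIV"
    if f: "diag_series \<Omega> c f" and p: "weight_pt s \<in> \<Omega>" "weight_pt s' \<in> \<Omega>" for c f s s'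
  proof -
    have "((\<lambda>a. of_real (c a) * (vec_monom (weight_pt s) a * cnj (vec_monom (weight_pt s') a))) has_sum f (weight_pt s) (weight_pt s')) UNIV"
      using f p by (auto simp: diag_series_def)
    then show ?thesis by (rule has_sum_cong[THEN iffD1, rotated]) (simp add: vec_monom_weight_pt)
  qed
  have form: "((\<lambda>b. of_real (c b) * (1 / of_nat (weight b)) ^ (2 * t) * of_real ((cmod (poly_val n q (weight b)))\<^sup>2))
      has_sum herm_form {..<n} (\<lambda>i j. f (weight_pt (t - i)) (weight_pt (t - j))) q q) UNIV"
    if f: "diag_series \<Omega> c f" and p: "\<And>i. i < n \<Longrightarrow> weight_pt (t - i) \<in> \<Omega>" and t: "n \<le> t" for c f t q
    by (rule weight_form[OF val[OF f p p] t])
  \<comment> \<open>The data given by \<open>\<Xi>\<close> are admissible at \<open>n\<close> points of the curve near \<open>0\<close>.\<close>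
  define \<kappa> where "\<kappa> a = cl a - conv x ck a" for a
  have \<kappa>s: "diag_series \<Omega> \<kappa> (\<lambda>z w. l z w - \<Xi> z w * k z w)"
    unfolding \<kappa>_def by (rule diag_series_diff[OF l ck\<Xi>])
  have M\<kappa>: "(\<lambda>b. \<bar>\<kappa> b\<bar> / real (weight b) ^ M) summable_on UNIV"
  proof (rule summable_comparison[OF summable_on_add[OF Ml Mc]])
    have "\<bar>\<kappa> b\<bar> \<le> cl b + conv x ck b" for b
      using pos(2)[of b] conv_nonneg[of x ck b, OF x0 less_imp_le[OF pos(1)]] unfolding \<kappa>_def by linarith
    then show "norm (\<bar>\<kappa> b\<bar> / real (weight b) ^ M) \<le> cl b / real (weight b) ^ M + conv x ck b / real (weight b) ^ M" for b
      unfolding add_divide_distrib[symmetric] by (simp add: divide_right_mono)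
  qed
  obtain T1 where T1: "\<And>t q S. t \<ge> T1 \<Longrightarrow>
     ((\<lambda>b. of_real (\<kappa> b) * (1 / of_nat (weight b)) ^ (2 * t) * complex_of_real ((cmod (poly_val n q (weight b)))\<^sup>2)) has_sum S) UNIV \<Longrightarrow> 0 \<le> S"
  proof -
    have "0 < \<kappa> a" if "weight a \<le> \<mu>" for a using lt[of a] that le_iff by (simp add: \<kappa>_def)
    from weight_form_eventually_nonneg[OF mu(1) M\<kappa> this] show ?thesis using that unfolding n_def L_def by blast
  qed
  obtain t1 where t1: "\<And>t. t \<ge> t1 \<Longrightarrow> weight_pt t \<in> ball (0 :: complex ^ 'd) r" using weight_pt_small[OF r(1)] by blast
  define T where "T = max T1 (t1 + n)"
  have pt: "weight_pt (t - i) \<in> \<Omega>" if "t \<ge> T" "i < n" for t i using t1[of "t - i"] r(2) that by (auto simp: T_def)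
  \<comment> \<open>Extending the data to \<open>0\<close> gives positivity of the reduced kernels, with coefficients \<open>\<theta>\<close>.\<close>
  define \<theta> where "\<theta> b = \<kappa> b - (if b = 0 then cl 0 else 0) + ck 0 * x b" for b
  have ext: "psd {..<n} (\<lambda>i j. (l (weight_pt (t - i)) (weight_pt (t - j)) - of_real (cl 0)) -
       (k (weight_pt (t - i)) (weight_pt (t - j)) - of_real (ck 0)) * \<Xi> (weight_pt (t - i)) (weight_pt (t - j)))"
    if t: "t \<ge> T" for t
  proof -
    define w where "w i = (weight_pt (t - i) :: complex ^ 'd)" for i
    define S where "S = w ` {..<n}"
    have S: "finite S" "S \<subseteq> \<Omega>" using pt[OF t] by (auto simp: S_def w_def)
    have tn: "n \<le> t" using t by (auto simp: T_def)
    have "psd {..<n} (\<lambda>i j. l (w i) (w j) - \<Xi> (w i) (w j) * k (w i) (w j))"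
      unfolding psd_finite_iff[OF finite_lessThan]
    proof
      fix q
      have "t \<ge> T1" using t by (simp add: T_def)
      then show "0 \<le> herm_form {..<n} (\<lambda>i j. l (w i) (w j) - \<Xi> (w i) (w j) * k (w i) (w j)) q q"
        unfolding w_def by (rule T1) (rule form[OF \<kappa>s pt[OF t] tn])
    qed
    then have "psd S (\<lambda>y y'. l (w (inv_into {..<n} w y)) (w (inv_into {..<n} w y')) -
        \<Xi> (w (inv_into {..<n} w y)) (w (inv_into {..<n} w y')) * k (w (inv_into {..<n} w y)) (w (inv_into {..<n} w y')))"
      by (rule psd_pullback) (use inv_into_into[of _ w "{..<n}"] in \<open>auto simp: S_def\<close>)
    then have "psd S (\<lambda>y y'. l y y' - k y y' * \<Xi> y y')"
      by (rule psd_cong[THEN iffD1, rotated]) (auto simp: S_def f_inv_into_f mult.commute)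
    from row_extension[OF pick S O \<Xi> this]
    have "psd {..<n} (\<lambda>i j. schur_compl l 0 (w i) (w j) - schur_compl k 0 (w i) (w j) * \<Xi> (w i) (w j))"
      by (rule psd_pullback) (auto simp: S_def)
    then show ?thesis
    proof (rule psd_cong[THEN iffD1, rotated])
      fix i j assume "i \<in> {..<n}" "j \<in> {..<n}"
      then have ij: "w i \<in> \<Omega>" "w j \<in> \<Omega>" using pt[OF t] by (auto simp: w_def)
      show "schur_compl l 0 (w i) (w j) - schur_compl k 0 (w i) (w j) * \<Xi> (w i) (w j) =
          (l (weight_pt (t - i)) (weight_pt (t - j)) - of_real (cl 0)) -
          (k (weight_pt (t - i)) (weight_pt (t - j)) - of_real (ck 0)) * \<Xi> (weight_pt (t - i)) (weight_pt (t - j))"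
        using cl0 ck0 unfolding schur_compl_def diag_series_zero[OF l ij(1) O] diag_series_zero[OF l ij(2) O] diag_series_zero[OF l O O]
          diag_series_zero[OF k ij(1) O] diag_series_zero[OF k ij(2) O] diag_series_zero[OF k O O] by (simp add: w_def)
    qed
  qed
  have \<theta>s: "diag_series \<Omega> \<theta> (\<lambda>z w. (l z w - of_real (cl 0)) - (k z w - of_real (ck 0)) * \<Xi> z w)"
    using diag_series_add[OF diag_series_diff[OF \<kappa>s diag_series_const[of \<Omega> "cl 0"]] diag_series_scale[OF x\<Xi>, of "ck 0"]]
    by (simp add: \<theta>_def[abs_def] algebra_simps)
  \<comment> \<open>This is tested on the functional that singles out the coefficient of \<open>m\<close>.\<close>
  define I where "I = insert m L - {0}"
  have I: "I \<subseteq> {a. weight a \<le> weight m}" "finite I" "m \<in> I" "0 \<notin> I"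
    using L m by (auto simp: I_def L_def le_iff)
  have cI: "n = card I" using mL L m by (simp add: I_def n_def card_Diff_singleton)
  have M\<theta>: "(\<lambda>b. \<bar>\<theta> b\<bar> / real (weight b) ^ M) summable_on UNIV"
  proof (rule summable_comparison)
    have "finite (insert 0 L)" using L by simp
    then have "(\<lambda>b. ((if b = 0 then cl 0 else 0) + ck 0 * x b) / real (weight b) ^ M) summable_on UNIV"
      by (rule has_sum_imp_summable[OF has_sum_finite_neutralI[OF _ _ _ refl]]) (use x mL in \<open>auto simp: L_def le_iff\<close>)
    then show "(\<lambda>b. \<bar>\<kappa> b\<bar> / real (weight b) ^ M + ((if b = 0 then cl 0 else 0) + ck 0 * x b) / real (weight b) ^ M) summable_on UNIV"
      by (intro summable_on_add M\<kappa>)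
    show "norm (\<bar>\<theta> b\<bar> / real (weight b) ^ M) \<le> \<bar>\<kappa> b\<bar> / real (weight b) ^ M + ((if b = 0 then cl 0 else 0) + ck 0 * x b) / real (weight b) ^ M" for b
    proof -
      have "0 \<le> ck 0 * x b" using ck0 x0 by simp
      then have "\<bar>\<theta> b\<bar> \<le> \<bar>\<kappa> b\<bar> + ((if b = 0 then cl 0 else 0) + ck 0 * x b)" using cl0 unfolding \<theta>_def by (auto simp: abs_if)
      then show ?thesis unfolding add_divide_distrib[symmetric] by (simp add: divide_right_mono)
    qed
  qed
  have "(cmod (\<Sum>a\<in>I. 0 * (if a = m then 1 else 0)))\<^sup>2 \<le> (\<Sum>a\<in>I. \<theta> a * (cmod (if a = m then 1 else 0))\<^sup>2)"
  proof (rule coefficient_form_nonneg[OF _ I(1) cI _ M\<theta>])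
    show "\<theta> a = 0 \<and> (0 :: complex) = 0" if a: "weight a \<le> weight m" "a \<notin> I" for a
    proof -
      have "a = m \<or> weight a < weight m" using a(1) by (simp flip: weight_eq_iff add: le_less disj_commute)
      then have "a = 0" using a(2) m le_iff by (auto simp: I_def L_def)
      then show ?thesis by (simp add: \<theta>_def \<kappa>_def conv_0)
    qed
    fix t and q :: "nat \<Rightarrow> complex" assume t: "t \<ge> T"
    then have tn: "n \<le> t" by (auto simp: T_def)
    let ?D = "\<lambda>b. of_real (\<theta> b) * (1 / of_nat (weight b)) ^ (2 * t) * complex_of_real ((cmod (poly_val n q (weight b)))\<^sup>2)"
    note D = form[OF \<theta>s pt[OF t] tn, of q]
    have "0 \<le> infsum ?D UNIV"
      by (simp only: infsumI[OF D] psdD[OF ext[OF t] finite_lessThan order_refl])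
    then have "0 \<le> Re (infsum ?D UNIV)" by (simp only: less_eq_complex_def zero_complex.sel)
    then show "(cmod (\<Sum>\<^sub>\<infinity>b :: nat ^ 'd. 0 * (1 / of_nat (weight b)) ^ t * poly_val n q (weight b)))\<^sup>2 \<le> Re (infsum ?D UNIV)"
      by (simp only: mult_zero_left infsum_0_simp norm_zero zero_power2)
  qed (use m1 in auto)
  also have "(\<Sum>a\<in>I. \<theta> a * (cmod (if a = m then 1 else 0))\<^sup>2) = (\<Sum>a\<in>I. if a = m then \<theta> m else 0)"
    by (intro sum.cong) auto
  finally have "0 \<le> \<theta> m" using I(2,3) by simp
  then show ?thesis using m x[of m] by (simp add: \<theta>_def \<kappa>_def)
qed

text \<open>Scaling \<open>x\<close> by factors less than \<open>1\<close> makes the inequalities strict.\<close>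

lemma coefficient_test:
  fixes \<Omega> :: "(complex ^ 'd::finite) set"
  assumes pick: "complete_pick_pair \<Omega> k l" and r: "0 < r" "ball 0 r \<subseteq> \<Omega>" and pos: "\<And>a. 0 < ck a" "\<And>a. 0 < cl a"
    and k: "diag_series \<Omega> ck k" and l: "diag_series \<Omega> cl l"
    and Mk: "(\<lambda>b. ck b / real (weight b) ^ M) summable_on UNIV" and Ml: "(\<lambda>b. cl b / real (weight b) ^ M) summable_on UNIV"
    and x0: "\<And>a. 0 \<le> x a" and x: "\<And>a. weight m \<le> weight a \<Longrightarrow> x a = 0"
    and le: "\<And>a. weight a < weight m \<Longrightarrow> conv x ck a \<le> cl a"
  shows "conv x ck m \<le> cl m"
proof (cases "m = 0")
  case True
  then have "x a = 0" for a using x[of a] weight_pos[of a] by (simp add: Suc_leI)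
  then show ?thesis using pos(2)[of m] by (simp add: conv_def split_def)
next
  case False
  show ?thesis
  proof (rule field_le_mult_one_interval)
    fix t :: real assume t: "0 < t" "t < 1"
    have "conv (\<lambda>a. t * x a) ck m \<le> cl m"
    proof (rule coefficient_test_strict[OF pick r pos k l Mk Ml False])
      fix a :: "nat ^ 'd" assume "weight a < weight m"
      then have "t * conv x ck a \<le> t * cl a" using t le by simp
      also have "\<dots> < cl a" using t pos(2)[of a] by simp
      finally show "conv (\<lambda>a. t * x a) ck a < cl a" by (simp add: conv_scale)
    qed (use t x0 x in auto)
    then show "t * conv x ck m \<le> cl m" by (simp add: conv_scale)
  qed
qed

section \<open>The greedy coefficients\<close>

text \<open>The value at \<open>c\<close> is prescribed in terms of those at indices of smaller weight: \<open>k\<close> with its constant term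
  removed never pairs \<open>c\<close> with \<open>0\<close>.\<close>

lemma conv_recursion:
  fixes \<Phi> :: "nat ^ 'd::finite \<Rightarrow> real \<Rightarrow> real"
  shows "\<exists>x. \<forall>c. x c = \<Phi> c (conv x (k(0 := 0)) c)"
proof -
  define x where "x = wfrec (Wellfounded.measure weight) (\<lambda>f c. \<Phi> c (conv f (k(0 := 0)) c))"
  have "x c = \<Phi> c (conv x (k(0 := 0)) c)" for c
  proof -
    have "x c = \<Phi> c (conv (cut x (Wellfounded.measure weight) c) (k(0 := 0)) c)"
      unfolding x_def by (subst wfrec) auto
    also have "conv (cut x (Wellfounded.measure weight) c) (k(0 := 0)) c = conv x (k(0 := 0)) c"
      by (rule conv_cong) (use weight_less_add in \<open>auto simp: cut_def\<close>)
    finally show ?thesis .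
  qed
  then show ?thesis by blast
qed

text \<open>Each \<open>F c\<close> is the least non-negative number for which \<open>k \<le> F * k\<close> at \<open>c\<close>, so that equality holds whenever \<open>F c > 0\<close>. To bound \<open>F * l\<close> at \<open>m\<close>, let \<open>B\<close>
  be the set of indices \<open>i\<close> such that \<open>F > 0\<close> at \<open>m - i\<close>, and let \<open>x\<close> be the solution of \<open>x * k = l\<close> on \<open>B\<close> that vanishes off \<open>B\<close>. The
  test shows inductively that \<open>x * k \<le> l\<close> everywhere and hence \<open>x \<ge> 0\<close>. Since \<open>F\<close> lives on the
  complementary indices of \<open>B\<close>, associativity of convolution gives
  \<open>F * l = F * (x * k) = x * (F * k) = x * k \<le> l\<close> at \<open>m\<close>.\<close>

theorem greedy_coefficients:
  fixes k l :: "nat ^ 'd::finite \<Rightarrow> real"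
  assumes pos: "\<And>a. 0 < k a" "\<And>a. 0 < l a"
    and test: "\<And>x m. (\<And>a. 0 \<le> x a) \<Longrightarrow> (\<And>a. weight m \<le> weight a \<Longrightarrow> x a = 0) \<Longrightarrow>
      (\<And>a. weight a < weight m \<Longrightarrow> conv x k a \<le> l a) \<Longrightarrow> conv x k m \<le> l m"
  obtains F where "F 0 = 0" "\<And>c. 0 \<le> F c" "\<And>c. c \<noteq> 0 \<Longrightarrow> k c \<le> conv F k c" "\<And>c. c \<noteq> 0 \<Longrightarrow> conv F l c \<le> l c"
proof -
  obtain F where F: "\<And>c. F c = (if c = 0 then 0 else max 0 ((k c - conv F (k(0 := 0)) c) / k 0))"
    using conv_recursion[of "\<lambda>c s. if c = 0 then 0 else max 0 ((k c - s) / k 0)" k] by blast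
  have k0: "0 < k 0" by (rule pos)
  have F0: "F 0 = 0" and F_nn: "0 \<le> F c" for c by (subst F, simp)+
  have Fk: "k c \<le> conv F k c" if "c \<noteq> 0" for c
  proof -
    have "(k c - conv F (k(0 := 0)) c) / k 0 \<le> F c"
      using that F[of c] by simp
    then have "k c - conv F (k(0 := 0)) c \<le> F c * k 0" using k0 by (simp only: divide_le_eq if_True)
    then show ?thesis by (subst conv_split) simp
  qed
  have Fk_eq: "conv F k c = k c" if "0 < F c" for c
  proof -
    have "F c = (k c - conv F (k(0 := 0)) c) / k 0"
      using that F[of c] by (auto split: if_splits)
    then show ?thesis using k0 by (subst conv_split) (simp add: field_simps)
  qed
  have "conv F l m \<le> l m" if m: "m \<noteq> 0" for m
  proof -
    define B where "B i \<longleftrightarrow> (\<exists>j. j \<noteq> 0 \<and> i + j = m \<and> 0 < F j)" for i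
    obtain x where x: "\<And>i. x i = (if B i then (l i - conv x (k(0 := 0)) i) / k 0 else 0)"
      using conv_recursion[of "\<lambda>i s. if B i then (l i - s) / k 0 else 0" k] by blast
    have xk_eq: "conv x k i = l i" if "B i" for i
    proof -
      have "x i = (l i - conv x (k(0 := 0)) i) / k 0" using that x[of i] by simp
      then show ?thesis using k0 by (subst conv_split) (simp add: field_simps)
    qed
    have "0 \<le> x i \<and> conv x k i \<le> l i" for i
    proof (induction "weight i" arbitrary: i rule: less_induct)
      case less
      \<comment> \<open>The test is applied at \<open>i\<close> to the part of \<open>x\<close> that is known to be non-negative.\<close>
      define y where "y a = (if weight a < weight i then x a else 0)" for a
      have yx: "conv y (k(0 := 0)) i = conv x (k(0 := 0)) i"
        by (rule conv_cong) (use weight_less_add in \<open>auto simp: y_def\<close>)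
      have "conv y k i \<le> l i"
      proof (rule test)
        fix a :: "nat ^ 'd" assume a: "weight a < weight i"
        have "conv y k a = conv x k a"
        proof (rule conv_cong)
          fix b c :: "nat ^ 'd" assume "b + c = a"
          then have "weight b \<le> weight a" by (auto simp: weight_add Suc_leI)
          then show "y b * k c = x b * k c" using a by (simp add: y_def)
        qed
        then show "conv y k a \<le> l a" using less a by simp
      qed (use less in \<open>auto simp: y_def\<close>)
      then have le: "conv x (k(0 := 0)) i \<le> l i"
        by (subst (asm) conv_split) (simp add: yx y_def)
      show ?case
      proof
        show "0 \<le> x i" using le k0 by (subst x) simp
        show "conv x k i \<le> l i"
        proof (cases "B i")
          case True
          then show ?thesis using xk_eq by simp
        next
          case False
          then have "x i = 0" using x[of i] by simp
          then show ?thesis using le by (subst conv_split) simp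
        qed
      qed
    qed
    then have xm: "conv x k m \<le> l m" by blast
    have "conv F l m = conv F (conv x k) m"
    proof (rule conv_cong)
      fix j i assume ji: "j + i = m"
      show "F j * l i = F j * conv x k i"
      proof (cases "0 < F j")
        case True
        then have "B i" using ji F0 unfolding B_def by (intro exI[of _ j]) (auto simp: add.commute)
        then show ?thesis by (simp add: xk_eq)
      next
        case False
        then have "F j = 0" using F_nn[of j] by linarith
        then show ?thesis by simp
      qed
    qed
    also have "\<dots> = conv x (conv F k) m" by (rule conv_left_commute)
    also have "\<dots> = conv x k m"
    proof (rule conv_cong)
      fix i j assume ij: "i + j = m"
      show "x i * conv F k j = x i * k j"
      proof (cases "B i")
        case True
        then have "0 < F j" using ij by (auto simp: B_def)
        then show ?thesis by (simp add: Fk_eq)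
      next
        case False
        then have "x i = 0" using x[of i] by simp
        then show ?thesis by simp
      qed
    qed
    finally show ?thesis using xm by simp
  qed
  with F0 F_nn Fk show ?thesis by (rule that)
qed

section \<open>Complete Pick pairs of diagonal holomorphic kernels\<close>

lemma psd_diag_series:
  assumes f: "diag_series \<Omega> c f" and c: "\<And>a. 0 \<le> c a" shows "psd \<Omega> f"
proof (rule psd_limit)
  show "((\<lambda>S. \<Sum>a\<in>S. of_real (c a) * (vec_monom z a * cnj (vec_monom w a))) \<longlongrightarrow> f z w) (finite_subsets_at_top UNIV)"
    if "z \<in> \<Omega>" "w \<in> \<Omega>" for z w
    using f that by (auto simp: diag_series_def has_sum_def)
  show "\<forall>\<^sub>F S in finite_subsets_at_top UNIV. psd \<Omega> (\<lambda>z w. \<Sum>a\<in>S. of_real (c a) * (vec_monom z a * cnj (vec_monom w a)))"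
    by (intro always_eventually allI psd_sum psd_scale psd_rank_one) (use c in \<open>auto simp: less_eq_complex_def\<close>)
qed simp

lemma growth_mono:
  assumes s: "(\<lambda>a. c a / real (weight a) ^ M) summable_on UNIV" and c: "\<And>a. 0 < c a" and M: "M \<le> M'"
  shows "(\<lambda>a. c a / real (weight a) ^ M') summable_on UNIV"
proof (rule summable_comparison[OF s])
  have "1 \<le> real (weight a)" for a :: "nat ^ 'a" using weight_pos[of a] by linarith
  then show "norm (c a / real (weight a) ^ M') \<le> c a / real (weight a) ^ M" for a
    using less_imp_le[OF c] M by (auto intro!: divide_left_mono power_increasing)
qed

text \<open>The greedy kernel \<open>F\<close> satisfies \<open>F l \<le> l - l\<^sub>0\<close> and \<open>k - k\<^sub>0 \<le> F k\<close>, where positivity can be read off the coefficients.\<close>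

theorem strong_certificate_of_complete_pick_pair:
  fixes \<Omega> :: "(complex ^ 'd::finite) set"
  assumes \<Omega>: "open \<Omega>" "0 \<in> \<Omega>" and pick: "complete_pick_pair \<Omega> k l"
    and pos: "\<And>a. 0 < ck a" "\<And>a. 0 < cl a" and k: "diag_series \<Omega> ck k" and l: "diag_series \<Omega> cl l"
    and Mk: "(\<lambda>a. ck a / real (weight a) ^ M) summable_on UNIV" and Ml: "(\<lambda>a. cl a / real (weight a) ^ M) summable_on UNIV"
  shows "\<exists>s. strong_shimorin_certificate \<Omega> k l s"
proof -
  obtain r where r: "0 < r" "ball 0 r \<subseteq> \<Omega>" using \<Omega> by (metis openE)
  have k0: "0 < ck 0" and l0: "0 < cl 0" by (rule pos)+
  obtain F where F0: "F 0 = 0" and F: "\<And>c. 0 \<le> F c" and Fk: "\<And>c. c \<noteq> 0 \<Longrightarrow> ck c \<le> conv F ck c"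
    and Fl: "\<And>c. c \<noteq> 0 \<Longrightarrow> conv F cl c \<le> cl c"
  proof (rule greedy_coefficients[OF pos])
    show "conv x ck m \<le> cl m"
      if "\<And>a. 0 \<le> x a" "\<And>a. weight m \<le> weight a \<Longrightarrow> x a = 0" "\<And>a. weight a < weight m \<Longrightarrow> conv x ck a \<le> cl a" for x m
      by (rule coefficient_test[OF pick r pos k l Mk Ml that])
  qed (rule that)
  have conv0: "conv F g 0 = 0" for g :: "nat ^ 'd \<Rightarrow> real"
    by (simp add: conv_0 F0)
  \<comment> \<open>The series with the greedy coefficients converges, because they are dominated by those of \<open>l\<close>.\<close>
  define \<Phi> where "\<Phi> z w = (\<Sum>\<^sub>\<infinity>a. of_real (F a) * (vec_monom z a * cnj (vec_monom w a)))" for z w :: "complex ^ 'd"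
  have F_le: "F c \<le> cl c / cl 0" for c
  proof -
    have "F c * cl 0 \<le> conv F cl c"
      unfolding conv_split[of F cl c] using conv_nonneg[of F "cl(0 := 0)" c] F less_imp_le[OF pos(2)] by simp
    also have "\<dots> \<le> cl c" using Fl[of c] conv0[of cl] l0 by (cases "c = 0") auto
    finally show ?thesis using l0 by (simp add: le_divide_eq)
  qed
  have \<Phi>: "diag_series \<Omega> F \<Phi>"
    unfolding diag_series_def
  proof (intro ballI conjI)
    fix z w assume zw: "z \<in> \<Omega>" "w \<in> \<Omega>"
    let ?m = "\<lambda>a. vec_monom z a * cnj (vec_monom w a)"
    have "(\<lambda>a. 1 / cl 0 * norm (of_real (cl a) * ?m a)) summable_on UNIV"
      using l zw by (intro summable_on_cmult_right) (auto simp: diag_series_def)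
    then show s: "(\<lambda>a. norm (of_real (F a) * ?m a)) summable_on UNIV"
    proof (rule Infinite_Sum.abs_summable_on_comparison_test')
      fix a
      have "F a * norm (?m a) \<le> cl a / cl 0 * norm (?m a)" by (intro mult_right_mono F_le) auto
      then show "norm (of_real (F a) * ?m a) \<le> 1 / cl 0 * norm (of_real (cl a) * ?m a)"
        using F[of a] pos(2)[of a] by (simp add: norm_mult)
    qed
    show "((\<lambda>a. of_real (F a) * ?m a) has_sum \<Phi> z w) UNIV"
      unfolding \<Phi>_def by (rule has_sum_infsum[OF abs_summable_summable[OF s]])
  qed
  have nn: "0 \<le> ck a" "0 \<le> cl a" for a by (rule less_imp_le, rule pos)+
  note \<Phi>k = diag_series_conv[OF \<Phi> k F nn(1)] and \<Phi>l = diag_series_conv[OF \<Phi> l F nn(2)]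
  have \<Phi>_psd: "psd \<Omega> \<Phi>" by (rule psd_diag_series[OF \<Phi> F])
  have G: "psd \<Omega> (\<lambda>z w. l z w - \<Phi> z w * l z w)"
  proof (rule psd_diag_series[OF diag_series_diff[OF l \<Phi>l]])
    show "0 \<le> cl a - conv F cl a" for a using Fl[of a] conv0[of cl] l0 by (cases "a = 0") auto
  qed
  have G0: "psd \<Omega> (\<lambda>z w. (l z w - \<Phi> z w * l z w) - of_real (cl 0))"
  proof (rule psd_diag_series[OF diag_series_diff[OF diag_series_diff[OF l \<Phi>l] diag_series_const]])
    show "0 \<le> cl a - conv F cl a - (if a = 0 then cl 0 else 0)" for a using Fl[of a] conv0[of cl] by auto
  qed
  have H: "psd \<Omega> (\<lambda>z w. (\<Phi> z w * k z w - k z w) + of_real (ck 0))"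
  proof (rule psd_diag_series[OF diag_series_add[OF diag_series_diff[OF \<Phi>k k] diag_series_const]])
    show "0 \<le> conv F ck a - ck a + (if a = 0 then ck 0 else 0)" for a using Fk[of a] conv0[of ck] by auto
  qed
  \<comment> \<open>\<open>(1 - F) l\<close> is at least the constant \<open>l\<^sub>0 > 0\<close>.\<close>
  have lt: "Re (\<Phi> z z) < 1" if z: "z \<in> \<Omega>" for z
  proof -
    obtain p where p: "\<Phi> z z = of_real p" "0 \<le> p" using psd_diag[OF \<Phi>_psd z] by (auto simp: complex_nonneg_iff)
    obtain q where q: "l z z = of_real q" "0 \<le> q"
      using psd_diag[OF psd_diag_series[OF l nn(2)] z] by (auto simp: complex_nonneg_iff)
    have "cl 0 \<le> q - p * q" using psd_diag[OF G0 z] by (simp add: p q less_eq_complex_def)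
    then have "0 < (1 - p) * q" using l0 by (simp add: algebra_simps)
    then show ?thesis using q(2) p(1) by (auto simp: zero_less_mult_iff)
  qed
  have ne: "1 - \<Phi> z w \<noteq> 0" if "z \<in> \<Omega>" "w \<in> \<Omega>" for z w
    using psd_geometric(1)[OF \<Phi>_psd lt that] by auto
  define s where "s z w = of_real (ck 0) / (1 - \<Phi> z w)" for z w
  define h where "h z w = of_real (1 / ck 0) * ((\<Phi> z w * k z w - k z w) + of_real (ck 0))" for z w
  define g where "g z w = of_real (1 / ck 0) * (l z w - \<Phi> z w * l z w)" for z w
  have X: "\<Omega> \<noteq> {}" using \<Omega> by auto
  have "complete_pick_kernel \<Omega> s" unfolding s_def by (rule complete_pick_kernel_of_ball_kernel[OF X \<Phi>_psd lt k0])
  moreover have "psd_kernel \<Omega> h" "psd_kernel \<Omega> g"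
    unfolding h_def g_def psd_kernel_iff using X k0
    by (intro conjI psd_scale H G; simp add: less_eq_complex_def)+
  moreover have "k z w = (1 - h z w) * s z w \<and> l z w = s z w * g z w" if "z \<in> \<Omega>" "w \<in> \<Omega>" for z w
    using ne[OF that] k0 unfolding s_def h_def g_def by (simp add: field_simps)
  ultimately have "strong_shimorin_certificate \<Omega> k l s" unfolding strong_shimorin_certificate_def by blast
  then show ?thesis by blast
qed

theorem theorem1p4:
  fixes \<Omega> :: "(complex ^ 'd) set"
    and k l :: "complex ^ 'd \<Rightarrow> complex ^ 'd \<Rightarrow> complex"
  assumes "open \<Omega>" and "connected \<Omega>" and "0 \<in> \<Omega>"
    and "diagonal_holomorphic_kernel \<Omega> k" and "diagonal_holomorphic_kernel \<Omega> l"
  shows "complete_pick_pair \<Omega> k l \<longleftrightarrow> (\<exists>s. strong_shimorin_certificate \<Omega> k l s)"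
proof -
  obtain ck Mk where ck: "\<And>a. 0 < ck a" "diag_series \<Omega> ck k" "(\<lambda>a. ck a / real (weight a) ^ Mk) summable_on UNIV"
    using diagonal_kernel_series[OF assms(1-4)] by blast
  obtain cl Ml where cl: "\<And>a. 0 < cl a" "diag_series \<Omega> cl l" "(\<lambda>a. cl a / real (weight a) ^ Ml) summable_on UNIV"
    using diagonal_kernel_series[OF assms(1-3,5)] by blast
  have kl: "psd_kernel \<Omega> k" "psd_kernel \<Omega> l" using assms(4,5) by (auto simp: diagonal_holomorphic_kernel_def)
  show ?thesis
  proof
    assume pick: "complete_pick_pair \<Omega> k l"
    show "\<exists>s. strong_shimorin_certificate \<Omega> k l s"
      by (rule strong_certificate_of_complete_pick_pair[OF assms(1,3) pick ck(1) cl(1) ck(2) cl(2)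
            growth_mono[OF ck(3,1) max.cobounded1] growth_mono[OF cl(3,1) max.cobounded2]])
  next
    assume "\<exists>s. strong_shimorin_certificate \<Omega> k l s"
    then obtain s where s: "strong_shimorin_certificate \<Omega> k l s" by blast
    show "complete_pick_pair \<Omega> k l"
    proof (rule complete_pick_pair_of_strong_certificate[OF kl s assms(3)])
      show "k z 0 \<noteq> 0" if "z \<in> \<Omega>" for z
        using ck(1)[of 0] diag_series_zero(1)[OF ck(2) that assms(3)] by simp
      have l: "psd \<Omega> l" using kl by (simp add: psd_kernel_iff)
      show "l w w \<noteq> 0" if "w \<in> \<Omega>" for w
        using cl(1)[of 0] diag_series_zero(1)[OF cl(2) that assms(3)] psd_zero_row(1)[OF l that assms(3)] by auto
    qed
  qed
qed

end
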